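(* Let $\Delta$ be a simplicial complex on vertex set $[n]=\{1,\dots,n\}$ such that every vertex $\{i\}$ is a face of $\Delta$, and let $\Delta^*$ be its Alexander dual. If $\Delta^*$ is sequentially Cohen–Macaulay over $k$, then the face ring $k[\Delta]$ is a $\mathcal{K}_2$ algebra.
   Context: $k$ is a field. The Stanley–Reisner ideal $I_\Delta\subset S=k[x_1,\dots,x_n]$ is generated by the monomials $\prod_{i\in\tau}x_i$ for $\tau\subset[n]$, $\tau\notin\Delta$; the face ring is $k[\Delta]=S/I_\Delta$. The Alexander dual is $\Delta^*=\{[n]\setminus\tau:\tau\notin\Delta\}$. For $\tau\in\Delta$, $\mathrm{link}_\Delta\tau=\{\sigma\in\Delta:\sigma\cap\tau=\emptyset,\ \sigma\cup\tau\in\Delta\}$. $\Delta$ is Cohen–Macaulay over $k$ if it is pure (all maximal faces have the same dimension) and $\tilde H_i(\mathrm{link}_\Delta\tau,k)=0$ for all $\tau\in\Delta$ and all $i<\dim\mathrm{link}_\Delta\tau$. For $q\in\mathbb{N}$, $\Delta(q)$ is the subcomplex of $\Delta$ whose maximal faces are the $q$-dimensional faces of $\Delta$; $\Delta$ is sequentially Cohen–Macaulay over $k$ if $\Delta(q)$ is Cohen–Macaulay over $k$ for all $q$. For a graded $k$-algebra $A$ (connected, $\mathbb{N}$-graded, locally finite, generated in degree 1), $E(A)=\mathrm{Ext}_A(k,k)$ is its Yoneda algebra, bigraded by cohomological degree $i$ and internal degree, with $E^i(A)$ the cohomological degree $i$ part; $A$ is a $\mathcal{K}_2$ algebra if $E(A)$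 is generated as a $k$-algebra by $E^1(A)$ and $E^2(A)$. *)

theory Defs
  imports Main
begin

definition simplicial_complex :: "nat \<Rightarrow> nat set set \<Rightarrow> bool" where
  "simplicial_complex n D \<longleftrightarrow> {} \<in> D \<and> (\<forall>F\<in>D. F \<subseteq> {1..n}) \<and> (\<forall>F\<in>D. \<forall>G. G \<subseteq> F \<longrightarrow> G \<in> D)"

definition alexander_dual :: "nat \<Rightarrow> nat set set \<Rightarrow> nat set set" where
  "alexander_dual n D = {{1..n} - \<tau> | \<tau>. \<tau> \<subseteq> {1..n} \<and> \<tau> \<notin> D}"

definition link :: "nat set set \<Rightarrow> nat set \<Rightarrow> nat set set" where
  "link D \<tau> = {\<sigma> \<in> D. \<sigma> \<inter> \<tau> = {} \<and> \<sigma> \<union> \<tau> \<in> D}"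

definition facet :: "nat set set \<Rightarrow> nat set \<Rightarrow> bool" where
  "facet D F \<longleftrightarrow> F \<in> D \<and> (\<forall>G\<in>D. F \<subseteq> G \<longrightarrow> G = F)"

definition pure_complex :: "nat set set \<Rightarrow> bool" where
  "pure_complex D \<longleftrightarrow> (\<forall>F G. facet D F \<longrightarrow> facet D G \<longrightarrow> card F = card G)"

section \<open>Reduced simplicial homology over a field (faces indexed by cardinality j = dim + 1)\<close>

text \<open>Simplicial boundary with the orientation induced by the order of nat:
  coefficient of G in the boundary of c.\<close>
definition bd :: "nat set set \<Rightarrow> (nat set \<Rightarrow> 'k::field) \<Rightarrow> nat set \<Rightarrow> 'k" where
  "bd L c G = (\<Sum>v\<in>{v. v \<notin> G \<and> insert v G \<in> L}. (-1) ^ card {u\<in>G. u < v} * c (insert v G))"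

definition chain_on :: "nat set set \<Rightarrow> nat \<Rightarrow> (nat set \<Rightarrow> 'k::field) \<Rightarrow> bool" where
  "chain_on L j c \<longleftrightarrow> (\<forall>F. c F \<noteq> 0 \<longrightarrow> F \<in> L \<and> card F = j)"

text \<open>reduced homology in dimension j - 1 (faces of cardinality j) vanishes; j = 0 is
  dimension -1 (the empty face).\<close>
definition red_hom_vanishes :: "'k::field itself \<Rightarrow> nat set set \<Rightarrow> nat \<Rightarrow> bool" where
  "red_hom_vanishes K L j \<longleftrightarrow>
     (\<forall>c :: nat set \<Rightarrow> 'k. chain_on L j c \<and> (\<forall>G. card G + 1 = j \<longrightarrow> bd L c G = 0) \<longrightarrow>
        (\<exists>b :: nat set \<Rightarrow> 'k. chain_on L (Suc j) b \<and> (\<forall>F. card F = j \<longrightarrow> c F = bd L b F)))"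

text \<open>Cohen--Macaulay: pure, and for every face tau, reduced homology of the link vanishes
  in all dimensions i < dim link, i.e. for all cardinalities j = i + 1 < Max card.\<close>
definition cohen_macaulay :: "'k::field itself \<Rightarrow> nat set set \<Rightarrow> bool" where
  "cohen_macaulay K D \<longleftrightarrow> pure_complex D \<and>
     (\<forall>\<tau>\<in>D. \<forall>j < Max (card ` link D \<tau>). red_hom_vanishes K (link D \<tau>) j)"

definition pure_skeleton :: "nat set set \<Rightarrow> nat \<Rightarrow> nat set set" where
  "pure_skeleton D q = {G. \<exists>F\<in>D. card F = Suc q \<and> G \<subseteq> F}"

definition seq_CM :: "'k::field itself \<Rightarrow> nat set set \<Rightarrow> bool" where
  "seq_CM K D \<longleftrightarrow> (\<forall>q. cohen_macaulay K (pure_skeleton D q))"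

section \<open>Face ring via its monomial basis, and its Yoneda algebra via the (reduced) bar construction\<close>

type_synonym mono = "nat \<Rightarrow> nat"

definition msupp :: "mono \<Rightarrow> nat set" where
  "msupp m = {i. m i \<noteq> 0}"

text \<open>standard monomial of positive degree of k[D] (basis of the augmentation ideal)\<close>
definition std_pos :: "nat set set \<Rightarrow> mono \<Rightarrow> bool" where
  "std_pos D m \<longleftrightarrow> msupp m \<in> D \<and> msupp m \<noteq> {}"

definition mdeg :: "mono \<Rightarrow> nat" where
  "mdeg m = (\<Sum>i\<in>msupp m. m i)"

definition madd :: "mono \<Rightarrow> mono \<Rightarrow> mono" where
  "madd m m' = (\<lambda>v. m v + m' v)"

definition admissible :: "nat set set \<Rightarrow> nat \<Rightarrow> nat \<Rightarrow> mono list \<Rightarrow> bool" where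
  "admissible D i d ms \<longleftrightarrow> length ms = i \<and> (\<forall>m\<in>set ms. std_pos D m) \<and> sum_list (map mdeg ms) = d"

definition merge_at :: "nat \<Rightarrow> mono list \<Rightarrow> mono list" where
  "merge_at j ms = take j ms @ [madd (ms ! j) (ms ! Suc j)] @ drop (Suc (Suc j)) ms"

text \<open>bar cochains of cohomological degree i and internal degree d\<close>
definition cochain :: "nat set set \<Rightarrow> nat \<Rightarrow> nat \<Rightarrow> (mono list \<Rightarrow> 'k::field) \<Rightarrow> bool" where
  "cochain D i d f \<longleftrightarrow> (\<forall>ms. f ms \<noteq> 0 \<longrightarrow> admissible D i d ms)"

text \<open>dual of the bar differential; a product of basis monomials is zero in k[D] iff its
  support is not a face\<close>
definition cobd :: "nat set set \<Rightarrow> (mono list \<Rightarrow> 'k::field) \<Rightarrow> mono list \<Rightarrow> 'k" where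
  "cobd D f ms = (if (\<forall>m\<in>set ms. std_pos D m) then
     (\<Sum>j<length ms - 1. if msupp (madd (ms ! j) (ms ! Suc j)) \<in> D
        then (-1) ^ j * f (merge_at j ms) else 0) else 0)"

definition cocycle :: "nat set set \<Rightarrow> nat \<Rightarrow> nat \<Rightarrow> (mono list \<Rightarrow> 'k::field) \<Rightarrow> bool" where
  "cocycle D i d f \<longleftrightarrow> cochain D i d f \<and> (\<forall>ms. cobd D f ms = 0)"

text \<open>cup product on bar cochains (induces the Yoneda product up to sign)\<close>
definition cup :: "nat \<Rightarrow> (mono list \<Rightarrow> 'k::field) \<Rightarrow> (mono list \<Rightarrow> 'k) \<Rightarrow> mono list \<Rightarrow> 'k" where
  "cup i f g ms = f (take i ms) * g (drop i ms)"

inductive_set gen12 :: "nat set set \<Rightarrow> (nat \<times> nat \<times> (mono list \<Rightarrow> 'k::field)) set"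
  for D :: "nat set set" where
  g1: "cocycle D 1 d z \<Longrightarrow> (1, d, z) \<in> gen12 D"
| g2: "cocycle D 2 d z \<Longrightarrow> (2, d, z) \<in> gen12 D"
| gmul: "(i, d, f) \<in> gen12 D \<Longrightarrow> (j, e, g) \<in> gen12 D \<Longrightarrow> (i + j, d + e, cup i f g) \<in> gen12 D"

text \<open>K2: every class in E^i (i \<ge> 1), of every internal degree, is a linear combination of
  products of classes from E^1 and E^2 (E^0 = k is the span of the unit).\<close>
definition K2_face_ring :: "'k::field itself \<Rightarrow> nat set set \<Rightarrow> bool" where
  "K2_face_ring K D \<longleftrightarrow>
     (\<forall>i d (z :: mono list \<Rightarrow> 'k). 1 \<le> i \<and> cocycle D i d z \<longrightarrow>
        (\<exists>(fs :: ('k \<times> (mono list \<Rightarrow> 'k)) list) (g :: mono list \<Rightarrow> 'k).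
           (\<forall>(c, f)\<in>set fs. (i, d, f) \<in> gen12 D) \<and> cochain D (i - 1) d g \<and>
           (\<forall>ms. z ms = (\<Sum>(c, f)\<leftarrow>fs. c * f ms) + cobd D g ms)))"

end

theory Submission
  imports Defs
begin

text \<open>
  Let \<open>S\<close> be the polynomial ring, \<open>I\<close> the Stanley--Reisner ideal and \<open>R = S/I\<close>. The bar cochains \<open>C(R)\<close>
  are a subalgebra of \<open>C(S)\<close>, consisting of the cochains supported on words in face monomials, and
  \<open>C(S)\<close> has cohomology the exterior algebra. Sequential Cohen--Macaulayness of the dual says that
  \<open>Ext(I, k)\<close> over \<open>S\<close> is generated by \<open>Hom(I, k)\<close> as a module over that exterior algebra: its classes are
  spanned by the cochains \<open>g|x\<^sub>1|...|x\<^sub>t\<close> dual to a minimal nonface \<open>g\<close> followed by variables. These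
  cochains are cocycles modulo \<open>C(R)\<close>, so by filtering words by the length of their prefix of face
  monomials, every cocycle of \<open>C(S)/C(R)\<close> is cohomologous to a sum of products \<open>c \<cdot> (g|x\<^sub>1|...|x\<^sub>t)\<close>
  with \<open>c\<close> a cocycle of \<open>C(R)\<close>.
  Given a cocycle \<open>z\<close> of \<open>C(R)\<close>, write \<open>z = \<lambda> + dy\<close> in \<open>C(S)\<close> with \<open>\<lambda>\<close> a combination of products of
  variables. Decomposing \<open>y\<close> modulo \<open>C(R)\<close> shows that, up to a coboundary, \<open>z\<close> is a sum of products of
  cocycles \<open>c\<close> of lower degree, of the degree two classes \<open>dg\<close>, and of the degree one classes \<open>x\<^sub>i\<close>.
\<close>

section \<open>The bar differential\<close>

text \<open>Write \<open>m\<close> for the maximal ideal of \<open>S\<close>. That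
  \<open>Ext(I, k)\<close> is generated by \<open>Hom(I, k)\<close> means that
  \<open>Ext(I/mI, k) -> Ext(I, k)\<close> is onto, or dually that
  \<open>Tor(mI, k) -> Tor(I, k)\<close> vanishes. In a squarefree multidegree \<sigma> the Koszul
  complex of \<open>I\<close> is, up to a shift, the chain complex of the link of
  \<open>{1..n} - \<sigma>\<close> in the Alexander dual, and that of \<open>mI\<close> uses only
  the faces that are not maximal in this link. Such faces of one cardinality lie in the link taken
  in a single pure skeleton of larger dimension, where Cohen--Macaulayness kills the homology. The
  other multidegrees are cones. Two obstacles shape the rest. The vanishing concerns Koszul
  complexes, the claim concerns words, so the two are compared explicitly, using a discrete Morse
  matching as a contraction. And cells can be dependent in \<open>Ext(I, k)\<close>, so that their
  coefficients are not determined and need not be cocycles; a minimal spanning set of cells repairs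
  this. The term \<lambda> comes from the same result for the ideal \<open>m\<close>, that is, for
  the complex \<open>{{}}\<close>.\<close>

lemma madd_assoc: "madd (madd a b) c = madd a (madd b c)"
  by (simp add: madd_def add.assoc)

lemma madd_comm: "madd a b = madd b a"
  by (simp add: madd_def add.commute)

lemma msupp_madd [simp]: "msupp (madd a b) = msupp a \<union> msupp b"
  by (auto simp: msupp_def madd_def)

text \<open>The coboundary of \<open>C(S)\<close>: a product of monomials is never zero in the
  polynomial ring, so the face test of \<open>cobd\<close> disappears, and the alternating signs
  come from the recursion.\<close>

fun bar_d :: "(mono list \<Rightarrow> 'k::field) \<Rightarrow> mono list \<Rightarrow> 'k" where
  "bar_d f (a # b # w) = f (madd a b # w) - bar_d (\<lambda>w. f (a # w)) (b # w)"
| "bar_d f [a] = 0"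
| "bar_d f [] = 0"

fun merges :: "mono list \<Rightarrow> mono list set" where
  "merges (a # b # w) = insert (madd a b # w) ((#) a ` merges (b # w))"
| "merges [a] = {}"
| "merges [] = {}"

lemma bar_d_cong:
  assumes "\<And>w'. w' \<in> merges w \<Longrightarrow> f w' = g w'"
  shows "bar_d f w = bar_d g w"
  using assms
proof (induction w arbitrary: f g rule: merges.induct)
  case (1 a b w)
  have "bar_d (\<lambda>w. f (a # w)) (b # w) = bar_d (\<lambda>w. g (a # w)) (b # w)"
    by (rule "1.IH") (use "1.prems" in auto)
  then show ?case using "1.prems" by simp
qed auto

lemma bar_d_eq_0: "(\<And>w'. w' \<in> merges w \<Longrightarrow> f w' = 0) \<Longrightarrow> bar_d f w = 0"
proof -
  assume a: "\<And>w'. w' \<in> merges w \<Longrightarrow> f w' = 0"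
  have "bar_d (\<lambda>_. 0::'a) w = 0"
    by (induction w rule: merges.induct) auto
  then show ?thesis using bar_d_cong[of w f "\<lambda>_. 0"] a by simp
qed

lemma bar_d_add: "bar_d (\<lambda>w. f w + g w) w = bar_d f w + bar_d g w"
  by (induction w arbitrary: f g rule: merges.induct) auto

lemma bar_d_diff: "bar_d (\<lambda>w. f w - g w) w = bar_d f w - bar_d g w"
  by (induction w arbitrary: f g rule: merges.induct) auto

lemma bar_d_scale: "bar_d (\<lambda>w. c * f w) w = c * bar_d f w"
  by (induction w arbitrary: f rule: merges.induct) (auto simp: algebra_simps)

lemma bar_d_sum: "bar_d (\<lambda>w. \<Sum>x\<in>A. f x w) w = (\<Sum>x\<in>A. bar_d (f x) w)"
proof (induction A rule: infinite_finite_induct)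
  case (insert x A)
  then show ?case by (simp add: bar_d_add)
qed (auto intro: bar_d_eq_0)

lemma bar_d_bar_d: "bar_d (bar_d f) w = 0"
proof (induction w arbitrary: f rule: merges.induct)
  case (1 a b w)
  show ?case
  proof (cases w)
    case (Cons c w')
    have IH: "bar_d (bar_d (\<lambda>w. f (a # w))) (b # w) = 0" by (rule "1.IH")
    show ?thesis using IH
      by (simp add: Cons bar_d_diff madd_assoc)
  qed simp
qed auto

text \<open>Leibniz rule. A merge at a position below \<open>p\<close> stays inside the first
  \<open>Suc p\<close> letters, any other inside the letters from position \<open>p\<close> on;
  hence the two different cuts of \<open>w\<close>.\<close>

lemma bar_d_cup:
  "p < length w \<Longrightarrow> bar_d (cup p f g) w =
     bar_d f (take (Suc p) w) * g (drop (Suc p) w) + (-1) ^ p * (f (take p w) * bar_d g (drop p w))"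
proof (induction p arbitrary: f w)
  case 0
  have "cup 0 f g = (\<lambda>w. f [] * g w)" by (simp add: cup_def fun_eq_iff)
  moreover have "bar_d f (take (Suc 0) w) = 0" by (cases w) auto
  ultimately show ?case by (simp add: bar_d_scale)
next
  case (Suc p)
  obtain a b w' where w: "w = a # b # w'"
    using Suc.prems by (cases w rule: merges.cases) auto
  have eq: "(\<lambda>v. cup (Suc p) f g (a # v)) = cup p (\<lambda>v. f (a # v)) g"
    by (simp add: cup_def fun_eq_iff)
  have IH: "bar_d (cup p (\<lambda>v. f (a # v)) g) (b # w') =
     bar_d (\<lambda>v. f (a # v)) (take (Suc p) (b # w')) * g (drop (Suc p) (b # w'))
     + (-1) ^ p * (f (a # take p (b # w')) * bar_d g (drop p (b # w')))"
    by (rule Suc.IH) (use Suc.prems w in auto)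
  have "bar_d (cup (Suc p) f g) w =
      f (madd a b # take p w') * g (drop p w') - bar_d (cup p (\<lambda>v. f (a # v)) g) (b # w')"
    by (simp only: w bar_d.simps eq) (simp add: cup_def)
  also have "\<dots> = bar_d f (take (Suc (Suc p)) w) * g (drop (Suc (Suc p)) w)
      + (-1) ^ Suc p * (f (take (Suc p) w) * bar_d g (drop (Suc p) w))"
    unfolding IH by (simp add: w left_diff_distrib)
  finally show ?case .
qed

lemma length_merges: "w' \<in> merges w \<Longrightarrow> length w = Suc (length w')"
  by (induction w arbitrary: w' rule: merges.induct) auto

lemma merge_at_Cons: "merge_at (Suc j) (a # w) = a # merge_at j w"
  by (simp add: merge_at_def)

lemma bar_d_eq_sum: "bar_d f w = (\<Sum>j<length w - 1. (-1) ^ j * f (merge_at j w))"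
proof (induction w arbitrary: f rule: merges.induct)
  case (1 a b w)
  have "(\<Sum>j<length (a # b # w) - 1. (-1) ^ j * f (merge_at j (a # b # w))) =
     f (madd a b # w) + (\<Sum>j<length w. (-1) ^ Suc j * f (a # merge_at j (b # w)))"
    by (simp add: sum.lessThan_Suc_shift merge_at_Cons del: sum.lessThan_Suc power_Suc)
       (simp add: merge_at_def)
  then show ?case
    by (simp add: 1 sum_negf)
qed auto

definition valid :: "nat \<Rightarrow> mono list \<Rightarrow> bool" where
  "valid n w \<longleftrightarrow> (\<forall>m\<in>set w. msupp m \<noteq> {} \<and> msupp m \<subseteq> {1..n})"

lemma valid_simps [simp]:
  "valid n []"
  "valid n (m # w) \<longleftrightarrow> msupp m \<noteq> {} \<and> msupp m \<subseteq> {1..n} \<and> valid n w"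
  "valid n (w @ w') \<longleftrightarrow> valid n w \<and> valid n w'"
  by (auto simp: valid_def)

lemma valid_merges: "w' \<in> merges w \<Longrightarrow> valid n w \<Longrightarrow> valid n w'"
  by (induction w arbitrary: w' rule: merges.induct) auto

section \<open>A matching on the words of the bar complex of the polynomial ring\<close>

definition chi :: "nat set \<Rightarrow> mono" where
  "chi \<tau> = (\<lambda>i. if i \<in> \<tau> then 1 else 0)"

abbreviation var :: "nat \<Rightarrow> mono" where
  "var v \<equiv> chi {v}"

definition low :: "mono \<Rightarrow> nat" where
  "low m = (LEAST i. i \<in> msupp m)"

lemma msupp_chi [simp]: "msupp (chi \<tau>) = \<tau>"
  by (auto simp: msupp_def chi_def)

lemma low_var [simp]: "low (var v) = v"
  unfolding low_def by (rule Least_equality) auto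

lemma low_in: "msupp m \<noteq> {} \<Longrightarrow> low m \<in> msupp m"
  unfolding low_def by (metis LeastI_ex ex_in_conv)

lemma low_le: "i \<in> msupp m \<Longrightarrow> low m \<le> i"
  unfolding low_def by (rule Least_le)

lemma low_eqI: "i \<in> msupp m \<Longrightarrow> (\<And>j. j \<in> msupp m \<Longrightarrow> i \<le> j) \<Longrightarrow> low m = i"
  unfolding low_def by (rule Least_equality)

lemma low_madd:
  assumes "msupp a \<noteq> {}" "msupp b \<noteq> {}"
  shows "low (madd a b) = min (low a) (low b)"
proof (rule low_eqI)
  show "min (low a) (low b) \<in> msupp (madd a b)"
    using low_in[OF assms(1)] low_in[OF assms(2)] by (simp add: min_def)
  show "min (low a) (low b) \<le> j" if "j \<in> msupp (madd a b)" for j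
    using that low_le[of j a] low_le[of j b] by auto
qed

lemma madd_neq_var:
  assumes "msupp a \<noteq> {}" "msupp b \<noteq> {}"
  shows "madd a b \<noteq> var v"
proof
  assume eq: "madd a b = var v"
  have "msupp a \<union> msupp b = {v}" using eq msupp_chi[of "{v}"] msupp_madd[of a b] by simp
  then have "a v \<noteq> 0" "b v \<noteq> 0" using assms by (auto simp: msupp_def)
  moreover have "a v + b v = 1" using fun_cong[OF eq, of v] by (simp add: madd_def chi_def)
  ultimately show False by simp
qed

lemma madd_neq: "msupp b \<noteq> {} \<Longrightarrow> madd a b \<noteq> a"
  by (auto simp: madd_def msupp_def fun_eq_iff)

text \<open>The matching of discrete Morse theory for the bar resolution, with the rightmost possible move.
  Take the longest suffix of the word consisting of strictly increasing single variables. If the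
  letter before it is divisible by a smaller variable, its lowest variable can be split off
  (Up); otherwise that letter can be merged with the first variable of the suffix
  (Down). Words that are such a suffix are unmatched (Crit).\<close>

datatype word_kind = Crit | Up | Down

fun kind :: "mono list \<Rightarrow> word_kind" where
  "kind [] = Crit"
| "kind (m # w) = (if kind w = Crit then
      (if w = [] \<or> low m < low (hd w) then (if m = var (low m) then Crit else Up) else Down)
    else kind w)"

fun split_word :: "mono list \<Rightarrow> mono list" where
  "split_word [] = []"
| "split_word (m # w) = (if kind w = Crit then m(low m := m (low m) - 1) # var (low m) # w
     else m # split_word w)"

fun merge_word :: "mono list \<Rightarrow> mono list" where
  "merge_word (a # b # w) = (if kind (b # w) = Crit then madd a b # w else a # merge_word (b # w))"
| "merge_word [a] = [a]"
| "merge_word [] = []"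

text \<open>The coefficient with which \<open>bar_d\<close> evaluates a cochain at
  \<open>merge_word\<close> of a Down word.\<close>

fun merge_sign :: "mono list \<Rightarrow> 'k::field" where
  "merge_sign (a # b # w) = (if kind (b # w) = Crit then 1 else - merge_sign (b # w))"
| "merge_sign [a] = 1"
| "merge_sign [] = 1"

lemma merge_sign_sq [simp]: "merge_sign w * merge_sign w = (1::'k::field)"
  by (induction w rule: merge_sign.induct) auto

lemma merge_sign_cancel: "merge_sign w * (merge_sign w * x) = (x::'k::field)"
  by (simp add: mult.assoc[symmetric])

text \<open>Let \<open>b\<close> be the first variable of the increasing suffix and \<open>a\<close>
  the letter before it. As \<open>low b \<le> low a\<close>, the product has lowest variable
  \<open>low b\<close>, is not a single variable, and \<open>low b\<close> still precedes the rest
  of the suffix: the new word is Up, and splitting undoes the merge.\<close>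

lemma merge_word_Down:
  assumes "valid n b" "kind b = Down"
  shows "kind (merge_word b) = Up \<and> split_word (merge_word b) = b \<and> valid n (merge_word b)
    \<and> merge_word b \<in> merges b"
  using assms
proof (induction b rule: merges.induct)
  case (1 a b w)
  show ?case
  proof (cases "kind (b # w) = Crit")
    case True
    then have b: "b = var (low b)" "kind w = Crit" "w = [] \<or> low b < low (hd w)"
      by (auto split: if_splits)
    have le: "low b \<le> low a" using 1(3) True by (auto split: if_splits)
    have l: "low (madd a b) = low b" using 1(2) le by (simp add: low_madd)
    have nv: "madd a b \<noteq> var (low b)" using 1(2) by (intro madd_neq_var) auto
    have "(madd a b)(low b := madd a b (low b) - 1) = a"
      using fun_cong[OF b(1)] by (auto simp: madd_def chi_def fun_eq_iff)
    then show ?thesis using 1(2) True b l nv by auto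
  next
    case False
    then have d: "kind (b # w) = Down" using 1(3) by auto
    have IH: "kind (merge_word (b # w)) = Up \<and> split_word (merge_word (b # w)) = b # w
       \<and> valid n (merge_word (b # w)) \<and> merge_word (b # w) \<in> merges (b # w)"
      using "1.IH" 1(2) d by simp
    then show ?thesis using 1(2) d False by (simp del: kind.simps) (simp add: d)
  qed
qed (auto split: if_splits)

lemma split_word_Up:
  assumes "valid n a" "kind a = Up"
  shows "kind (split_word a) = Down \<and> merge_word (split_word a) = a \<and> valid n (split_word a)"
  using assms
proof (induction a)
  case (Cons m w)
  show ?case
  proof (cases "kind w = Crit")
    case True
    define u where "u = low m"
    define m' where "m' = m(u := m u - 1)"
    have m: "m \<noteq> var u" "w = [] \<or> u < low (hd w)"
      using Cons(3) True by (auto simp: u_def split: if_splits)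
    have u: "u \<in> msupp m" using Cons(2) low_in by (auto simp: u_def)
    have mm: "madd m' (var u) = m"
      using u by (auto simp: m'_def madd_def chi_def msupp_def fun_eq_iff)
    have ne: "msupp m' \<noteq> {}"
    proof
      assume "msupp m' = {}"
      then have "m' i = 0" for i by (auto simp: msupp_def)
      then have "madd m' (var u) = var u" by (simp add: madd_def)
      then show False using mm m by simp
    qed
    have sub: "msupp m' \<subseteq> msupp m" by (auto simp: m'_def msupp_def split: if_splits)
    have "u \<le> low m'" using low_in[OF ne] sub low_le u_def by blast
    then have "\<not> low m' < u" by simp
    moreover have "split_word (m # w) = m' # var u # w"
      using True by (simp add: m'_def u_def)
    ultimately show ?thesis using True m(2) mm ne sub Cons(2) by auto
  next
    case False
    then have up: "kind w = Up" using Cons(3) by auto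
    then have IH: "kind (split_word w) = Down" "merge_word (split_word w) = w" "valid n (split_word w)"
      using Cons by auto
    obtain b r where s: "split_word w = b # r" using IH(1) by (cases "split_word w") auto
    have "kind (b # r) = Down" using IH s by simp
    then show ?thesis using False IH s Cons(2)
      by (simp del: kind.simps) (simp add: up)
  qed
qed auto

section \<open>Increasing pairs, a statistic that makes the matching triangular\<close>

definition cross :: "nat \<Rightarrow> mono \<Rightarrow> mono \<Rightarrow> nat" where
  "cross n a b = (\<Sum>u\<in>{1..n}. \<Sum>v\<in>{u<..n}. a u * b v)"

lemma cross_madd_left: "cross n (madd a b) c = cross n a c + cross n b c"
  by (simp add: cross_def madd_def distrib_right sum.distrib)

lemma cross_madd_right: "cross n a (madd b c) = cross n a b + cross n a c"
  by (simp add: cross_def madd_def distrib_left sum.distrib)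

lemma cross_pos:
  assumes "msupp a \<noteq> {}" "msupp a \<subseteq> {1..n}" "msupp b \<noteq> {}" "msupp b \<subseteq> {1..n}" "low a < low b"
  shows "cross n a b > 0"
proof -
  have a: "low a \<in> msupp a" "low b \<in> msupp b" using assms low_in by auto
  then have "a (low a) * b (low b) > 0" by (auto simp: msupp_def)
  moreover have "low a \<in> {1..n}" "low b \<in> {low a<..n}" using a assms by auto
  ultimately show ?thesis unfolding cross_def
    by (metis (no_types, lifting) finite_atLeastAtMost finite_greaterThanAtMost neq0_conv sum_eq_0_iff)
qed

text \<open>Writing every letter as a decreasing product of variables, this counts the increasing pairs of
  the concatenated word. Merging letters re-sorts that word and can only destroy such pairs.\<close>

fun incs :: "nat \<Rightarrow> mono list \<Rightarrow> nat" where
  "incs n [] = 0"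
| "incs n (m # w) = (\<Sum>m'\<leftarrow>w. cross n m m') + incs n w"

lemma cross_merges: "w' \<in> merges w \<Longrightarrow> (\<Sum>m'\<leftarrow>w'. cross n m m') = (\<Sum>m'\<leftarrow>w. cross n m m')"
  by (induction w arbitrary: w' rule: merges.induct) (auto simp: cross_madd_right)

lemma incs_madd: "incs n (a # b # w) = cross n a b + incs n (madd a b # w)"
proof -
  have "(\<Sum>m'\<leftarrow>w. cross n (madd a b) m') = (\<Sum>m'\<leftarrow>w. cross n a m') + (\<Sum>m'\<leftarrow>w. cross n b m')"
    by (induction w) (auto simp: cross_madd_left)
  then show ?thesis by simp
qed

text \<open>The letters behind \<open>a\<close> contain the same variables before and after the
  merge, so the pairs that start in \<open>a\<close> cancel; sums on both sides avoid truncated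
  subtraction.\<close>

lemma incs_Cons_merges:
  "w' \<in> merges w \<Longrightarrow> incs n (a # w') + incs n w = incs n (a # w) + incs n w'"
  by (simp add: cross_merges)

text \<open>Adjacent letters of a Crit word are increasing variables, so whichever two are merged,
  their pair is lost.\<close>

lemma incs_merges_Crit:
  assumes "valid n w" "kind w = Crit" "w' \<in> merges w"
  shows "incs n w' < incs n w"
  using assms
proof (induction w arbitrary: w' rule: merges.induct)
  case (1 a b w)
  have k: "kind (b # w) = Crit" "low a < low b" using 1(3) by (auto split: if_splits)
  show ?case
  proof (cases "w' = madd a b # w")
    case True
    have "cross n a b > 0" using 1(2) k by (intro cross_pos) auto
    then show ?thesis using True incs_madd[of n a b w] by simp
  next
    case False
    then obtain w'' where w'': "w' = a # w''" "w'' \<in> merges (b # w)" using 1(4) by auto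
    have "incs n w'' < incs n (b # w)" using "1.IH" 1(2) k w'' by simp
    then show ?thesis using incs_Cons_merges[OF w''(2), of n a] unfolding w''(1) by linarith
  qed
qed auto

text \<open>This is the acyclicity of the matching. A merge left of the suffix keeps the word Down,
  unless it multiplies the letter before the suffix by a variable below the suffix; that variable
  formed an increasing pair with the letter, which is lost. A merge inside the suffix loses a pair
  by \<open>incs_merges_Crit\<close>.\<close>

lemma incs_merges_Down:
  assumes "valid n b" "kind b = Down" "w \<in> merges b" "w \<noteq> merge_word b"
  shows "kind w = Down \<or> incs n w < incs n b"
  using assms
proof (induction b arbitrary: w rule: merges.induct)
  case (1 h k r)
  consider (head) "w = madd h k # r" | (tail) w' where "w = h # w'" "w' \<in> merges (k # r)"
    using 1(4) by auto
  then show ?case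
  proof cases
    case head
    then have nc: "kind (k # r) \<noteq> Crit" using 1(5) by auto
    then have kd: "kind (k # r) = Down" using 1(3) by auto
    show ?thesis
    proof (cases "kind r = Crit")
      case True
      then have r: "r \<noteq> []" "low (hd r) \<le> low k" using kd by (auto split: if_splits)
      show ?thesis
      proof (cases "low h < low (hd r)")
        case lt: True
        then have "cross n h k > 0" using 1(2) r by (intro cross_pos) auto
        then show ?thesis using head incs_madd[of n h k r] by simp
      next
        case False
        then have "\<not> low (madd h k) < low (hd r)" using 1(2) r by (simp add: low_madd)
        then show ?thesis using head True r by simp
      qed
    next
      case False
      then show ?thesis using kd head by simp
    qed
  next
    case tail
    show ?thesis
    proof (cases "kind (k # r) = Crit")
      case True
      then have "incs n w' < incs n (k # r)"
        using incs_merges_Crit 1(2) tail by (metis valid_simps(2))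
      then show ?thesis using incs_Cons_merges[OF tail(2), of n h] unfolding tail(1) by linarith
    next
      case False
      then have kd: "kind (k # r) = Down" using 1(3) by auto
      have "kind w' = Down \<or> incs n w' < incs n (k # r)"
        using "1.IH" 1(2,5) tail kd False by auto
      then show ?thesis
      proof
        assume "kind w' = Down"
        then show ?thesis using tail by simp
      next
        assume "incs n w' < incs n (k # r)"
        then show ?thesis using incs_Cons_merges[OF tail(2), of n h] unfolding tail(1) by linarith
      qed
    qed
  qed
qed auto

text \<open>The matched merge loses no pair, because no variable of the letter is smaller than the
  variable it absorbs.\<close>

lemma incs_merge_word:
  assumes "valid n b" "kind b = Down"
  shows "incs n (merge_word b) = incs n b"
  using assms
proof (induction b rule: merges.induct)
  case (1 a b w)
  show ?case
  proof (cases "kind (b # w) = Crit")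
    case True
    then have b: "b = var (low b)" by (auto split: if_splits)
    have le: "low b \<le> low a" using 1(3) True by (auto split: if_splits)
    have "cross n a b = 0"
      unfolding cross_def
    proof (intro sum.neutral ballI)
      fix u v assume uv: "u \<in> {1..n}" "v \<in> {u<..n}"
      show "a u * b v = 0"
      proof (cases "v = low b")
        case v: True
        then have "u \<notin> msupp a" using low_le[of u a] uv le by auto
        then show ?thesis by (simp add: msupp_def)
      next
        case False
        then have "b v = 0" using fun_cong[OF b, of v] by (simp add: chi_def)
        then show ?thesis by simp
      qed
    qed
    then show ?thesis using True incs_madd[of n a b w] by simp
  next
    case False
    then have kd: "kind (b # w) = Down" using 1(3) by auto
    have "merge_word (b # w) \<in> merges (b # w)" using merge_word_Down kd 1(2) by (metis valid_simps(2))
    moreover have "incs n (merge_word (b # w)) = incs n (b # w)" using "1.IH" 1(2) kd by simp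
    ultimately show ?thesis using incs_Cons_merges[of "merge_word (b # w)" "b # w" n a] False
      by (simp del: kind.simps incs.simps)
  qed
qed auto

text \<open>The matched word arises from one position only: a merge at the head changes the first
  letter, a merge further on keeps it.\<close>

lemma bar_d_Down:
  assumes "valid n b" "kind b = Down"
  shows "bar_d f b = merge_sign b * f (merge_word b) + bar_d (\<lambda>w. if w = merge_word b then 0 else f w) b"
  using assms
proof (induction b arbitrary: f rule: merges.induct)
  case (1 a b w)
  show ?case
  proof (cases "kind (b # w) = Crit")
    case True
    have "madd a b \<noteq> a" using 1(2) by (intro madd_neq) auto
    then show ?thesis using True by simp
  next
    case False
    have ne: "madd a b \<noteq> a" using 1(2) by (intro madd_neq) auto
    have kd: "kind (b # w) = Down" using 1(3) False by auto
    have IH: "bar_d (\<lambda>v. f (a # v)) (b # w) = merge_sign (b # w) * f (a # merge_word (b # w))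
       + bar_d (\<lambda>v. if v = merge_word (b # w) then 0 else f (a # v)) (b # w)"
      by (rule "1.IH") (use 1(2) kd in auto)
    have m: "merge_word (a # b # w) = a # merge_word (b # w)"
      "merge_sign (a # b # w) = (- merge_sign (b # w) :: 'a)" using False by simp_all
    have "bar_d (\<lambda>v. if v = merge_word (a # b # w) then 0 else f v) (a # b # w) =
        f (madd a b # w) - bar_d (\<lambda>v. if v = merge_word (b # w) then 0 else f (a # v)) (b # w)"
      unfolding m bar_d.simps using ne by simp
    then show ?thesis unfolding m bar_d.simps(1)[of f] IH by simp
  qed
qed (auto split: if_splits)

text \<open>The bar differential from cochains on Up words to cochains on Down words is triangular with
  respect to \<open>incs\<close>, with diagonal entries \<open>\<plusminus>1\<close> given by the matching; this inverts it.\<close>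

function solve :: "nat \<Rightarrow> (mono list \<Rightarrow> 'k::field) \<Rightarrow> mono list \<Rightarrow> 'k" where
  "solve n f a = (if kind a = Up then merge_sign (split_word a) *
     (f (split_word a) - bar_d (\<lambda>w. if incs n w < incs n a then solve n f w else 0) (split_word a)) else 0)"
  by auto
termination by (relation "measure (\<lambda>(n, f, a). incs n a)") auto

declare solve.simps [simp del]

lemma solve_eq_0: "kind a \<noteq> Up \<Longrightarrow> solve n f a = 0"
  by (simp add: solve.simps)

text \<open>A merge other than the matched one is Down, where \<open>f\<close> vanishes, or has
  smaller \<open>incs\<close>; the matched merge keeps \<open>incs\<close>, so the guard drops
  it.\<close>

lemma bar_d_Down':
  assumes "valid n b" "kind b = Down" "\<And>w. valid n w \<Longrightarrow> kind w = Down \<Longrightarrow> f w = 0"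
  shows "bar_d f b = merge_sign b * f (merge_word b) + bar_d (\<lambda>w. if incs n w < incs n b then f w else 0) b"
proof -
  have "bar_d (\<lambda>w. if w = merge_word b then 0 else f w) b =
        bar_d (\<lambda>w. if incs n w < incs n b then f w else 0) b"
  proof (rule bar_d_cong)
    fix w assume w: "w \<in> merges b"
    have "valid n w" using valid_merges[OF w assms(1)] .
    then show "(if w = merge_word b then 0 else f w) = (if incs n w < incs n b then f w else 0)"
      using incs_merges_Down[OF assms(1,2) w] incs_merge_word[OF assms(1,2)] assms(3)[of w] by auto
  qed
  then show ?thesis using bar_d_Down[OF assms(1,2), of f] by simp
qed

lemma bar_d_solve:
  assumes "valid n b" "kind b = Down"
  shows "bar_d (solve n f) b = f b"
proof -
  note m = merge_word_Down[OF assms]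
  have "bar_d (solve n f) b = merge_sign b * solve n f (merge_word b)
     + bar_d (\<lambda>w. if incs n w < incs n b then solve n f w else 0) b"
    by (rule bar_d_Down'[OF assms]) (simp add: solve_eq_0)
  then show ?thesis
    by (subst (asm) (1) solve.simps) (simp add: m incs_merge_word[OF assms] merge_sign_cancel)
qed

text \<open>Injectivity of the same triangular system: going up in \<open>incs\<close>, the equation
  at the partner \<open>split_word w\<close> of an Up word \<open>w\<close> forces
  \<open>f w\<close> to vanish.\<close>

lemma eq_0_if_bar_d_Down:
  assumes "\<And>w. valid n w \<Longrightarrow> kind w \<noteq> Up \<Longrightarrow> f w = 0"
    and "\<And>w. valid n w \<Longrightarrow> kind w = Down \<Longrightarrow> bar_d f w = 0"
    and "valid n w"
  shows "f w = (0::'k::field)"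
  using assms(3)
proof (induction "incs n w" arbitrary: w rule: less_induct)
  case less
  show ?case
  proof (cases "kind w = Up")
    case True
    define b where "b = split_word w"
    have b: "kind b = Down" "merge_word b = w" "valid n b"
      using split_word_Up[OF less(2) True] by (auto simp: b_def)
    have inc: "incs n b = incs n w" using incs_merge_word[OF b(3,1)] b(2) by simp
    have "bar_d (\<lambda>w. if incs n w < incs n b then f w else 0) b = 0"
      by (rule bar_d_eq_0) (use less(1) valid_merges b(3) inc in auto)
    then have "bar_d f b = merge_sign b * f w"
      using bar_d_Down'[OF b(3,1), of f] assms(1) b(2) by simp
    then have "merge_sign b * (merge_sign b * f w) = 0" using assms(2) b by simp
    then show ?thesis by (simp add: merge_sign_cancel)
  next
    case False
    then show ?thesis using assms(1) less(2) by simp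
  qed
qed

section \<open>Antisymmetrisation\<close>

text \<open>The Koszul sign, chosen to agree with the orientation used in \<open>bd\<close>.\<close>

definition ksgn :: "nat set \<Rightarrow> nat \<Rightarrow> 'k::field" where
  "ksgn \<tau> v = (-1) ^ card {u \<in> \<tau>. u < v}"

lemma ksgn_sq [simp]: "ksgn \<tau> v * ksgn \<tau> v = (1::'k::field)"
  by (simp add: ksgn_def power_add[symmetric] mult_2[symmetric])

lemma ksgn_insert:
  assumes "finite \<tau>" "r \<notin> \<tau>"
  shows "ksgn (insert r \<tau>) v = (if r < v then - ksgn \<tau> v else ksgn \<tau> v :: 'k::field)"
proof -
  have "{u \<in> insert r \<tau>. u < v} = (if r < v then insert r {u \<in> \<tau>. u < v} else {u \<in> \<tau>. u < v})"
    by auto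
  then show ?thesis using assms by (simp add: ksgn_def)
qed

lemma ksgn_remove:
  assumes "finite \<tau>" "r \<in> \<tau>"
  shows "ksgn (\<tau> - {r}) v = (if r < v then - ksgn \<tau> v else ksgn \<tau> v :: 'k::field)"
proof -
  have "ksgn (insert r (\<tau> - {r})) v = (if r < v then - ksgn (\<tau> - {r}) v else ksgn (\<tau> - {r}) v :: 'k)"
    by (rule ksgn_insert) (use assms in auto)
  then show ?thesis using assms by (simp add: insert_absorb)
qed

lemma ksgn_remove_self: "ksgn (\<tau> - {v}) v = (ksgn \<tau> v :: 'k::field)"
proof -
  have "{u \<in> \<tau> - {v}. u < v} = {u \<in> \<tau>. u < v}" by auto
  then show ?thesis by (simp add: ksgn_def)
qed

lemma ksgn_Min:
  assumes "finite \<tau>"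
  shows "ksgn \<tau> (Min \<tau>) = (1 :: 'k::field)"
proof -
  have "{u \<in> \<tau>. u < Min \<tau>} = {}" using assms by (auto simp: not_less)
  then show ?thesis unfolding ksgn_def by (simp only: card.empty power_0)
qed

lemma antisym_sum_eq_0:
  fixes h :: "nat \<Rightarrow> nat \<Rightarrow> 'k::field"
  assumes fin: "finite A" and anti: "\<And>v b. v \<in> A \<Longrightarrow> b \<in> A \<Longrightarrow> v < b \<Longrightarrow> h b v = - h v b"
  shows "(\<Sum>v\<in>A. \<Sum>b\<in>A - {v}. h v b) = 0"
proof -
  have "(\<Sum>b\<in>A - {v}. h v b) = (\<Sum>b\<in>A. if v < b then h v b else 0) + (\<Sum>b\<in>A. if b < v then h v b else 0)"
    if "v \<in> A" for v
  proof -
    have "(\<Sum>b\<in>A - {v}. h v b) = (\<Sum>b\<in>A. if b = v then 0 else h v b)"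
      using fin by (intro sum.mono_neutral_cong_left) auto
    also have "\<dots> = (\<Sum>b\<in>A. (if v < b then h v b else 0) + (if b < v then h v b else 0))"
      by (intro sum.cong) auto
    finally show ?thesis by (simp add: sum.distrib)
  qed
  then have "(\<Sum>v\<in>A. \<Sum>b\<in>A - {v}. h v b) =
     (\<Sum>v\<in>A. \<Sum>b\<in>A. if v < b then h v b else 0) + (\<Sum>v\<in>A. \<Sum>b\<in>A. if b < v then h v b else 0)"
    by (simp add: sum.distrib)
  also have "(\<Sum>v\<in>A. \<Sum>b\<in>A. if b < v then h v b else 0) = (\<Sum>b\<in>A. \<Sum>v\<in>A. if b < v then h v b else 0)"
    by (rule sum.swap)
  also have "\<dots> = - (\<Sum>v\<in>A. \<Sum>b\<in>A. if v < b then h v b else 0)"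
    unfolding sum_negf[symmetric] by (intro sum.cong refl) (use anti in auto)
  finally show ?thesis by simp
qed

text \<open>Signed sum of \<open>f\<close> over all orderings of \<open>\<tau>\<close>: the comparison map from bar to Koszul cochains.\<close>

function alt :: "(mono list \<Rightarrow> 'k::field) \<Rightarrow> nat set \<Rightarrow> 'k" where
  "alt f \<tau> = (if finite \<tau> \<and> \<tau> \<noteq> {}
     then (\<Sum>v\<in>\<tau>. ksgn \<tau> v * alt (\<lambda>w. f (var v # w)) (\<tau> - {v})) else f [])"
  by auto
termination
  by (relation "measure (\<lambda>(f, \<tau>). card \<tau>)") (auto intro: card_Diff1_less simp del: card_Diff_insert card_Diff_singleton)

declare alt.simps [simp del]

lemma alt_empty: "alt f {} = f []"
  by (simp add: alt.simps)

lemma alt_nonempty: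
  "finite \<tau> \<Longrightarrow> \<tau> \<noteq> {} \<Longrightarrow>
    alt f \<tau> = (\<Sum>v\<in>\<tau>. ksgn \<tau> v * alt (\<lambda>w. f (var v # w)) (\<tau> - {v}))"
  by (subst alt.simps) simp

lemma alt_cong:
  assumes "finite \<tau>" "\<And>vs. set vs = \<tau> \<Longrightarrow> distinct vs \<Longrightarrow> f (map var vs) = g (map var vs)"
  shows "alt f \<tau> = alt g \<tau>"
  using assms
proof (induction "card \<tau>" arbitrary: \<tau> f g)
  case 0
  then show ?case using "0.prems"(2)[of "[]"] by (simp add: alt_empty)
next
  case (Suc k)
  then have ne: "\<tau> \<noteq> {}" by auto
  have "alt (\<lambda>w. f (var v # w)) (\<tau> - {v}) = alt (\<lambda>w. g (var v # w)) (\<tau> - {v})" if v: "v \<in> \<tau>" for v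
  proof (rule Suc.hyps)
    fix vs assume "set vs = \<tau> - {v}" "distinct vs"
    then show "f (var v # map var vs) = g (var v # map var vs)"
      using Suc.prems(2)[of "v # vs"] v by auto
  qed (use Suc v in auto)
  then show ?case by (simp add: alt_nonempty Suc.prems(1) ne)
qed

lemma alt_linear:
  assumes "finite \<tau>"
  shows "alt (\<lambda>w. f w + g w) \<tau> = alt f \<tau> + alt g \<tau>"
    and "alt (\<lambda>w. f w - g w) \<tau> = alt f \<tau> - alt g \<tau>"
    and "alt (\<lambda>w. c * f w) \<tau> = c * alt f \<tau>"
proof -
  have "alt (\<lambda>w. f w + g w) \<tau> = alt f \<tau> + alt g \<tau> \<and> alt (\<lambda>w. f w - g w) \<tau> = alt f \<tau> - alt g \<tau>
    \<and> alt (\<lambda>w. c * f w) \<tau> = c * alt f \<tau>"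
    using assms
  proof (induction "card \<tau>" arbitrary: \<tau> f g)
    case 0
    then show ?case by (simp add: alt_empty)
  next
    case (Suc k)
    then have ne: "\<tau> \<noteq> {}" by auto
    have IH: "alt (\<lambda>w. f (var v # w) + g (var v # w)) (\<tau> - {v}) =
        alt (\<lambda>w. f (var v # w)) (\<tau> - {v}) + alt (\<lambda>w. g (var v # w)) (\<tau> - {v})"
      "alt (\<lambda>w. f (var v # w) - g (var v # w)) (\<tau> - {v}) =
        alt (\<lambda>w. f (var v # w)) (\<tau> - {v}) - alt (\<lambda>w. g (var v # w)) (\<tau> - {v})"
      "alt (\<lambda>w. c * f (var v # w)) (\<tau> - {v}) = c * alt (\<lambda>w. f (var v # w)) (\<tau> - {v})"
      if "v \<in> \<tau>" for v
      using Suc.hyps(1)[of "\<tau> - {v}" "\<lambda>w. f (var v # w)" "\<lambda>w. g (var v # w)"] Suc.hyps(2) Suc.prems that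
      by auto
    show ?case
      by (simp add: alt_nonempty Suc.prems(1) ne IH distrib_left right_diff_distrib sum.distrib
          sum_subtractf sum_distrib_left mult.left_commute cong: sum.cong)
  qed
  then show "alt (\<lambda>w. f w + g w) \<tau> = alt f \<tau> + alt g \<tau>"
    and "alt (\<lambda>w. f w - g w) \<tau> = alt f \<tau> - alt g \<tau>"
    and "alt (\<lambda>w. c * f w) \<tau> = c * alt f \<tau>" by auto
qed

lemma alt_zero: "finite \<tau> \<Longrightarrow> alt (\<lambda>_. 0) \<tau> = (0::'k::field)"
  using alt_linear(3)[of \<tau> 0 "\<lambda>_. 0"] by simp

lemma alt_eq_0:
  "finite \<tau> \<Longrightarrow> (\<And>vs. set vs = \<tau> \<Longrightarrow> distinct vs \<Longrightarrow> f (map var vs) = 0) \<Longrightarrow> alt f \<tau> = (0::'k::field)"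
  using alt_cong[of \<tau> f "\<lambda>_. 0"] alt_zero by metis

text \<open>Orderings that do not start with the minimum are unsorted and contribute nothing; taking
  out the minimum has sign \<open>+1\<close>. This evaluates \<open>alt\<close> on cochains
  normalised to vanish on Down words.\<close>

lemma alt_sorted:
  assumes "finite \<tau>"
    "\<And>vs. set vs = \<tau> \<Longrightarrow> distinct vs \<Longrightarrow> \<not> sorted vs \<Longrightarrow> f (map var vs) = 0"
  shows "alt f \<tau> = (f (map var (sorted_list_of_set \<tau>)) :: 'k::field)"
  using assms
proof (induction "card \<tau>" arbitrary: \<tau> f)
  case 0
  then show ?case by (simp add: alt_empty)
next
  case (Suc k)
  then have ne: "\<tau> \<noteq> {}" by auto
  define m where "m = Min \<tau>"
  have m: "m \<in> \<tau>" "\<And>v. v \<in> \<tau> \<Longrightarrow> m \<le> v" using Suc.prems(1) ne by (auto simp: m_def)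
  have "alt f \<tau> = (\<Sum>v\<in>\<tau>. ksgn \<tau> v * alt (\<lambda>w. f (var v # w)) (\<tau> - {v}))"
    by (rule alt_nonempty[OF Suc.prems(1) ne])
  also have "\<dots> = (\<Sum>v\<in>{m}. ksgn \<tau> v * alt (\<lambda>w. f (var v # w)) (\<tau> - {v}))"
  proof (rule sum.mono_neutral_right)
    show "\<forall>v\<in>\<tau> - {m}. ksgn \<tau> v * alt (\<lambda>w. f (var v # w)) (\<tau> - {v}) = 0"
    proof
      fix v assume v: "v \<in> \<tau> - {m}"
      have "alt (\<lambda>w. f (var v # w)) (\<tau> - {v}) = 0"
      proof (rule alt_eq_0)
        fix vs assume vs: "set vs = \<tau> - {v}" "distinct vs"
        have "m \<in> set vs" "m < v" using v vs m by (auto simp: le_neq_implies_less)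
        then have "\<not> sorted (v # vs)" by (meson not_le sorted_simps(2))
        then show "f (var v # map var vs) = 0" using Suc.prems(2)[of "v # vs"] vs v by auto
      qed (use Suc.prems in simp)
      then show "ksgn \<tau> v * alt (\<lambda>w. f (var v # w)) (\<tau> - {v}) = 0" by simp
    qed
  qed (use Suc.prems m in auto)
  also have "\<dots> = alt (\<lambda>w. f (var m # w)) (\<tau> - {m})"
    using Suc.prems(1) by (simp add: m_def ksgn_Min)
  also have "\<dots> = f (var m # map var (sorted_list_of_set (\<tau> - {m})))"
  proof (rule Suc.hyps)
    fix vs assume vs: "set vs = \<tau> - {m}" "distinct vs" "\<not> sorted vs"
    then show "f (var m # map var vs) = 0" using Suc.prems(2)[of "m # vs"] m by auto
  qed (use Suc m in auto)
  also have "\<dots> = f (map var (sorted_list_of_set \<tau>))"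
    using sorted_list_of_set_nonempty[OF Suc.prems(1) ne] by (simp add: m_def)
  finally show ?case .
qed

text \<open>Merging two adjacent variables does not see their order, while exchanging them changes
  the sign of the ordering, so the terms cancel in pairs.\<close>

lemma alt_bar_d:
  assumes "finite \<tau>"
  shows "alt (bar_d f) \<tau> = (0::'k::field)"
  using assms
proof (induction "card \<tau>" arbitrary: \<tau> f)
  case 0
  then show ?case by (simp add: alt_empty)
next
  case (Suc k)
  then have ne: "\<tau> \<noteq> {}" by auto
  define g where "g v w = (case w of [] \<Rightarrow> 0 | b # w' \<Rightarrow> f (madd (var v) b # w'))" for v w
  define h where "h v b = ksgn \<tau> v * (ksgn (\<tau> - {v}) b *
      alt (\<lambda>w'. f (madd (var v) (var b) # w')) (\<tau> - {v} - {b}))" for v b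
  have "alt (\<lambda>w. bar_d f (var v # w)) (\<tau> - {v}) = alt (g v) (\<tau> - {v})" if v: "v \<in> \<tau>" for v
  proof -
    have "(\<lambda>w. bar_d f (var v # w)) = (\<lambda>w. g v w - bar_d (\<lambda>w. f (var v # w)) w)"
      by (rule ext) (auto simp: g_def split: list.split)
    moreover have "alt (bar_d (\<lambda>w. f (var v # w))) (\<tau> - {v}) = 0"
      by (rule Suc.hyps) (use Suc v in auto)
    ultimately show ?thesis using Suc.prems by (simp add: alt_linear)
  qed
  then have "alt (bar_d f) \<tau> = (\<Sum>v\<in>\<tau>. ksgn \<tau> v * alt (g v) (\<tau> - {v}))"
    by (simp add: alt_nonempty Suc.prems ne)
  also have "\<dots> = (\<Sum>v\<in>\<tau>. \<Sum>b\<in>\<tau> - {v}. h v b)"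
  proof (rule sum.cong[OF refl])
    fix v assume v: "v \<in> \<tau>"
    show "ksgn \<tau> v * alt (g v) (\<tau> - {v}) = (\<Sum>b\<in>\<tau> - {v}. h v b)"
    proof (cases "\<tau> - {v} = {}")
      case True
      then show ?thesis unfolding True by (simp add: alt_empty g_def)
    next
      case False
      then show ?thesis using Suc.prems
        by (simp add: alt_nonempty h_def g_def sum_distrib_left)
    qed
  qed
  also have "\<dots> = 0"
  proof (rule antisym_sum_eq_0[OF Suc.prems])
    fix v b assume vb: "v \<in> \<tau>" "b \<in> \<tau>" "v < b"
    have "\<tau> - {b} - {v} = \<tau> - {v} - {b}" by auto
    then show "h b v = - h v b"
      using vb Suc.prems by (simp add: h_def ksgn_remove madd_comm[of "var b"] mult.left_commute)
  qed
  finally show ?case .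
qed

text \<open>With \<open>m\<close> kept in front, only its merges with the first variable survive:
  antisymmetrisation turns the bar differential into the Koszul differential with monomial
  coefficients.\<close>

lemma alt_bar_d_Cons:
  assumes "finite \<tau>"
  shows "alt (\<lambda>w. bar_d F (m # w)) \<tau> =
    (\<Sum>v\<in>\<tau>. ksgn \<tau> v * alt (\<lambda>w. F (madd m (var v) # w)) (\<tau> - {v}) :: 'k::field)"
proof -
  define g where "g w = (case w of [] \<Rightarrow> 0 | b # w' \<Rightarrow> F (madd m b # w'))" for w
  have "(\<lambda>w. bar_d F (m # w)) = (\<lambda>w. g w - bar_d (\<lambda>w. F (m # w)) w)"
    by (rule ext) (auto simp: g_def split: list.split)
  then have "alt (\<lambda>w. bar_d F (m # w)) \<tau> = alt g \<tau>"
    using assms by (simp add: alt_linear alt_bar_d)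
  also have "\<dots> = (\<Sum>v\<in>\<tau>. ksgn \<tau> v * alt (\<lambda>w. F (madd m (var v) # w)) (\<tau> - {v}))"
    using assms by (cases "\<tau> = {}") (auto simp: alt_empty alt_nonempty g_def)
  finally show ?thesis .
qed

text \<open>Orderings of a set are never Up, and exactly one of them is Crit; this ties the matching
  to \<open>alt\<close>.\<close>

lemma kind_map_var:
  assumes "distinct vs"
  shows "kind (map var vs) = (if sorted vs then Crit else Down)"
  using assms
proof (induction vs)
  case (Cons v vs)
  then show ?case
    by (cases vs) (auto simp: le_less)
qed auto

lemma kind_Crit_imp:
  assumes "kind w = Crit"
  shows "\<exists>vs. w = map var vs \<and> sorted vs \<and> distinct vs"
  using assms
proof (induction w)
  case (Cons m w)
  have k: "kind w = Crit" and m: "m = var (low m)" and l: "w = [] \<or> low m < low (hd w)"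
    using Cons.prems by (metis kind.simps(2) word_kind.distinct)+
  obtain vs where vs: "w = map var vs" "sorted vs" "distinct vs" using Cons.IH k by blast
  have "sorted (low m # vs) \<and> distinct (low m # vs)"
    using l vs by (cases vs) auto
  moreover have "m # w = map var (low m # vs)" using vs m by simp
  ultimately show ?case by metis
qed auto

section \<open>Cohomology of the module of nonface monomials\<close>

definition min_nonface :: "nat set set \<Rightarrow> nat set \<Rightarrow> bool" where
  "min_nonface D g \<longleftrightarrow> g \<notin> D \<and> (\<forall>v\<in>g. g - {v} \<in> D)"

text \<open>With \<open>I\<close> the ideal of nonface monomials and \<open>m\<close> the maximal ideal, this is the squarefree part,
  in dual form, of the statement that \<open>Tor(mI, k) \<longrightarrow> Tor(I, k)\<close> vanishes: a Koszul cocycle of \<open>I\<close> becomes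
  a coboundary on \<open>mI\<close>. Here \<open>\<tau>\<close> stands for the Koszul generator \<open>e\<^sub>\<tau>\<close> with coefficient
  \<open>x\<^sup>\<sigma>\<^sup>-\<^sup>\<tau>\<close>.\<close>

definition detects :: "'k::field itself \<Rightarrow> nat \<Rightarrow> nat set set \<Rightarrow> bool" where
  "detects K n D \<longleftrightarrow> (\<forall>\<sigma>\<subseteq>{1..n}. \<forall>\<phi> :: nat set \<Rightarrow> 'k.
     (\<forall>\<tau>\<subseteq>\<sigma>. \<sigma> - \<tau> \<notin> D \<longrightarrow> (\<Sum>v\<in>\<tau>. ksgn \<tau> v * \<phi> (\<tau> - {v})) = 0) \<longrightarrow>
     (\<exists>\<psi>. \<forall>\<tau>\<subseteq>\<sigma>. (\<exists>v\<in>\<sigma> - \<tau>. \<sigma> - \<tau> - {v} \<notin> D) \<longrightarrow> \<phi> \<tau> = (\<Sum>v\<in>\<tau>. ksgn \<tau> v * \<psi> (\<tau> - {v}))))"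

text \<open>Contraction towards the apex \<open>r\<close>, stated for one \<open>\<tau>\<close> so
  that the cocycle condition is asked only at \<open>insert r \<tau>\<close>. For
  \<open>r \<in> \<tau>\<close> only the summand of \<open>r\<close> survives; otherwise the sum is,
  up to sign, the cocycle condition at \<open>insert r \<tau>\<close> without its summand for
  \<open>r\<close>.\<close>

lemma cone_cobd:
  fixes \<phi> :: "nat set \<Rightarrow> 'k::field"
  assumes fin: "finite \<tau>"
    and coc: "r \<notin> \<tau> \<Longrightarrow> (\<Sum>v\<in>insert r \<tau>. ksgn (insert r \<tau>) v * \<phi> (insert r \<tau> - {v})) = 0"
    and \<psi>: "\<psi> = (\<lambda>\<tau>. if r \<in> \<tau> then 0 else ksgn \<tau> r * \<phi> (insert r \<tau>))"
  shows "\<phi> \<tau> = (\<Sum>v\<in>\<tau>. ksgn \<tau> v * \<psi> (\<tau> - {v}))"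
proof (cases "r \<in> \<tau>")
  case True
  have "(\<Sum>v\<in>\<tau>. ksgn \<tau> v * \<psi> (\<tau> - {v})) = (\<Sum>v\<in>{r}. ksgn \<tau> v * \<psi> (\<tau> - {v}))"
    using True fin by (intro sum.mono_neutral_right) (auto simp: \<psi>)
  also have "\<dots> = ksgn \<tau> r * ksgn \<tau> r * \<phi> \<tau>"
    using True by (simp add: \<psi> ksgn_remove_self insert_absorb mult.assoc)
  finally show ?thesis by simp
next
  case False
  have self: "ksgn (insert r \<tau>) r = (ksgn \<tau> r :: 'k)" using fin False by (simp add: ksgn_insert)
  have "(\<Sum>v\<in>\<tau>. ksgn \<tau> v * \<psi> (\<tau> - {v})) =
     (\<Sum>v\<in>\<tau>. - (ksgn \<tau> r * (ksgn (insert r \<tau>) v * \<phi> (insert r \<tau> - {v}))))"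
  proof (rule sum.cong[OF refl])
    fix v assume v: "v \<in> \<tau>"
    then have "v \<noteq> r" and eq: "insert r \<tau> - {v} = insert r (\<tau> - {v})" using False by auto
    have m1: "\<psi> (\<tau> - {v}) = ksgn (\<tau> - {v}) r * \<phi> (insert r (\<tau> - {v}))"
      using False by (simp add: \<psi>)
    have m2: "ksgn \<tau> v * ksgn (\<tau> - {v}) r = (- (ksgn \<tau> r * ksgn (insert r \<tau>) v) :: 'k)"
      using fin False v \<open>v \<noteq> r\<close> by (simp add: ksgn_insert ksgn_remove)
    show "ksgn \<tau> v * \<psi> (\<tau> - {v}) =
       - (ksgn \<tau> r * (ksgn (insert r \<tau>) v * \<phi> (insert r \<tau> - {v})))"
      unfolding m1 eq mult.assoc[symmetric] m2 by simp
  qed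
  also have "\<dots> = - (ksgn \<tau> r * (\<Sum>v\<in>\<tau>. ksgn (insert r \<tau>) v * \<phi> (insert r \<tau> - {v})))"
    by (simp add: sum_negf sum_distrib_left)
  also have "(\<Sum>v\<in>\<tau>. ksgn (insert r \<tau>) v * \<phi> (insert r \<tau> - {v})) = - (ksgn \<tau> r * \<phi> \<tau>)"
    using coc[OF False] fin False by (simp add: self eq_neg_iff_add_eq_0 add.commute)
  finally show ?thesis by (simp add: mult.assoc[symmetric])
qed

text \<open>For \<open>\<tau> \<subseteq> msupp \<alpha>\<close> this is the coefficient that
  accompanies the Koszul generator of \<tau> in multidegree \<alpha>.\<close>

definition msub :: "mono \<Rightarrow> nat set \<Rightarrow> mono" where
  "msub \<alpha> \<tau> = (\<lambda>i. if i \<in> \<tau> then \<alpha> i - 1 else \<alpha> i)"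

lemma msub_madd: "msub (madd m (chi \<tau>)) \<tau> = m"
  by (auto simp: msub_def madd_def chi_def)

lemma madd_msub_var: "\<tau> \<subseteq> msupp \<alpha> \<Longrightarrow> v \<in> \<tau> \<Longrightarrow> madd (msub \<alpha> \<tau>) (var v) = msub \<alpha> (\<tau> - {v})"
  by (auto simp: msub_def madd_def chi_def fun_eq_iff msupp_def)

lemma madd_var_chi: "v \<in> \<tau> \<Longrightarrow> madd (madd m (var v)) (chi (\<tau> - {v})) = madd m (chi \<tau>)"
  by (auto simp: madd_def chi_def fun_eq_iff)

text \<open>In a multidegree \<open>\<alpha>\<close> with \<open>\<alpha> r \<ge> 2\<close> the relevant complex is a cone with apex \<open>r\<close>.\<close>

lemma koszul_cocycle_multidegree:
  fixes \<phi> :: "mono \<Rightarrow> nat set \<Rightarrow> 'k::field"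
  assumes det: "detects TYPE('k) n D"
    and coc: "\<And>m \<tau>. msupp m \<subseteq> {1..n} \<Longrightarrow> msupp m \<notin> D \<Longrightarrow> \<tau> \<subseteq> {1..n} \<Longrightarrow>
       (\<Sum>v\<in>\<tau>. ksgn \<tau> v * \<phi> (madd m (var v)) (\<tau> - {v})) = 0"
    and \<alpha>: "msupp \<alpha> \<subseteq> {1..n}"
  shows "\<exists>\<psi> \<chi>. \<forall>\<tau>\<subseteq>msupp \<alpha>. msupp (msub \<alpha> \<tau>) \<notin> D \<longrightarrow>
     \<phi> (msub \<alpha> \<tau>) \<tau> = (\<Sum>v\<in>\<tau>. ksgn \<tau> v * \<psi> (\<tau> - {v})) +
       (if msub \<alpha> \<tau> = chi (msupp (msub \<alpha> \<tau>)) \<and> min_nonface D (msupp (msub \<alpha> \<tau>)) then \<chi> \<tau> else 0)"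
proof -
  define \<phi>' where "\<phi>' \<tau> = \<phi> (msub \<alpha> \<tau>) \<tau>" for \<tau>
  have sub: "msupp (msub \<alpha> \<tau>) \<subseteq> {1..n}" for \<tau>
    using \<alpha> by (auto simp: msub_def msupp_def subset_iff)
  have coc': "(\<Sum>v\<in>\<tau>. ksgn \<tau> v * \<phi>' (\<tau> - {v})) = 0"
    if t: "\<tau> \<subseteq> msupp \<alpha>" "msupp (msub \<alpha> \<tau>) \<notin> D" for \<tau>
  proof -
    have "(\<Sum>v\<in>\<tau>. ksgn \<tau> v * \<phi>' (\<tau> - {v})) =
        (\<Sum>v\<in>\<tau>. ksgn \<tau> v * \<phi> (madd (msub \<alpha> \<tau>) (var v)) (\<tau> - {v}))"
      using t by (intro sum.cong) (auto simp: \<phi>'_def madd_msub_var)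
    also have "\<dots> = 0" by (rule coc) (use t sub \<alpha> in auto)
    finally show ?thesis .
  qed
  show ?thesis
  proof (cases "\<exists>r. \<alpha> r \<ge> 2")
    case True
    then obtain r where r: "\<alpha> r \<ge> 2" by blast
    define \<psi> where "\<psi> = (\<lambda>\<tau>. if r \<in> \<tau> then 0 else ksgn \<tau> r * \<phi>' (insert r \<tau>))"
    have "\<phi>' \<tau> = (\<Sum>v\<in>\<tau>. ksgn \<tau> v * \<psi> (\<tau> - {v}))"
      if t: "\<tau> \<subseteq> msupp \<alpha>" "msupp (msub \<alpha> \<tau>) \<notin> D" for \<tau>
    proof (rule cone_cobd[OF _ _ \<psi>_def])
      show "finite \<tau>" by (meson finite_atLeastAtMost finite_subset t(1) \<alpha>)
      assume "r \<notin> \<tau>"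
      have "msupp (msub \<alpha> (insert r \<tau>)) = msupp (msub \<alpha> \<tau>)"
        using r by (auto simp: msub_def msupp_def)
      then show "(\<Sum>v\<in>insert r \<tau>. ksgn (insert r \<tau>) v * \<phi>' (insert r \<tau> - {v})) = 0"
        using t r by (intro coc') (auto simp: msupp_def)
    qed
    then show ?thesis
      by (intro exI[of _ \<psi>] exI[of _ "\<lambda>_. 0"]) (auto simp: \<phi>'_def)
  next
    case False
    define \<sigma> where "\<sigma> = msupp \<alpha>"
    have a: "\<alpha> i = (if i \<in> \<sigma> then 1 else 0)" for i
      using False[simplified, rule_format, of i] by (auto simp: \<sigma>_def msupp_def)
    have ms: "msub \<alpha> \<tau> = chi (\<sigma> - \<tau>)" if "\<tau> \<subseteq> \<sigma>" for \<tau>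
      using that by (auto simp: msub_def chi_def a fun_eq_iff)
    have "\<forall>\<tau>\<subseteq>\<sigma>. \<sigma> - \<tau> \<notin> D \<longrightarrow> (\<Sum>v\<in>\<tau>. ksgn \<tau> v * \<phi>' (\<tau> - {v})) = 0"
      using coc' ms by (auto simp: \<sigma>_def)
    then obtain \<psi> where \<psi>: "\<forall>\<tau>\<subseteq>\<sigma>. (\<exists>v\<in>\<sigma> - \<tau>. \<sigma> - \<tau> - {v} \<notin> D) \<longrightarrow>
        \<phi>' \<tau> = (\<Sum>v\<in>\<tau>. ksgn \<tau> v * \<psi> (\<tau> - {v}))"
      using spec[OF mp[OF spec[OF det[unfolded detects_def], of \<sigma>] \<alpha>[folded \<sigma>_def]], of \<phi>']
      by blast
    show ?thesis
    proof (intro exI allI impI)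
      fix \<tau> assume t: "\<tau> \<subseteq> msupp \<alpha>" "msupp (msub \<alpha> \<tau>) \<notin> D"
      then have t': "\<tau> \<subseteq> \<sigma>" by (simp add: \<sigma>_def)
      \<comment> \<open>\<open>detects\<close> gives no equation at a minimal nonface; there the
        second summand is by definition the whole discrepancy.\<close>
      show "\<phi> (msub \<alpha> \<tau>) \<tau> = (\<Sum>v\<in>\<tau>. ksgn \<tau> v * \<psi> (\<tau> - {v})) +
       (if msub \<alpha> \<tau> = chi (msupp (msub \<alpha> \<tau>)) \<and> min_nonface D (msupp (msub \<alpha> \<tau>))
        then (\<lambda>\<tau>. \<phi>' \<tau> - (\<Sum>v\<in>\<tau>. ksgn \<tau> v * \<psi> (\<tau> - {v}))) \<tau> else 0)"
      proof (cases "min_nonface D (\<sigma> - \<tau>)")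
        case True
        then show ?thesis using t' by (simp add: ms \<phi>'_def)
      next
        case False
        then have "\<exists>v\<in>\<sigma> - \<tau>. \<sigma> - \<tau> - {v} \<notin> D"
          using t(2) ms[OF t'] by (auto simp: min_nonface_def)
        then have "\<phi>' \<tau> = (\<Sum>v\<in>\<tau>. ksgn \<tau> v * \<psi> (\<tau> - {v}))" using \<psi> t' by blast
        then show ?thesis using t' False by (simp add: ms \<phi>'_def)
      qed
    qed
  qed
qed

text \<open>The Koszul differential preserves the multidegree \<open>madd m (chi \<tau>)\<close>, so
  solutions are chosen in each multidegree independently and reassembled.\<close>

lemma koszul_cocycle:
  fixes \<phi> :: "mono \<Rightarrow> nat set \<Rightarrow> 'k::field"
  assumes det: "detects TYPE('k) n D"
    and coc: "\<And>m \<tau>. msupp m \<subseteq> {1..n} \<Longrightarrow> msupp m \<notin> D \<Longrightarrow> \<tau> \<subseteq> {1..n} \<Longrightarrow>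
       (\<Sum>v\<in>\<tau>. ksgn \<tau> v * \<phi> (madd m (var v)) (\<tau> - {v})) = 0"
  shows "\<exists>\<psi> \<chi>. \<forall>m \<tau>. msupp m \<subseteq> {1..n} \<longrightarrow> msupp m \<notin> D \<longrightarrow> \<tau> \<subseteq> {1..n} \<longrightarrow>
     \<phi> m \<tau> = (\<Sum>v\<in>\<tau>. ksgn \<tau> v * \<psi> (madd m (var v)) (\<tau> - {v})) +
       (if m = chi (msupp m) \<and> min_nonface D (msupp m) then \<chi> (msupp m) \<tau> else 0)"
proof -
  define P where "P \<alpha> \<psi> \<chi> \<longleftrightarrow> (\<forall>\<tau>\<subseteq>msupp \<alpha>. msupp (msub \<alpha> \<tau>) \<notin> D \<longrightarrow>
     \<phi> (msub \<alpha> \<tau>) \<tau> = (\<Sum>v\<in>\<tau>. ksgn \<tau> v * \<psi> (\<tau> - {v})) +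
       (if msub \<alpha> \<tau> = chi (msupp (msub \<alpha> \<tau>)) \<and> min_nonface D (msupp (msub \<alpha> \<tau>)) then \<chi> \<tau> else 0))"
    for \<alpha> \<psi> \<chi>
  define \<psi> where "\<psi> \<alpha> = (SOME \<psi>. \<exists>\<chi>. P \<alpha> \<psi> \<chi>)" for \<alpha>
  define \<chi> where "\<chi> \<alpha> = (SOME \<chi>. P \<alpha> (\<psi> \<alpha>) \<chi>)" for \<alpha>
  have *: "P \<alpha> (\<psi> \<alpha>) (\<chi> \<alpha>)" if "msupp \<alpha> \<subseteq> {1..n}" for \<alpha>
  proof -
    have "\<exists>\<psi> \<chi>. P \<alpha> \<psi> \<chi>"
      unfolding P_def by (rule koszul_cocycle_multidegree[OF det coc that])
    then have "\<exists>\<chi>. P \<alpha> (\<psi> \<alpha>) \<chi>" unfolding \<psi>_def by (rule someI_ex)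
    then show ?thesis unfolding \<chi>_def by (rule someI_ex)
  qed
  show ?thesis
  proof (intro exI allI impI)
    fix m \<tau> assume m: "msupp m \<subseteq> {1..n}" "msupp m \<notin> D" and t: "\<tau> \<subseteq> {1..n}"
    have "\<phi> m \<tau> = (\<Sum>v\<in>\<tau>. ksgn \<tau> v * \<psi> (madd m (chi \<tau>)) (\<tau> - {v})) +
       (if m = chi (msupp m) \<and> min_nonface D (msupp m) then \<chi> (madd m (chi \<tau>)) \<tau> else 0)"
      using *[of "madd m (chi \<tau>)", unfolded P_def, rule_format, of \<tau>] m t by (simp add: msub_madd)
    also have "(\<Sum>v\<in>\<tau>. ksgn \<tau> v * \<psi> (madd m (chi \<tau>)) (\<tau> - {v})) =
      (\<Sum>v\<in>\<tau>. ksgn \<tau> v * (\<lambda>m \<tau>. \<psi> (madd m (chi \<tau>)) \<tau>) (madd m (var v)) (\<tau> - {v}))"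
      by (intro sum.cong) (auto simp: madd_var_chi)
    \<comment> \<open>Under the condition \<open>m\<close> is determined by its support, so the
      coefficient may be indexed by a set.\<close>
    also have "(if m = chi (msupp m) \<and> min_nonface D (msupp m) then \<chi> (madd m (chi \<tau>)) \<tau> else 0) =
       (if m = chi (msupp m) \<and> min_nonface D (msupp m)
        then (\<lambda>g \<tau>. \<chi> (madd (chi g) (chi \<tau>)) \<tau>) (msupp m) \<tau> else 0)"
      by (rule if_cong) (rule refl, erule conjE, erule arg_cong2[of m "chi (msupp m)" \<tau> \<tau>
          "\<lambda>m \<tau>. \<chi> (madd m (chi \<tau>)) \<tau>", OF _ refl], rule refl)
    finally show "\<phi> m \<tau> =
      (\<Sum>v\<in>\<tau>. ksgn \<tau> v * (\<lambda>m \<tau>. \<psi> (madd m (chi \<tau>)) \<tau>) (madd m (var v)) (\<tau> - {v})) +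
       (if m = chi (msupp m) \<and> min_nonface D (msupp m)
        then (\<lambda>g \<tau>. \<chi> (madd (chi g) (chi \<tau>)) \<tau>) (msupp m) \<tau> else 0)" .
  qed
qed

text \<open>The bar complex of the module \<open>I\<close>: the first letter is a basis monomial of
  \<open>I\<close>, the others are monomials of positive degree in \<open>S\<close>.\<close>

definition nonface_word :: "nat \<Rightarrow> nat set set \<Rightarrow> mono list \<Rightarrow> bool" where
  "nonface_word n D w \<longleftrightarrow> valid n w \<and> w \<noteq> [] \<and> msupp (hd w) \<notin> D"

text \<open>A first coboundary removes \<open>F\<close> where the tail is Down; the vanishing
  antisymmetrisation then removes it where the tail is Crit, and the cocycle condition where the
  tail is Up.\<close>

lemma bar_exact_if_alt_eq_0:
  fixes F :: "mono list \<Rightarrow> 'k::field"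
  assumes down: "\<forall>F\<in>D. \<forall>G. G \<subseteq> F \<longrightarrow> G \<in> D" and emp: "{} \<in> D"
    and coc: "\<And>w. nonface_word n D w \<Longrightarrow> bar_d F w = 0"
    and alt0: "\<And>m \<tau>. msupp m \<subseteq> {1..n} \<Longrightarrow> msupp m \<notin> D \<Longrightarrow> \<tau> \<subseteq> {1..n} \<Longrightarrow> alt (\<lambda>w. F (m # w)) \<tau> = 0"
  shows "\<exists>G. \<forall>w. nonface_word n D w \<longrightarrow> F w = bar_d G w"
proof -
  \<comment> \<open>The leading letter contributes a minus sign to \<open>bar_d\<close>, hence the
    negated right-hand side.\<close>
  define G where "G w = (case w of [] \<Rightarrow> 0 | m # b \<Rightarrow> solve n (\<lambda>b. - F (m # b)) b)" for w
  define F' where "F' w = F w - bar_d G w" for w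
  have G0: "G (m # b) = 0" if "kind b \<noteq> Up" for m b
    using that by (simp add: G_def solve_eq_0)
  \<comment> \<open>Merging the front letter with the head of a Down tail leaves a tail that is not
    Up, where \<open>G\<close> vanishes.\<close>
  have tl: "\<exists>c b'. b = c # b' \<and> kind b' \<noteq> Up" if "kind b = Down" for b
    using that by (cases b) (auto split: if_splits)
  have F'coc: "bar_d F' w = 0" if "nonface_word n D w" for w
  proof -
    have "bar_d F' w = bar_d F w - bar_d (bar_d G) w" unfolding F'_def by (rule bar_d_diff)
    then show ?thesis using coc that by (simp add: bar_d_bar_d)
  qed
  have F'Down: "F' (m # b) = 0" if "valid n b" "kind b = Down" for m b
  proof -
    obtain c b' where b: "b = c # b'" "kind b' \<noteq> Up" using tl \<open>kind b = Down\<close> by blast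
    have "bar_d G (m # b) = G (madd m c # b') - bar_d (\<lambda>w. G (m # w)) b" by (simp add: b)
    also have "(\<lambda>w. G (m # w)) = solve n (\<lambda>b. - F (m # b))" by (simp add: G_def)
    also have "bar_d \<dots> b = - F (m # b)" by (rule bar_d_solve[OF that])
    finally show ?thesis using b by (simp add: F'_def G0)
  qed
  have F'nUp: "F' (m # b) = 0"
    if m: "msupp m \<subseteq> {1..n}" "msupp m \<notin> D" and b: "valid n b" "kind b \<noteq> Up" for m b
  proof (cases "kind b = Crit")
    case True
    then obtain vs where vs: "b = map var vs" "sorted vs" "distinct vs" using kind_Crit_imp by blast
    have t: "set vs \<subseteq> {1..n}" using b vs by (auto simp: valid_def)
    have val: "valid n (map var us)" if "set us = set vs" for us
      using t that by (auto simp: valid_def)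
    have "F' (m # b) = F' (m # map var (sorted_list_of_set (set vs)))"
      using vs by (simp add: sorted_list_of_set.idem_if_sorted_distinct)
    also have "\<dots> = alt (\<lambda>w. F' (m # w)) (set vs)"
      by (rule alt_sorted[symmetric]) (auto simp: F'Down val kind_map_var)
    also have "\<dots> = alt (\<lambda>w. F (m # w)) (set vs) - alt (\<lambda>w. bar_d G (m # w)) (set vs)"
      by (simp add: F'_def alt_linear)
    also have "alt (\<lambda>w. F (m # w)) (set vs) = 0" by (rule alt0) (use m t in auto)
    also have "alt (\<lambda>w. bar_d G (m # w)) (set vs) = 0"
    proof -
      have "alt (\<lambda>w. G (madd m (var v) # w)) (set vs - {v}) = 0" for v
        by (rule alt_eq_0) (auto simp: G0 kind_map_var)
      then show ?thesis by (simp add: alt_bar_d_Cons)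
    qed
    finally show ?thesis by simp
  next
    case False
    then have "kind b = Down" using b by (cases "kind b") auto
    then show ?thesis using F'Down b by simp
  qed
  have "F' w = 0" if w: "nonface_word n D w" for w
  proof -
    obtain m b where mb: "w = m # b" "msupp m \<subseteq> {1..n}" "msupp m \<notin> D" "valid n b"
      using w by (cases w) (auto simp: nonface_word_def)
    have "F' (m # b) = 0"
    proof (rule eq_0_if_bar_d_Down[where n = n and f = "\<lambda>b. F' (m # b)"])
      fix v assume v: "valid n v" "kind v = Down"
      obtain c v' where cv: "v = c # v'" "kind v' \<noteq> Up" using tl v(2) by blast
      have "nonface_word n D (m # v)"
        using v mb emp by (auto simp: nonface_word_def)
      then have "bar_d F' (m # v) = 0" by (rule F'coc)
      moreover have "F' (madd m c # v') = 0"
        by (rule F'nUp) (use cv v mb down in auto)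
      ultimately show "bar_d (\<lambda>b. F' (m # b)) v = 0" by (simp add: cv)
    qed (use mb F'nUp in auto)
    then show ?thesis using mb by simp
  qed
  then show ?thesis by (auto simp: F'_def)
qed

text \<open>Index set of the cochains \<open>g|x\<^sub>1|...|x\<^sub>t\<close>; the set
  \<open>\<tau>\<close> of variables is allowed to meet \<open>g\<close>.\<close>

definition cells :: "nat \<Rightarrow> nat set set \<Rightarrow> (nat set \<times> nat set) set" where
  "cells n D = {(g, \<tau>). g \<subseteq> {1..n} \<and> min_nonface D g \<and> \<tau> \<subseteq> {1..n}}"

definition cell_word :: "nat set \<times> nat set \<Rightarrow> mono list" where
  "cell_word b = chi (fst b) # map var (sorted_list_of_set (snd b))"

definition dual_word :: "mono list \<Rightarrow> mono list \<Rightarrow> 'k::field" where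
  "dual_word u w = (if w = u then 1 else 0)"

lemma finite_cells [simp]: "finite (cells n D)"
  by (rule finite_subset[of _ "Pow {1..n} \<times> Pow {1..n}"]) (auto simp: cells_def)

lemma merges_neq_vars: "valid n w \<Longrightarrow> w' \<in> merges w \<Longrightarrow> w' \<noteq> map var vs"
proof (induction w arbitrary: w' vs rule: merges.induct)
  case (1 a b w)
  have "madd a b \<noteq> var v" for v using 1(2) by (intro madd_neq_var) auto
  then show ?case using 1 by (auto simp: Cons_eq_map_conv) metis
qed auto

text \<open>If the product were the squarefree monomial of \<open>g\<close>, its factors would have
  disjoint supports, and the support of \<open>a\<close> would miss a vertex of \<open>g\<close>,
  hence be a face.\<close>

lemma madd_neq_min_nonface:
  assumes "\<forall>F\<in>D. \<forall>G. G \<subseteq> F \<longrightarrow> G \<in> D" "min_nonface D g" "msupp a \<notin> D" "msupp b \<noteq> {}"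
  shows "madd a b \<noteq> chi g \<and> madd b a \<noteq> chi g"
proof -
  have "madd a b \<noteq> chi g"
  proof
    assume eq: "madd a b = chi g"
    obtain v where v: "b v \<noteq> 0" using assms(4) by (auto simp: msupp_def)
    have "a v + b v \<le> 1" using fun_cong[OF eq, of v] by (simp add: madd_def chi_def split: if_splits)
    then have "v \<notin> msupp a" using v by (simp add: msupp_def)
    moreover have "msupp a \<union> msupp b = g" using eq msupp_madd[of a b] by simp
    moreover have "v \<in> g" using v fun_cong[OF eq, of v] by (simp add: madd_def chi_def split: if_splits)
    ultimately have "msupp a \<subseteq> g - {v}" "g - {v} \<in> D" using assms(2) by (auto simp: min_nonface_def)
    then show False using assms(1,3) by blast
  qed
  then show ?thesis using madd_comm by metis
qed

lemma bar_d_dual_cell: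
  assumes "\<forall>F\<in>D. \<forall>G. G \<subseteq> F \<longrightarrow> G \<in> D" "b \<in> cells n D" "nonface_word n D w"
  shows "bar_d (dual_word (cell_word b)) w = (0::'k::field)"
proof (rule bar_d_eq_0)
  fix w' assume w': "w' \<in> merges w"
  have "w' \<noteq> cell_word b"
  proof (cases w rule: merges.cases)
    case (1 a c r)
    have "madd a c \<noteq> chi (fst b) \<and> madd c a \<noteq> chi (fst b)"
      by (rule madd_neq_min_nonface[of D]) (use assms 1 in \<open>auto simp: cells_def nonface_word_def\<close>)
    moreover have "valid n (c # r)" using assms(3) 1 by (auto simp: nonface_word_def)
    ultimately show ?thesis using w' 1 merges_neq_vars[of n "c # r"] by (auto simp: cell_word_def)
  qed (use w' in auto)
  then show "dual_word (cell_word b) w' = (0::'k)" by (simp add: dual_word_def)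
qed

text \<open>Transports \<open>koszul_cocycle\<close> to words: after subtracting the cells and the
  coboundary of a lift of the Koszul cochain, the antisymmetrisation is zero and
  \<open>bar_exact_if_alt_eq_0\<close> applies.\<close>

lemma nonface_cocycle_cells:
  fixes F :: "mono list \<Rightarrow> 'k::field"
  assumes down: "\<forall>F\<in>D. \<forall>G. G \<subseteq> F \<longrightarrow> G \<in> D" and emp: "{} \<in> D"
    and det: "detects TYPE('k) n D"
    and coc: "\<And>w. nonface_word n D w \<Longrightarrow> bar_d F w = 0"
  shows "\<exists>\<chi> G. \<forall>w. nonface_word n D w \<longrightarrow>
    F w = (\<Sum>b\<in>cells n D. \<chi> b * dual_word (cell_word b) w) + bar_d G w"
proof -
  define \<phi> where "\<phi> m \<tau> = alt (\<lambda>w. F (m # w)) \<tau>" for m \<tau>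
  have \<phi>coc: "(\<Sum>v\<in>\<tau>. ksgn \<tau> v * \<phi> (madd m (var v)) (\<tau> - {v})) = 0"
    if m: "msupp m \<subseteq> {1..n}" "msupp m \<notin> D" "\<tau> \<subseteq> {1..n}" for m \<tau>
  proof -
    have fin: "finite \<tau>" by (rule finite_subset[of _ "{1..n}"]) (use m in auto)
    have "(\<Sum>v\<in>\<tau>. ksgn \<tau> v * \<phi> (madd m (var v)) (\<tau> - {v})) = alt (\<lambda>w. bar_d F (m # w)) \<tau>"
      unfolding \<phi>_def by (rule alt_bar_d_Cons[OF fin, symmetric])
    also have "\<dots> = 0"
    proof (rule alt_eq_0[OF fin])
      fix vs assume "set vs = \<tau>"
      then have "valid n (map var vs)" using m by (auto simp: valid_def)
      then show "bar_d F (m # map var vs) = 0"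
        using m emp by (intro coc) (auto simp: nonface_word_def)
    qed
    finally show ?thesis .
  qed
  have "\<exists>\<psi> \<chi>. \<forall>m \<tau>. msupp m \<subseteq> {1..n} \<longrightarrow> msupp m \<notin> D \<longrightarrow> \<tau> \<subseteq> {1..n} \<longrightarrow>
     \<phi> m \<tau> = (\<Sum>v\<in>\<tau>. ksgn \<tau> v * \<psi> (madd m (var v)) (\<tau> - {v})) +
       (if m = chi (msupp m) \<and> min_nonface D (msupp m) then \<chi> (msupp m) \<tau> else 0)"
    by (rule koszul_cocycle[OF det]) (rule \<phi>coc)
  then obtain \<psi> \<chi> where ex: "\<forall>m \<tau>. msupp m \<subseteq> {1..n} \<longrightarrow> msupp m \<notin> D \<longrightarrow> \<tau> \<subseteq> {1..n} \<longrightarrow>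
     \<phi> m \<tau> = (\<Sum>v\<in>\<tau>. ksgn \<tau> v * \<psi> (madd m (var v)) (\<tau> - {v})) +
       (if m = chi (msupp m) \<and> min_nonface D (msupp m) then \<chi> (msupp m) \<tau> else 0)"
    by (elim exE)
  note * = ex[rule_format]
  \<comment> \<open>A bar cochain with antisymmetrisation \<open>\<psi>\<close>: it lives on
    increasing tails of variables, from which the set is recovered as the union of the
    supports.\<close>
  define \<Psi> where "\<Psi> w = (case w of [] \<Rightarrow> 0 | m # b \<Rightarrow>
      if \<exists>\<tau>. finite \<tau> \<and> b = map var (sorted_list_of_set \<tau>)
      then \<psi> m (\<Union>(msupp ` set b)) else 0)" for w
  define E where "E w = (\<Sum>b\<in>cells n D. case_prod \<chi> b * dual_word (cell_word b) w)" for w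
  define F' where "F' w = F w - bar_d \<Psi> w - E w" for w
  have inj: "sorted_list_of_set \<tau> = sorted_list_of_set \<tau>' \<longleftrightarrow> \<tau> = \<tau>'" if "finite \<tau>" "finite \<tau>'" for \<tau> \<tau>' :: "nat set"
    using that by (metis set_sorted_list_of_set)
  have injv: "inj var" by (rule injI) (metis msupp_chi singleton_inject)
  have alt\<Psi>: "alt (\<lambda>w. \<Psi> (m # w)) \<tau> = \<psi> m \<tau>" if fin: "finite \<tau>" for m \<tau>
  proof -
    have "alt (\<lambda>w. \<Psi> (m # w)) \<tau> = \<Psi> (m # map var (sorted_list_of_set \<tau>))"
    proof (rule alt_sorted[OF fin])
      fix vs :: "nat list" assume "\<not> sorted vs"
      then have "vs \<noteq> sorted_list_of_set \<tau>'" for \<tau>' by auto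
      then show "\<Psi> (m # map var vs) = 0" by (auto simp: \<Psi>_def inj_map_eq_map[OF injv])
    qed
    also have "\<dots> = \<psi> m \<tau>" using fin by (auto simp: \<Psi>_def image_image)
    finally show ?thesis .
  qed
  have altE: "alt (\<lambda>w. E (m # w)) \<tau> =
      (if m = chi (msupp m) \<and> min_nonface D (msupp m) then \<chi> (msupp m) \<tau> else 0)"
    if m: "msupp m \<subseteq> {1..n}" "\<tau> \<subseteq> {1..n}" for m \<tau>
  proof -
    have fin: "finite \<tau>" by (rule finite_subset[of _ "{1..n}"]) (use m in auto)
    have fin': "finite (snd b)" if "b \<in> cells n D" for b
      using that finite_subset by (fastforce simp: cells_def)
    have "alt (\<lambda>w. E (m # w)) \<tau> = E (m # map var (sorted_list_of_set \<tau>))"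
    proof (rule alt_sorted[OF fin])
      fix vs :: "nat list" assume "\<not> sorted vs"
      then have "vs \<noteq> sorted_list_of_set \<tau>'" for \<tau>' by auto
      then show "E (m # map var vs) = 0"
        by (auto simp: E_def dual_word_def cell_word_def inj_map_eq_map[OF injv])
    qed
    also have "\<dots> = (\<Sum>b\<in>cells n D. if b = (msupp m, \<tau>) \<and> m = chi (msupp m) then case_prod \<chi> b else 0)"
      unfolding E_def
    proof (rule sum.cong[OF refl])
      fix b assume b: "b \<in> cells n D"
      obtain g \<tau>' where gt: "b = (g, \<tau>')" by (cases b)
      have "m # map var (sorted_list_of_set \<tau>) = cell_word b \<longleftrightarrow> m = chi g \<and> \<tau> = \<tau>'"
        using fin fin'[OF b] gt by (simp add: cell_word_def inj_map_eq_map[OF injv] inj)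
      moreover have "m = chi g \<longleftrightarrow> g = msupp m \<and> m = chi (msupp m)" by (metis msupp_chi)
      ultimately have "m # map var (sorted_list_of_set \<tau>) = cell_word b \<longleftrightarrow>
          b = (msupp m, \<tau>) \<and> m = chi (msupp m)"
        unfolding gt by blast
      then show "case_prod \<chi> b * dual_word (cell_word b) (m # map var (sorted_list_of_set \<tau>)) =
         (if b = (msupp m, \<tau>) \<and> m = chi (msupp m) then case_prod \<chi> b else 0)"
        by (simp add: dual_word_def)
    qed
    also have "\<dots> = (if m = chi (msupp m) \<and> (msupp m, \<tau>) \<in> cells n D then \<chi> (msupp m) \<tau> else 0)"
      by (cases "m = chi (msupp m)") (simp_all add: sum.delta[OF finite_cells])
    also have "(msupp m, \<tau>) \<in> cells n D \<longleftrightarrow> min_nonface D (msupp m)"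
      using m by (simp add: cells_def)
    finally show ?thesis .
  qed
  have "\<exists>G. \<forall>w. nonface_word n D w \<longrightarrow> F' w = bar_d G w"
  proof (rule bar_exact_if_alt_eq_0[OF down emp])
    fix w assume w: "nonface_word n D w"
    have "bar_d E w = 0"
      unfolding E_def by (simp add: bar_d_sum bar_d_scale bar_d_dual_cell[OF down _ w])
    then show "bar_d F' w = 0"
      unfolding F'_def using coc[OF w] by (simp add: bar_d_diff bar_d_bar_d)
  next
    fix m \<tau> assume m: "msupp m \<subseteq> {1..n}" "msupp m \<notin> D" "\<tau> \<subseteq> {1..n}"
    have fin: "finite \<tau>" by (rule finite_subset[of _ "{1..n}"]) (use m in auto)
    have "alt (\<lambda>w. F' (m # w)) \<tau> = \<phi> m \<tau> - alt (\<lambda>w. bar_d \<Psi> (m # w)) \<tau> - alt (\<lambda>w. E (m # w)) \<tau>"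
      using fin by (simp add: F'_def alt_linear \<phi>_def)
    then show "alt (\<lambda>w. F' (m # w)) \<tau> = 0"
      using fin m by (simp add: alt_bar_d_Cons alt\<Psi> altE *)
  qed
  then obtain G where G: "\<And>w. nonface_word n D w \<Longrightarrow> F' w = bar_d G w" by blast
  have "F w = (\<Sum>b\<in>cells n D. case_prod \<chi> b * dual_word (cell_word b) w) + bar_d (\<lambda>w. \<Psi> w + G w) w"
    if "nonface_word n D w" for w
    using G[OF that] by (simp add: F'_def E_def bar_d_add algebra_simps)
  then show ?thesis by blast
qed

section \<open>Sequential Cohen--Macaulayness of the Alexander dual\<close>

text \<open>Gaussian elimination over the columns. It translates the cohomological claim of
  \<open>detects\<close> into the homology that Cohen--Macaulayness speaks about.\<close>

lemma fredholm_alternative: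
  fixes M :: "'a \<Rightarrow> 'b \<Rightarrow> 'k::field"
  assumes "finite B" "finite A"
    and "\<And>c. (\<forall>b\<in>B. (\<Sum>a\<in>A. c a * M a b) = 0) \<Longrightarrow> (\<Sum>a\<in>A. c a * \<phi> a) = 0"
  shows "\<exists>\<psi>. \<forall>a\<in>A. \<phi> a = (\<Sum>b\<in>B. M a b * \<psi> b)"
  using assms(1,3)
proof (induction B arbitrary: M \<phi> rule: finite_induct)
  case empty
  have "\<phi> a = 0" if "a \<in> A" for a
  proof -
    have "(\<Sum>x\<in>A. (if x = a then 1 else 0) * \<phi> x) = 0" by (rule empty) simp
    also have "(\<Sum>x\<in>A. (if x = a then 1 else 0) * \<phi> x) = (\<Sum>x\<in>A. if x = a then \<phi> x else 0)"
      by (intro sum.cong) auto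
    finally show ?thesis using assms(2) that by simp
  qed
  then show ?case by simp
next
  case (insert b0 B)
  show ?case
  proof (cases "\<exists>a0\<in>A. M a0 b0 \<noteq> 0")
    case True
    then obtain a0 where a0: "a0 \<in> A" "M a0 b0 \<noteq> 0" by blast
    define p where "p = M a0 b0"
    have p: "p \<noteq> 0" using a0 by (simp add: p_def)
    define M' where "M' a b = M a b - M a b0 / p * M a0 b" for a b
    define \<phi>' where "\<phi>' a = \<phi> a - M a b0 / p * \<phi> a0" for a
    have "\<exists>\<psi>. \<forall>a\<in>A. \<phi>' a = (\<Sum>b\<in>B. M' a b * \<psi> b)"
    proof (rule insert.IH)
      fix c assume c: "\<forall>b\<in>B. (\<Sum>a\<in>A. c a * M' a b) = 0"
      \<comment> \<open>Lowering \<open>c\<close> by \<open>t\<close> at the pivot row makes it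
        annihilate the pivot column too, so that the hypothesis for \<open>insert b0 B\<close>
        applies.\<close>
      define t where "t = (\<Sum>a\<in>A. c a * (M a b0 / p))"
      define c' where "c' a = c a - (if a = a0 then t else 0)" for a
      have c': "(\<Sum>a\<in>A. c' a * X a) = (\<Sum>a\<in>A. c a * (X a - M a b0 / p * X a0))" for X
      proof -
        have "(\<Sum>a\<in>A. c' a * X a) = (\<Sum>a\<in>A. c a * X a) - (\<Sum>a\<in>A. (if a = a0 then t * X a else 0))"
          unfolding c'_def sum_subtractf[symmetric] by (intro sum.cong) (auto simp: left_diff_distrib)
        also have "(\<Sum>a\<in>A. (if a = a0 then t * X a else 0)) = t * X a0"
          using assms(2) a0 by simp
        finally show ?thesis
          by (simp add: t_def right_diff_distrib sum_subtractf sum_distrib_right mult.assoc)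
      qed
      have "\<forall>b\<in>insert b0 B. (\<Sum>a\<in>A. c' a * M a b) = 0"
        using c p unfolding c' by (auto simp: M'_def p_def[symmetric])
      then have "(\<Sum>a\<in>A. c' a * \<phi> a) = 0" by (rule insert.prems)
      then show "(\<Sum>a\<in>A. c a * \<phi>' a) = 0" by (simp add: c' \<phi>'_def)
    qed
    then obtain \<psi> where \<psi>: "\<And>a. a \<in> A \<Longrightarrow> \<phi>' a = (\<Sum>b\<in>B. M' a b * \<psi> b)" by blast
    define \<psi>' where "\<psi>' b = (if b = b0 then (\<phi> a0 - (\<Sum>b\<in>B. M a0 b * \<psi> b)) / p else \<psi> b)" for b
    have "\<phi> a = (\<Sum>b\<in>insert b0 B. M a b * \<psi>' b)" if a: "a \<in> A" for a
    proof -
      have "(\<Sum>b\<in>B. M a b * \<psi>' b) = (\<Sum>b\<in>B. M a b * \<psi> b)"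
        using insert.hyps by (intro sum.cong) (auto simp: \<psi>'_def)
      moreover have "\<phi> a - M a b0 / p * \<phi> a0 = (\<Sum>b\<in>B. M a b * \<psi> b) - M a b0 / p * (\<Sum>b\<in>B. M a0 b * \<psi> b)"
        using \<psi>[OF a] by (simp add: \<phi>'_def M'_def left_diff_distrib sum_subtractf sum_distrib_left mult.assoc)
      ultimately show ?thesis using insert.hyps
        by (simp add: \<psi>'_def field_simps p)
    qed
    then show ?thesis by blast
  next
    case False
    then have z: "M a b0 = 0" if "a \<in> A" for a using that by blast
    have "\<exists>\<psi>. \<forall>a\<in>A. \<phi> a = (\<Sum>b\<in>B. M a b * \<psi> b)"
      by (rule insert.IH) (rule insert.prems, simp add: z)
    then show ?thesis using insert.hyps z by simp
  qed
qed

text \<open>The Koszul coboundary is the transpose of the boundary of the full simplex on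
  \<open>\<sigma>\<close>; the two double sums are matched by inserting \<open>v\<close>.\<close>

lemma bd_pairing:
  fixes b \<phi> :: "nat set \<Rightarrow> 'k::field"
  assumes fin: "finite \<sigma>"
  shows "(\<Sum>\<tau>\<in>Pow \<sigma>. (\<Sum>v\<in>\<sigma> - \<tau>. ksgn \<tau> v * b (insert v \<tau>)) * \<phi> \<tau>) =
    (\<Sum>\<rho>\<in>Pow \<sigma>. b \<rho> * (\<Sum>v\<in>\<rho>. ksgn \<rho> v * \<phi> (\<rho> - {v})))"
proof -
  have fin': "finite \<tau>" if "\<tau> \<in> Pow \<sigma>" for \<tau> using that fin finite_subset by auto
  have "(\<Sum>\<tau>\<in>Pow \<sigma>. (\<Sum>v\<in>\<sigma> - \<tau>. ksgn \<tau> v * b (insert v \<tau>)) * \<phi> \<tau>) =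
     (\<Sum>(\<tau>, v)\<in>Sigma (Pow \<sigma>) (\<lambda>\<tau>. \<sigma> - \<tau>). ksgn \<tau> v * b (insert v \<tau>) * \<phi> \<tau>)"
    using fin by (subst sum.Sigma[symmetric]) (auto simp: sum_distrib_right)
  also have "\<dots> = (\<Sum>(\<rho>, v)\<in>Sigma (Pow \<sigma>) (\<lambda>\<rho>. \<rho>). b \<rho> * (ksgn \<rho> v * \<phi> (\<rho> - {v})))"
  proof (rule sum.reindex_bij_witness[where i = "\<lambda>(\<rho>, v). (\<rho> - {v}, v)" and j = "\<lambda>(\<tau>, v). (insert v \<tau>, v)"])
    fix x assume "x \<in> Sigma (Pow \<sigma>) (\<lambda>\<tau>. \<sigma> - \<tau>)"
    then obtain \<tau> v where x: "x = (\<tau>, v)" "\<tau> \<subseteq> \<sigma>" "v \<in> \<sigma>" "v \<notin> \<tau>" by auto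
    have "ksgn (insert v \<tau>) v = (ksgn \<tau> v :: 'k)" using x fin'[of \<tau>] by (simp add: ksgn_insert)
    then show "(case case x of (\<tau>, v) \<Rightarrow> (insert v \<tau>, v) of
         (\<rho>, v) \<Rightarrow> b \<rho> * (ksgn \<rho> v * \<phi> (\<rho> - {v}))) =
         (case x of (\<tau>, v) \<Rightarrow> ksgn \<tau> v * b (insert v \<tau>) * \<phi> \<tau>)"
      using x by (simp add: mult_ac)
  qed auto
  also have "\<dots> = (\<Sum>\<rho>\<in>Pow \<sigma>. b \<rho> * (\<Sum>v\<in>\<rho>. ksgn \<rho> v * \<phi> (\<rho> - {v})))"
    using fin fin' by (subst sum.Sigma[symmetric]) (auto simp: sum_distrib_left)
  finally show ?thesis .
qed

lemma bd_eq_sum: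
  assumes "L \<subseteq> Pow \<sigma>" "finite \<sigma>" "\<And>F. c F \<noteq> 0 \<Longrightarrow> F \<in> L"
  shows "bd L c G = (\<Sum>v\<in>\<sigma> - G. ksgn G v * (c (insert v G) :: 'k::field))"
  unfolding bd_def ksgn_def
  by (rule sum.mono_neutral_left) (use assms in auto)

text \<open>The hypothesis on the support of \<open>c\<close> makes it a chain on the link of the complement of \<open>\<sigma>\<close> in a pure
  skeleton whose dimension exceeds that of \<open>c\<close>, which is where Cohen--Macaulayness applies.\<close>

lemma homology_link_pure_skeleton:
  fixes c :: "nat set \<Rightarrow> 'k::field"
  assumes sc: "simplicial_complex n D" and cm: "seq_CM TYPE('k) (alexander_dual n D)"
    and \<sigma>: "\<sigma> \<subseteq> {1..n}"
    and supp: "\<And>\<tau>. c \<tau> \<noteq> 0 \<Longrightarrow> \<tau> \<subseteq> \<sigma> \<and> card \<tau> = j \<and> (\<exists>v\<in>\<sigma> - \<tau>. \<sigma> - \<tau> - {v} \<notin> D)"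
    and cyc: "\<And>G. G \<subseteq> \<sigma> \<Longrightarrow> card G + 1 = j \<Longrightarrow> (\<Sum>v\<in>\<sigma> - G. ksgn G v * c (insert v G)) = 0"
  shows "\<exists>b. (\<forall>\<rho>. b \<rho> \<noteq> 0 \<longrightarrow> \<rho> \<subseteq> \<sigma> \<and> \<sigma> - \<rho> \<notin> D) \<and>
    (\<forall>\<tau>. card \<tau> = j \<longrightarrow> c \<tau> = (\<Sum>v\<in>\<sigma> - \<tau>. ksgn \<tau> v * b (insert v \<tau>)))"
proof (cases "\<exists>\<tau>. c \<tau> \<noteq> 0")
  case False
  then show ?thesis by (intro exI[of _ "\<lambda>_. 0"]) auto
next
  case True
  then obtain \<tau>0 where \<tau>0: "c \<tau>0 \<noteq> 0" by blast
  have fin: "finite \<sigma>" using \<sigma> finite_subset by blast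
  have down: "G \<in> D" if "F \<in> D" "G \<subseteq> F" for F G
    using sc that by (auto simp: simplicial_complex_def)
  \<comment> \<open>A set \<open>\<tau>\<close> in the support of \<open>c\<close>, extended by a
    suitable \<open>v\<close> and by the complement of \<open>\<sigma>\<close>, is a dual face with
    \<open>n - card \<sigma> + j + 1\<close> elements; \<open>q\<close> is its dimension.\<close>
  define q where "q = n - card \<sigma> + j"
  define PS where "PS = pure_skeleton (alexander_dual n D) q"
  define L where "L = link PS ({1..n} - \<sigma>)"
  have inPS: "{1..n} - (\<sigma> - insert v \<tau>) \<in> alexander_dual n D \<and> card ({1..n} - (\<sigma> - insert v \<tau>)) = Suc q"
    if t: "c \<tau> \<noteq> 0" "v \<in> \<sigma> - \<tau>" "\<sigma> - \<tau> - {v} \<notin> D" for \<tau> v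
  proof
    have eq: "\<sigma> - insert v \<tau> = \<sigma> - \<tau> - {v}" by auto
    show "{1..n} - (\<sigma> - insert v \<tau>) \<in> alexander_dual n D"
      unfolding alexander_dual_def eq using t \<sigma> by blast
    have t': "\<tau> \<subseteq> \<sigma>" "card \<tau> = j" using supp[OF t(1)] by auto
    have "card ({1..n} - (\<sigma> - insert v \<tau>)) = n - card (\<sigma> - insert v \<tau>)"
      using \<sigma> fin by (subst card_Diff_subset) auto
    also have "card (\<sigma> - insert v \<tau>) = card \<sigma> - Suc j"
      using t t' fin finite_subset[OF t'(1) fin] by (subst card_Diff_subset) auto
    also have "n - (card \<sigma> - Suc j) = Suc q"
    proof -
      have "Suc j = card (insert v \<tau>)" using t t' finite_subset[OF t'(1) fin] by simp
      also have "\<dots> \<le> card \<sigma>" using t t' fin by (intro card_mono) auto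
      finally have "Suc j \<le> card \<sigma>" .
      moreover have "card \<sigma> \<le> n" using card_mono[OF _ \<sigma>] by simp
      ultimately show ?thesis by (simp add: q_def)
    qed
    finally show "card ({1..n} - (\<sigma> - insert v \<tau>)) = Suc q" .
  qed
  have inL: "\<tau> \<in> L \<and> insert v \<tau> \<in> L \<and> {1..n} - \<sigma> \<in> PS"
    if t: "c \<tau> \<noteq> 0" "v \<in> \<sigma> - \<tau>" "\<sigma> - \<tau> - {v} \<notin> D" for \<tau> v
  proof -
    have "G \<in> PS" if "G \<subseteq> {1..n} - (\<sigma> - insert v \<tau>)" for G
      unfolding PS_def pure_skeleton_def using inPS[OF t] that by blast
    then show ?thesis
      unfolding L_def link_def using supp[OF t(1)] t(2) \<sigma> by (auto simp: subset_iff)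
  qed
  have suppL: "\<tau> \<in> L" if t: "c \<tau> \<noteq> 0" for \<tau>
    using supp[OF t] inL[OF t] by blast
  have L: "\<rho> \<subseteq> \<sigma> \<and> \<sigma> - \<rho> \<notin> D" if r: "\<rho> \<in> L" for \<rho>
  proof -
    have r': "\<rho> \<inter> ({1..n} - \<sigma>) = {}" "\<rho> \<union> ({1..n} - \<sigma>) \<in> PS" using r by (auto simp: L_def link_def)
    then obtain N where N: "N \<subseteq> {1..n}" "N \<notin> D" "\<rho> \<union> ({1..n} - \<sigma>) \<subseteq> {1..n} - N"
      by (auto simp: PS_def pure_skeleton_def alexander_dual_def)
    then have "\<rho> \<subseteq> \<sigma>" "N \<subseteq> \<sigma> - \<rho>" using r'(1) by auto
    then show ?thesis using N down by blast
  qed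
  obtain v0 where v0: "v0 \<in> \<sigma> - \<tau>0" "\<sigma> - \<tau>0 - {v0} \<notin> D" using supp[OF \<tau>0] by blast
  have finL: "finite L" by (rule finite_subset[of _ "Pow \<sigma>"]) (use L fin in auto)
  \<comment> \<open>One face of cardinality \<open>j + 1\<close> in the link puts \<open>j\<close>
    strictly below the top cardinality, the range where homology vanishes.\<close>
  have "card (insert v0 \<tau>0) \<le> Max (card ` L)"
    using inL[OF \<tau>0 v0] finL by (intro Max_ge) auto
  moreover have "card (insert v0 \<tau>0) = Suc j"
    using supp[OF \<tau>0] v0 finite_subset[OF _ fin] by auto
  ultimately have "j < Max (card ` L)" by simp
  moreover have "cohen_macaulay TYPE('k) PS" using cm by (simp add: seq_CM_def PS_def)
  ultimately have "red_hom_vanishes TYPE('k) L j"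
    using inL[OF \<tau>0 v0] by (simp add: cohen_macaulay_def L_def)
  moreover have "chain_on L j c" using supp suppL by (auto simp: chain_on_def)
  moreover have "bd L c G = 0" if "card G + 1 = j" for G
  proof -
    have eq: "bd L c G = (\<Sum>v\<in>\<sigma> - G. ksgn G v * c (insert v G))"
      by (rule bd_eq_sum) (use L fin suppL in auto)
    show ?thesis
    proof (cases "G \<subseteq> \<sigma>")
      case True
      then show ?thesis using eq cyc that by simp
    next
      case False
      then have "c (insert v G) = 0" for v using supp[of "insert v G"] by auto
      then show ?thesis using eq by simp
    qed
  qed
  ultimately obtain b where b: "chain_on L (Suc j) b" "\<And>F. card F = j \<Longrightarrow> c F = bd L b F"
    unfolding red_hom_vanishes_def by blast
  have "bd L b F = (\<Sum>v\<in>\<sigma> - F. ksgn F v * b (insert v F))" for F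
    by (rule bd_eq_sum) (use L fin b in \<open>auto simp: chain_on_def\<close>)
  moreover have "\<rho> \<subseteq> \<sigma> \<and> \<sigma> - \<rho> \<notin> D" if "b \<rho> \<noteq> 0" for \<rho>
    using L b that by (auto simp: chain_on_def)
  ultimately show ?thesis using b(2) by auto
qed

text \<open>By duality it suffices that a functional \<open>c\<close> on \<open>N\<close> that kills
  all coboundaries also kills \<open>\<phi>\<close>. Such a \<open>c\<close> is a cycle, hence a
  boundary of some \<open>b\<close> supported where \<open>\<sigma> - \<rho>\<close> is a nonface,
  and there the cocycle condition makes the pairing with \<open>\<phi>\<close> vanish.\<close>

lemma seq_CM_dual_imp_detects:
  assumes sc: "simplicial_complex n D" and cm: "seq_CM TYPE('k::field) (alexander_dual n D)"
  shows "detects TYPE('k) n D"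
  unfolding detects_def
proof (intro allI impI)
  fix \<sigma> and \<phi> :: "nat set \<Rightarrow> 'k"
  assume \<sigma>: "\<sigma> \<subseteq> {1..n}"
    and coc: "\<forall>\<tau>\<subseteq>\<sigma>. \<sigma> - \<tau> \<notin> D \<longrightarrow> (\<Sum>v\<in>\<tau>. ksgn \<tau> v * \<phi> (\<tau> - {v})) = 0"
  have fin: "finite \<sigma>" using \<sigma> finite_subset by blast
  define N where "N = {\<tau>. \<tau> \<subseteq> \<sigma> \<and> (\<exists>v\<in>\<sigma> - \<tau>. \<sigma> - \<tau> - {v} \<notin> D)}"
  have NP: "N \<subseteq> Pow \<sigma>" by (auto simp: N_def)
  have finN: "finite N" using NP fin by (simp add: finite_subset)
  define M :: "nat set \<Rightarrow> nat set \<Rightarrow> 'k"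
    where "M \<rho> G = (\<Sum>v\<in>\<rho>. ksgn \<rho> v * (if \<rho> - {v} = G then 1 else 0))" for \<rho> G
  have "\<exists>\<psi>. \<forall>\<tau>\<in>N. \<phi> \<tau> = (\<Sum>\<rho>\<in>Pow \<sigma>. M \<tau> \<rho> * \<psi> \<rho>)"
  proof (rule fredholm_alternative)
    fix c assume c: "\<forall>\<rho>\<in>Pow \<sigma>. (\<Sum>\<tau>\<in>N. c \<tau> * M \<tau> \<rho>) = 0"
    define c' where "c' j \<tau> = (if \<tau> \<in> N \<and> card \<tau> = j then c \<tau> else 0)" for j \<tau>
    have "(\<Sum>\<tau>\<in>N. c' j \<tau> * \<phi> \<tau>) = 0" for j
    proof -
      have cyc: "(\<Sum>v\<in>\<sigma> - G. ksgn G v * c' j (insert v G)) = 0" if G: "G \<subseteq> \<sigma>" "card G + 1 = j" for G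
      proof -
        have finG: "finite G" using G fin finite_subset by blast
        define c0 where "c0 \<tau> = (if \<tau> \<in> N then c \<tau> else 0)" for \<tau>
        have "(\<Sum>v\<in>\<sigma> - G. ksgn G v * c' j (insert v G)) = (\<Sum>v\<in>\<sigma> - G. ksgn G v * c0 (insert v G))"
          using G finG by (intro sum.cong) (auto simp: c'_def c0_def)
        also have "\<dots> = (\<Sum>\<tau>\<in>Pow \<sigma>. if \<tau> = G then (\<Sum>v\<in>\<sigma> - \<tau>. ksgn \<tau> v * c0 (insert v \<tau>)) else 0)"
          using fin G by simp
        also have "\<dots> = (\<Sum>\<tau>\<in>Pow \<sigma>. (\<Sum>v\<in>\<sigma> - \<tau>. ksgn \<tau> v * c0 (insert v \<tau>)) * (if \<tau> = G then 1 else 0))"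
          by (intro sum.cong) auto
        also have "\<dots> = (\<Sum>\<rho>\<in>Pow \<sigma>. c0 \<rho> * M \<rho> G)"
          unfolding M_def by (rule bd_pairing[OF fin])
        also have "\<dots> = (\<Sum>\<rho>\<in>N. c \<rho> * M \<rho> G)"
          using fin NP by (intro sum.mono_neutral_cong_right) (auto simp: c0_def)
        also have "\<dots> = 0" using c G by simp
        finally show ?thesis .
      qed
      have "\<exists>b. (\<forall>\<rho>. b \<rho> \<noteq> 0 \<longrightarrow> \<rho> \<subseteq> \<sigma> \<and> \<sigma> - \<rho> \<notin> D) \<and>
          (\<forall>\<tau>. card \<tau> = j \<longrightarrow> c' j \<tau> = (\<Sum>v\<in>\<sigma> - \<tau>. ksgn \<tau> v * b (insert v \<tau>)))"
      proof (rule homology_link_pure_skeleton[OF sc cm \<sigma>])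
        fix \<tau> assume "c' j \<tau> \<noteq> 0"
        then have "\<tau> \<in> N" "card \<tau> = j" by (auto simp: c'_def split: if_splits)
        then show "\<tau> \<subseteq> \<sigma> \<and> card \<tau> = j \<and> (\<exists>v\<in>\<sigma> - \<tau>. \<sigma> - \<tau> - {v} \<notin> D)"
          by (simp add: N_def)
      qed (rule cyc)
      then obtain b where b1: "\<forall>\<rho>. b \<rho> \<noteq> 0 \<longrightarrow> \<rho> \<subseteq> \<sigma> \<and> \<sigma> - \<rho> \<notin> D" and
        b2: "\<forall>\<tau>. card \<tau> = j \<longrightarrow> c' j \<tau> = (\<Sum>v\<in>\<sigma> - \<tau>. ksgn \<tau> v * b (insert v \<tau>))"
        by blast
      \<comment> \<open>The boundary of \<open>b\<close> is known only in cardinality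
        \<open>j\<close>; discarding the other parts of \<open>b\<close> makes the equation hold for
        every \<open>\<tau> \<subseteq> \<sigma>\<close>.\<close>
      define b' where "b' \<rho> = (if card \<rho> = Suc j then b \<rho> else 0)" for \<rho>
      have c'b: "c' j \<tau> = (\<Sum>v\<in>\<sigma> - \<tau>. ksgn \<tau> v * b' (insert v \<tau>))" if "\<tau> \<subseteq> \<sigma>" for \<tau>
      proof -
        have "finite \<tau>" by (rule finite_subset[OF that fin])
        then have b': "b' (insert v \<tau>) = (if card \<tau> = j then b (insert v \<tau>) else 0)" if "v \<in> \<sigma> - \<tau>" for v
          using that by (auto simp: b'_def)
        have "(\<Sum>v\<in>\<sigma> - \<tau>. ksgn \<tau> v * b' (insert v \<tau>)) =
           (\<Sum>v\<in>\<sigma> - \<tau>. ksgn \<tau> v * (if card \<tau> = j then b (insert v \<tau>) else 0))"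
          by (intro sum.cong) (auto simp: b')
        then show ?thesis using b2 by (cases "card \<tau> = j") (auto simp: c'_def)
      qed
      have "(\<Sum>\<tau>\<in>N. c' j \<tau> * \<phi> \<tau>) = (\<Sum>\<tau>\<in>Pow \<sigma>. c' j \<tau> * \<phi> \<tau>)"
        using fin NP by (intro sum.mono_neutral_left) (auto simp: c'_def)
      also have "\<dots> = (\<Sum>\<tau>\<in>Pow \<sigma>. (\<Sum>v\<in>\<sigma> - \<tau>. ksgn \<tau> v * b' (insert v \<tau>)) * \<phi> \<tau>)"
        by (intro sum.cong) (auto simp: c'b)
      also have "\<dots> = (\<Sum>\<rho>\<in>Pow \<sigma>. b' \<rho> * (\<Sum>v\<in>\<rho>. ksgn \<rho> v * \<phi> (\<rho> - {v})))"
        by (rule bd_pairing[OF fin])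
      also have "\<dots> = 0"
      proof (rule sum.neutral, rule ballI)
        fix \<rho> show "b' \<rho> * (\<Sum>v\<in>\<rho>. ksgn \<rho> v * \<phi> (\<rho> - {v})) = 0"
          using b1 coc by (cases "b \<rho> = 0") (auto simp: b'_def)
      qed
      finally show ?thesis .
    qed
    then have "(\<Sum>j\<le>card \<sigma>. \<Sum>\<tau>\<in>N. c' j \<tau> * \<phi> \<tau>) = 0" by simp
    also have "(\<Sum>j\<le>card \<sigma>. \<Sum>\<tau>\<in>N. c' j \<tau> * \<phi> \<tau>) = (\<Sum>\<tau>\<in>N. \<Sum>j\<le>card \<sigma>. c' j \<tau> * \<phi> \<tau>)"
      by (rule sum.swap)
    also have "\<dots> = (\<Sum>\<tau>\<in>N. c \<tau> * \<phi> \<tau>)"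
    proof (rule sum.cong[OF refl])
      fix \<tau> assume t: "\<tau> \<in> N"
      have "card \<tau> \<le> card \<sigma>" using t NP fin by (intro card_mono) auto
      have "(\<Sum>j\<le>card \<sigma>. c' j \<tau> * \<phi> \<tau>) = (\<Sum>j\<le>card \<sigma>. if j = card \<tau> then c \<tau> * \<phi> \<tau> else 0)"
        using t by (intro sum.cong) (auto simp: c'_def)
      then show "(\<Sum>j\<le>card \<sigma>. c' j \<tau> * \<phi> \<tau>) = c \<tau> * \<phi> \<tau>"
        using \<open>card \<tau> \<le> card \<sigma>\<close> by simp
    qed
    finally show "(\<Sum>\<tau>\<in>N. c \<tau> * \<phi> \<tau>) = 0" .
  qed (use fin finN in auto)
  then obtain \<psi> where \<psi>: "\<And>\<tau>. \<tau> \<in> N \<Longrightarrow> \<phi> \<tau> = (\<Sum>\<rho>\<in>Pow \<sigma>. M \<tau> \<rho> * \<psi> \<rho>)" by blast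
  have "\<phi> \<tau> = (\<Sum>v\<in>\<tau>. ksgn \<tau> v * \<psi> (\<tau> - {v}))" if t: "\<tau> \<in> N" for \<tau>
  proof -
    have "(\<Sum>\<rho>\<in>Pow \<sigma>. M \<tau> \<rho> * \<psi> \<rho>) = (\<Sum>\<rho>\<in>Pow \<sigma>. \<Sum>v\<in>\<tau>. if \<tau> - {v} = \<rho> then ksgn \<tau> v * \<psi> \<rho> else 0)"
      unfolding M_def sum_distrib_right by (intro sum.cong) auto
    also have "\<dots> = (\<Sum>v\<in>\<tau>. \<Sum>\<rho>\<in>Pow \<sigma>. if \<tau> - {v} = \<rho> then ksgn \<tau> v * \<psi> \<rho> else 0)"
      by (rule sum.swap)
    also have "\<dots> = (\<Sum>v\<in>\<tau>. ksgn \<tau> v * \<psi> (\<tau> - {v}))"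
      using t NP fin by (intro sum.cong) auto
    finally show ?thesis using \<psi>[OF t] by simp
  qed
  then show "\<exists>\<psi>. \<forall>\<tau>\<subseteq>\<sigma>. (\<exists>v\<in>\<sigma> - \<tau>. \<sigma> - \<tau> - {v} \<notin> D) \<longrightarrow> \<phi> \<tau> = (\<Sum>v\<in>\<tau>. ksgn \<tau> v * \<psi> (\<tau> - {v}))"
    unfolding N_def by blast
qed

text \<open>Here \<open>I\<close> is the maximal ideal and any \<open>r \<in> \<sigma>\<close>
  serves as cone apex. This instance gives the cohomology of \<open>C(S)\<close> itself.\<close>

lemma detects_irrelevant: "detects TYPE('k::field) n {{}}"
  unfolding detects_def
proof (intro allI impI)
  fix \<sigma> and \<phi> :: "nat set \<Rightarrow> 'k"
  assume \<sigma>: "\<sigma> \<subseteq> {1..n}"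
    and coc: "\<forall>\<tau>\<subseteq>\<sigma>. \<sigma> - \<tau> \<notin> {{}} \<longrightarrow> (\<Sum>v\<in>\<tau>. ksgn \<tau> v * \<phi> (\<tau> - {v})) = 0"
  have fin: "finite \<sigma>" using \<sigma> finite_subset by blast
  define r where "r = (SOME r. r \<in> \<sigma>)"
  define \<psi> where "\<psi> = (\<lambda>\<tau>. if r \<in> \<tau> then 0 else ksgn \<tau> r * \<phi> (insert r \<tau>))"
  have "\<phi> \<tau> = (\<Sum>v\<in>\<tau>. ksgn \<tau> v * \<psi> (\<tau> - {v}))"
    if t: "\<tau> \<subseteq> \<sigma>" "v \<in> \<sigma> - \<tau>" "\<sigma> - \<tau> - {v} \<notin> {{}}" for \<tau> v
  proof (rule cone_cobd[OF _ _ \<psi>_def])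
    show "finite \<tau>" using t fin finite_subset by blast
    have r: "r \<in> \<sigma>" unfolding r_def by (rule someI[of _ v]) (use t in auto)
    assume "r \<notin> \<tau>"
    \<comment> \<open>\<open>\<sigma> - \<tau>\<close> has at least two elements, so one is left
      after removing \<open>r\<close>.\<close>
    have "\<sigma> - insert r \<tau> \<noteq> {}" using t by auto
    then show "(\<Sum>v\<in>insert r \<tau>. ksgn (insert r \<tau>) v * \<phi> (insert r \<tau> - {v})) = 0"
      by (intro coc[rule_format]) (use t r in auto)
  qed
  then show "\<exists>\<psi>. \<forall>\<tau>\<subseteq>\<sigma>. (\<exists>v\<in>\<sigma> - \<tau>. \<sigma> - \<tau> - {v} \<notin> {{}}) \<longrightarrow> \<phi> \<tau> = (\<Sum>v\<in>\<tau>. ksgn \<tau> v * \<psi> (\<tau> - {v}))"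
    by blast
qed

section \<open>Lifting along the inclusion of the face ring's bar cochains\<close>

definition std_word :: "nat \<Rightarrow> nat set set \<Rightarrow> mono list \<Rightarrow> bool" where
  "std_word n D w \<longleftrightarrow> valid n w \<and> (\<forall>m\<in>set w. msupp m \<in> D)"

lemma bar_d_append:
  "bar_d f (u @ x # t) = bar_d (\<lambda>u'. f (u' @ x # t)) u
     + (if u = [] then 0 else (-1) ^ (length u - 1) * f (butlast u @ madd (last u) x # t))
     + (-1) ^ length u * bar_d (\<lambda>p. f (u @ p)) (x # t)"
proof (induction u arbitrary: f rule: merges.induct)
  case (1 a b u)
  have "bar_d (\<lambda>w. f (a # w)) ((b # u) @ x # t) = bar_d (\<lambda>u'. f (a # u' @ x # t)) (b # u)
     + (-1) ^ length u * f (a # butlast (b # u) @ madd (last (b # u)) x # t)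
     - (-1) ^ length u * bar_d (\<lambda>p. f (a # (b # u) @ p)) (x # t)"
    using 1[of "\<lambda>w. f (a # w)"] by simp
  then show ?case by simp
qed auto

text \<open>Merging enlarges supports and can only move a letter to the left. Hence cochains that
  vanish on words with a nonface among the first \<open>l\<close> letters are closed under
  \<open>bar_d\<close>, which is what the filtration by prefix length rests on.\<close>

lemma merges_nonface:
  assumes "\<forall>F\<in>D. \<forall>G. G \<subseteq> F \<longrightarrow> G \<in> D" "w' \<in> merges w" "\<exists>m\<in>set (take l w). msupp m \<notin> D"
  shows "\<exists>m\<in>set (take l w'). msupp m \<notin> D"
  using assms(2,3)
proof (induction w arbitrary: w' l rule: merges.induct)
  case (1 a b w)
  obtain k where l: "l = Suc k" using 1(3) by (cases l) auto
  consider "w' = madd a b # w" | w'' where "w' = a # w''" "w'' \<in> merges (b # w)"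
    using 1(2) by auto
  then show ?case
  proof cases
    case 1
    show ?thesis
    proof (cases "msupp a \<in> D \<and> msupp b \<in> D")
      case True
      then obtain k' where "k = Suc k'" "\<exists>m\<in>set (take k' w). msupp m \<notin> D"
        using "1.prems"(2) l by (cases k) auto
      then have "\<exists>m\<in>set (take k w). msupp m \<notin> D"
        by (meson set_take_subset_set_take in_mono lessI less_imp_le)
      then show ?thesis using 1 l by auto
    next
      case False
      then have "msupp (madd a b) \<notin> D"
        using assms(1) by (metis msupp_madd sup_ge1 sup_ge2)
      then show ?thesis using 1 l by auto
    qed
  next
    case 2
    show ?thesis
    proof (cases "msupp a \<in> D")
      case True
      then have "\<exists>m\<in>set (take k (b # w)). msupp m \<notin> D" using "1.prems"(2) l by auto
      then have "\<exists>m\<in>set (take k w''). msupp m \<notin> D" using "1.IH" 2 by blast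
      then show ?thesis using 2 l by auto
    next
      case False
      then show ?thesis using 2 l by auto
    qed
  qed
qed auto

text \<open>Cocycles of \<open>C(R)\<close> of cohomological degree \<open>l\<close>; the internal
  degree is left open and is fixed only in \<open>cocycle_iff\<close>.\<close>

definition std_cocycle :: "nat \<Rightarrow> nat set set \<Rightarrow> nat \<Rightarrow> (mono list \<Rightarrow> 'k::field) \<Rightarrow> bool" where
  "std_cocycle n D l c \<longleftrightarrow> (\<forall>w. c w \<noteq> 0 \<longrightarrow> length w = l \<and> std_word n D w)
     \<and> (\<forall>w. std_word n D w \<longrightarrow> bar_d c w = 0)"

definition cells_span :: "'k::field itself \<Rightarrow> nat \<Rightarrow> nat set set \<Rightarrow> (nat set \<times> nat set) set \<Rightarrow> bool" where
  "cells_span K n D J \<longleftrightarrow> (\<forall>F :: mono list \<Rightarrow> 'k.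
     (\<forall>w. nonface_word n D w \<longrightarrow> bar_d F w = 0) \<longrightarrow>
     (\<exists>\<chi> G. \<forall>w. nonface_word n D w \<longrightarrow>
        F w = (\<Sum>b\<in>J. \<chi> b * dual_word (cell_word b) w) + bar_d G w))"

definition cells_indep :: "'k::field itself \<Rightarrow> nat \<Rightarrow> nat set set \<Rightarrow> (nat set \<times> nat set) set \<Rightarrow> bool" where
  "cells_indep K n D J \<longleftrightarrow> (\<forall>(a :: nat set \<times> nat set \<Rightarrow> 'k) G.
     (\<forall>w. nonface_word n D w \<longrightarrow> (\<Sum>b\<in>J. a b * dual_word (cell_word b) w) = bar_d G w) \<longrightarrow>
     (\<forall>b\<in>J. a b = 0))"

text \<open>In a spanning set of least size there is no relation modulo coboundaries, since it would
  express one cell by the others.\<close>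

lemma cell_basis:
  assumes "cells_span TYPE('k::field) n D (cells n D)"
  shows "\<exists>J\<subseteq>cells n D. cells_span TYPE('k) n D J \<and> cells_indep TYPE('k) n D J"
proof -
  define P where "P J \<longleftrightarrow> J \<subseteq> cells n D \<and> cells_span TYPE('k) n D J" for J
  obtain J where J: "P J" "\<And>J'. P J' \<Longrightarrow> card J \<le> card J'"
    using ex_has_least_nat[of P "cells n D" card] assms by (auto simp: P_def)
  have finJ: "finite J" using J(1) by (auto simp: P_def intro: finite_subset)
  have "cells_indep TYPE('k) n D J"
    unfolding cells_indep_def
  proof (intro allI impI ballI, rule ccontr)
    fix a :: "nat set \<times> nat set \<Rightarrow> 'k" and G b0
    assume a: "\<forall>w. nonface_word n D w \<longrightarrow> (\<Sum>b\<in>J. a b * dual_word (cell_word b) w) = bar_d G w"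
      and b0: "b0 \<in> J" "a b0 \<noteq> 0"
    have "cells_span TYPE('k) n D (J - {b0})"
      unfolding cells_span_def
    proof (intro allI impI)
      fix F :: "mono list \<Rightarrow> 'k" assume "\<forall>w. nonface_word n D w \<longrightarrow> bar_d F w = 0"
      then obtain \<chi> G' where F: "\<forall>w. nonface_word n D w \<longrightarrow>
          F w = (\<Sum>b\<in>J. \<chi> b * dual_word (cell_word b) w) + bar_d G' w"
        using J(1) unfolding P_def cells_span_def by blast
      define t where "t = \<chi> b0 / a b0"
      have "F w = (\<Sum>b\<in>J - {b0}. (\<chi> b - t * a b) * dual_word (cell_word b) w)
          + bar_d (\<lambda>w. G' w + t * G w) w" if w: "nonface_word n D w" for w
      proof -
        have "(\<Sum>b\<in>J - {b0}. (\<chi> b - t * a b) * dual_word (cell_word b) w) =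
            (\<Sum>b\<in>J. (\<chi> b - t * a b) * dual_word (cell_word b) w)"
          using finJ b0 by (intro sum.mono_neutral_left) (auto simp: t_def)
        also have "\<dots> = (\<Sum>b\<in>J. \<chi> b * dual_word (cell_word b) w) - t * bar_d G w"
          using a w by (simp add: left_diff_distrib sum_subtractf mult.assoc sum_distrib_left[symmetric])
        finally show ?thesis using F w by (simp add: bar_d_add bar_d_scale)
      qed
      then show "\<exists>\<chi> G. \<forall>w. nonface_word n D w \<longrightarrow>
          F w = (\<Sum>b\<in>J - {b0}. \<chi> b * dual_word (cell_word b) w) + bar_d G w"
        by (intro exI[of _ "\<lambda>b. \<chi> b - t * a b"] exI[of _ "\<lambda>w. G' w + t * G w"]) simp
    qed
    then have "P (J - {b0})" using J(1) by (auto simp: P_def)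
    then have "card J \<le> card (J - {b0})" by (rule J(2))
    then show False using card_Diff1_less[OF finJ b0(1)] by simp
  qed
  then show ?thesis using J(1) by (auto simp: P_def)
qed

text \<open>The trailing letters of a cell word are vertices, hence faces, so a nonface letter of
  \<open>w\<close> could only be merged into the leading minimal nonface, against
  \<open>madd_neq_min_nonface\<close>; a merge further right leaves a letter that is no variable.
  Thus cells are cocycles of \<open>C(S)/C(R)\<close>.\<close>

lemma bar_d_dual_cell_nonface:
  assumes down: "\<forall>F\<in>D. \<forall>G. G \<subseteq> F \<longrightarrow> G \<in> D" and vert: "\<forall>i\<in>{1..n}. {i} \<in> D"
    and b: "b \<in> cells n D" and w: "valid n w" "\<exists>m\<in>set w. msupp m \<notin> D"
  shows "bar_d (dual_word (cell_word b)) w = (0::'k::field)"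
proof (rule bar_d_eq_0)
  fix w' assume w': "w' \<in> merges w"
  have "w' \<noteq> cell_word b"
  proof (cases w rule: merges.cases)
    case (1 a c r)
    have fin: "finite (snd b)" by (rule finite_subset[of _ "{1..n}"]) (use b in \<open>auto simp: cells_def\<close>)
    have mnf: "min_nonface D (fst b)" "snd b \<subseteq> {1..n}" using b by (auto simp: cells_def)
    have "madd a c # r \<noteq> cell_word b"
    proof
      assume eq: "madd a c # r = cell_word b"
      then have "\<forall>m\<in>set r. msupp m \<in> D" using vert fin mnf by (auto simp: cell_word_def)
      then have "msupp a \<notin> D \<or> msupp c \<notin> D" using w(2) 1 by auto
      moreover have "msupp a \<noteq> {}" "msupp c \<noteq> {}" using w(1) 1 by auto
      ultimately have "madd a c \<noteq> chi (fst b)"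
        using madd_neq_min_nonface[OF down mnf(1)] by blast
      then show False using eq by (simp add: cell_word_def)
    qed
    moreover have "valid n (c # r)" using w 1 by auto
    ultimately show ?thesis using w' 1 merges_neq_vars[of n "c # r"] by (auto simp: cell_word_def)
  qed (use w' in auto)
  then show "dual_word (cell_word b) w' = (0::'k)" by (simp add: dual_word_def)
qed

lemma bar_d_std_cocycle:
  assumes down: "\<forall>F\<in>D. \<forall>G. G \<subseteq> F \<longrightarrow> G \<in> D" and c: "std_cocycle n D l c" and w: "valid n w"
  shows "bar_d c w = (0::'k::field)"
proof (cases "std_word n D w")
  case True
  then show ?thesis using c by (simp add: std_cocycle_def)
next
  case False
  show ?thesis
  proof (rule bar_d_eq_0)
    fix w' assume w': "w' \<in> merges w"
    have "\<exists>m\<in>set (take (length w) w'). msupp m \<notin> D"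
      by (rule merges_nonface[OF down w']) (use False w in \<open>auto simp: std_word_def\<close>)
    then have "\<not> std_word n D w'" by (auto simp: std_word_def dest: in_set_takeD)
    then show "c w' = 0" using c by (auto simp: std_cocycle_def)
  qed
qed

lemma bar_d_cup_std_cocycle:
  fixes c :: "mono list \<Rightarrow> 'k::field"
  assumes down: "\<forall>F\<in>D. \<forall>G. G \<subseteq> F \<longrightarrow> G \<in> D" and c: "std_cocycle n D l c" and w: "valid n w"
  shows "bar_d (cup l c f) w = (-1) ^ l * cup l c (bar_d f) w"
proof (cases "l < length w")
  case True
  have "valid n (take (Suc l) w)" using w by (auto simp: valid_def dest: in_set_takeD)
  then have "bar_d c (take (Suc l) w) = 0" by (rule bar_d_std_cocycle[OF down c])
  then show ?thesis using True by (simp add: bar_d_cup) (simp add: cup_def)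
next
  case False
  have "bar_d (cup l c f) w = 0"
  proof (rule bar_d_eq_0)
    fix w' assume "w' \<in> merges w"
    then have "length w' < l" using length_merges[of w' w] False by simp
    then have "c (take l w') = 0" using c by (auto simp: std_cocycle_def)
    then show "cup l c f w' = 0" by (simp add: cup_def)
  qed
  moreover have "drop l w = []" using False by simp
  ultimately show ?thesis by (simp add: cup_def)
qed

text \<open>Split words as \<open>u @ p\<close> where \<open>u\<close> has length \<open>l\<close> and \<open>p\<close> starts with a nonface. For fixed \<open>u\<close> the
  lowest term of \<open>y\<close> is a cocycle in \<open>p\<close>, hence a combination of cells with coefficients \<open>c b u\<close>. Since
  multiplying a nonface monomial never yields a minimal nonface, linear independence of the cells in
  cohomology forces every \<open>c b\<close> to be a cocycle.\<close>

lemma nonface_cocycle_lift_step: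
  fixes y :: "mono list \<Rightarrow> 'k::field"
  assumes down: "\<forall>F\<in>D. \<forall>G. G \<subseteq> F \<longrightarrow> G \<in> D"
    and J: "J \<subseteq> cells n D" "cells_span TYPE('k) n D J" "cells_indep TYPE('k) n D J"
    and coc: "\<And>w. valid n w \<Longrightarrow> \<exists>m\<in>set w. msupp m \<notin> D \<Longrightarrow> bar_d y w = 0"
    and van: "\<And>w. valid n w \<Longrightarrow> \<exists>m\<in>set (take l w). msupp m \<notin> D \<Longrightarrow> y w = 0"
  shows "\<exists>c H. (\<forall>b\<in>J. std_cocycle n D l (c b)) \<and>
    (\<forall>w. valid n w \<longrightarrow> (\<exists>m\<in>set (take (Suc l) w). msupp m \<notin> D) \<longrightarrow>
       y w = (\<Sum>b\<in>J. cup l (c b) (dual_word (cell_word b)) w) + bar_d H w)"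
proof -
  let ?B = "\<lambda>b. dual_word (cell_word b) :: mono list \<Rightarrow> 'k"
  have van_append: "z (u' @ x # t) = 0"
    if a: "valid n (u' @ x # t)" "length u' < l" "msupp x \<notin> D"
      "\<And>w. valid n w \<Longrightarrow> \<exists>m\<in>set (take l w). msupp m \<notin> D \<Longrightarrow> z w = 0"
    for z :: "mono list \<Rightarrow> 'k" and u' x t
  proof (rule a(4)[OF a(1)])
    obtain k where "l - length u' = Suc k" using a(2) by (cases "l - length u'") auto
    then show "\<exists>m\<in>set (take l (u' @ x # t)). msupp m \<notin> D" using a(3) by auto
  qed
  \<comment> \<open>A merge inside \<open>u\<close> or across its end moves a nonface into the first
    \<open>l\<close> letters, where \<open>z\<close> vanishes; only the merges inside
    \<open>p\<close> remain.\<close>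
  have red: "bar_d z (u @ p) = (-1) ^ l * bar_d (\<lambda>p. z (u @ p)) p"
    if u: "valid n u" "length u = l" and p: "nonface_word n D p"
      and z: "\<And>w. valid n w \<Longrightarrow> \<exists>m\<in>set (take l w). msupp m \<notin> D \<Longrightarrow> z w = 0"
    for z :: "mono list \<Rightarrow> 'k" and u p
  proof -
    obtain x t where xt: "p = x # t" "valid n (x # t)" "msupp x \<notin> D"
      using p by (cases p) (auto simp: nonface_word_def)
    have "bar_d (\<lambda>u'. z (u' @ x # t)) u = 0"
    proof (rule bar_d_eq_0)
      fix u' assume u': "u' \<in> merges u"
      show "z (u' @ x # t) = 0"
        by (rule van_append[OF _ _ _ z])
           (use u' u xt valid_merges[OF u'] length_merges[OF u'] in auto)
    qed
    moreover have "z (butlast u @ madd (last u) x # t) = 0" if ne: "u \<noteq> []"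
    proof (rule van_append[OF _ _ _ z])
      have "last u \<in> set u" "\<forall>m\<in>set (butlast u). m \<in> set u" using ne by (auto dest: in_set_butlastD)
      then show "valid n (butlast u @ madd (last u) x # t)" using u xt by (auto simp: valid_def)
      show "length (butlast u) < l" using u ne by (cases u) auto
      show "msupp (madd (last u) x) \<notin> D" using xt down by (metis msupp_madd sup_ge2)
    qed auto
    ultimately show ?thesis unfolding xt(1) bar_d_append[of z u] using u by auto
  qed
  have ex: "\<exists>\<chi> G. \<forall>p. nonface_word n D p \<longrightarrow> y (u @ p) = (\<Sum>b\<in>J. \<chi> b * ?B b p) + bar_d G p"
    if u: "std_word n D u" "length u = l" for u
  proof -
    have "bar_d (\<lambda>p. y (u @ p)) p = 0" if p: "nonface_word n D p" for p
    proof -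
      have "\<exists>m\<in>set (u @ p). msupp m \<notin> D" using p hd_in_set by (fastforce simp: nonface_word_def)
      then have "bar_d y (u @ p) = 0" using u p by (intro coc) (auto simp: std_word_def nonface_word_def)
      moreover have "bar_d y (u @ p) = (-1) ^ l * bar_d (\<lambda>p. y (u @ p)) p"
        by (rule red) (use u p van in \<open>auto simp: std_word_def\<close>)
      ultimately show ?thesis by simp
    qed
    then show ?thesis using J(2) unfolding cells_span_def by blast
  qed
  \<comment> \<open>The choice is made for each prefix \<open>u\<close> separately; that the
    coefficients fit together to cocycles is shown afterwards.\<close>
  define \<chi> where "\<chi> u = (SOME \<chi>. \<exists>G. \<forall>p. nonface_word n D p \<longrightarrow> y (u @ p) = (\<Sum>b\<in>J. \<chi> b * ?B b p) + bar_d G p)" for u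
  define G where "G u = (SOME G. \<forall>p. nonface_word n D p \<longrightarrow> y (u @ p) = (\<Sum>b\<in>J. \<chi> u b * ?B b p) + bar_d G p)" for u
  have y: "y (u @ p) = (\<Sum>b\<in>J. \<chi> u b * ?B b p) + bar_d (G u) p"
    if u: "std_word n D u" "length u = l" and p: "nonface_word n D p" for u p
  proof -
    have "\<exists>G. \<forall>p. nonface_word n D p \<longrightarrow> y (u @ p) = (\<Sum>b\<in>J. \<chi> u b * ?B b p) + bar_d G p"
      unfolding \<chi>_def using someI_ex[OF ex[OF u]] .
    then have "\<forall>p. nonface_word n D p \<longrightarrow> y (u @ p) = (\<Sum>b\<in>J. \<chi> u b * ?B b p) + bar_d (G u) p"
      unfolding G_def by (rule someI_ex)
    then show ?thesis using p by blast
  qed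
  define c where "c b u = (if std_word n D u \<and> length u = l then \<chi> u b else 0)" for b u
  \<comment> \<open>Reassembles the cochains \<open>G u\<close>; the sign cancels the one that
    \<open>bar_d\<close> picks up when passing the prefix.\<close>
  define H where "H w = (if std_word n D (take l w) \<and> l \<le> length w
      then (-1) ^ l * G (take l w) (drop l w) else 0)" for w
  have Hvan: "H w = 0" if "\<exists>m\<in>set (take l w). msupp m \<notin> D" for w
    using that by (auto simp: H_def std_word_def)
  have dHvan: "bar_d H w = 0" if "\<exists>m\<in>set (take l w). msupp m \<notin> D" for w
    by (rule bar_d_eq_0) (use that merges_nonface[OF down] Hvan in blast)
  have dH: "bar_d H (u @ p) = bar_d (G u) p"
    if u: "std_word n D u" "length u = l" and p: "nonface_word n D p" for u p
  proof -
    have "bar_d H (u @ p) = (-1) ^ l * bar_d (\<lambda>p. H (u @ p)) p"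
      by (rule red) (use u p Hvan in \<open>auto simp: std_word_def\<close>)
    moreover have "(\<lambda>p. H (u @ p)) = (\<lambda>p. (-1) ^ l * G u p)" using u by (auto simp: H_def)
    ultimately show ?thesis by (simp add: bar_d_scale mult.assoc[symmetric] power_add[symmetric] mult_2[symmetric])
  qed
  define y1 where "y1 w = y w - bar_d H w" for w
  have y1van: "y1 w = 0" if "valid n w" "\<exists>m\<in>set (take l w). msupp m \<notin> D" for w
    using van that dHvan by (simp add: y1_def)
  have y1: "y1 (u @ p) = (\<Sum>b\<in>J. c b u * ?B b p)"
    if u: "valid n u" "length u = l" and p: "nonface_word n D p" for u p
  proof (cases "std_word n D u")
    case True
    then show ?thesis using y[OF True u(2) p] dH[OF True u(2) p] u by (simp add: y1_def c_def)
  next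
    case False
    then have "\<exists>m\<in>set u. msupp m \<notin> D" using u by (auto simp: std_word_def)
    then have "y1 (u @ p) = 0" using u p by (intro y1van) (auto simp: nonface_word_def)
    then show ?thesis using False by (simp add: c_def)
  qed
  have y1coc: "bar_d y1 w = 0" if "valid n w" "\<exists>m\<in>set w. msupp m \<notin> D" for w
    using coc[OF that] unfolding y1_def by (simp add: bar_d_diff bar_d_bar_d)
  have good: "std_cocycle n D l (c b)" if b: "b \<in> J" for b
  proof -
    have "bar_d (c b) u = 0" if u: "std_word n D u" for u
    proof (cases "length u = Suc l")
      case False
      show ?thesis by (rule bar_d_eq_0) (use False length_merges in \<open>force simp: c_def\<close>)
    next
      case len: True
      then have ne: "u \<noteq> []" by auto
      have uv: "valid n u" using u by (simp add: std_word_def)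
      \<comment> \<open>At a prefix of length \<open>Suc l\<close> the cocycle condition for
        \<open>y1\<close> splits into merges inside \<open>u\<close>, which give
        \<open>bar_d (c b)\<close>, the merge across its end, which vanishes, and a coboundary in
        \<open>p\<close>.\<close>
      have "(\<Sum>b\<in>J. bar_d (c b) u * ?B b p) = bar_d (\<lambda>p. (-1) ^ l * y1 (u @ p)) p"
        if p: "nonface_word n D p" for p
      proof -
        obtain x t where xt: "p = x # t" "valid n (x # t)" "msupp x \<notin> D"
          using p by (cases p) (auto simp: nonface_word_def)
        have "bar_d y1 (u @ p) = 0"
          by (rule y1coc) (use uv xt in auto)
        moreover have "bar_d (\<lambda>u'. y1 (u' @ p)) u = bar_d (\<lambda>u'. \<Sum>b\<in>J. ?B b p * c b u') u"
        proof (rule bar_d_cong)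
          fix u' assume u': "u' \<in> merges u"
          show "y1 (u' @ p) = (\<Sum>b\<in>J. ?B b p * c b u')"
            using y1[OF valid_merges[OF u' uv] _ p] length_merges[OF u'] len by (simp add: mult.commute)
        qed
        moreover have "bar_d (\<lambda>u'. \<Sum>b\<in>J. ?B b p * c b u') u = (\<Sum>b\<in>J. bar_d (c b) u * ?B b p)"
          by (simp only: bar_d_sum bar_d_scale) (simp add: mult.commute)
        moreover have "y1 (butlast u @ madd (last u) x # t) = 0"
        proof -
          have l: "last u \<in> set u" "\<forall>m\<in>set (butlast u). m \<in> set u" using ne by (auto dest: in_set_butlastD)
          have ml: "msupp (last u) \<noteq> {}" "msupp (last u) \<subseteq> {1..n}" using l uv by (auto simp: valid_def)
          have "y1 (butlast u @ madd (last u) x # t) = (\<Sum>b\<in>J. c b (butlast u) * ?B b (madd (last u) x # t))"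
          proof (rule y1)
            show "valid n (butlast u)" using l uv by (auto simp: valid_def)
            show "length (butlast u) = l" using len by simp
            have "msupp (madd (last u) x) \<notin> D" using xt down by (metis msupp_madd sup_ge2)
            then show "nonface_word n D (madd (last u) x # t)" using ml xt by (auto simp: nonface_word_def)
          qed
          also have "\<dots> = 0"
          proof (rule sum.neutral, rule ballI)
            fix b assume "b \<in> J"
            then have "min_nonface D (fst b)" using J(1) by (auto simp: cells_def)
            then have "madd (last u) x \<noteq> chi (fst b)"
              using madd_neq_min_nonface[OF down _ xt(3) ml(1)] by blast
            then show "c b (butlast u) * ?B b (madd (last u) x # t) = 0"
              by (simp add: dual_word_def cell_word_def)
          qed
          finally show ?thesis .
        qed
        ultimately have "0 = (\<Sum>b\<in>J. bar_d (c b) u * ?B b p) + (-1) ^ Suc l * bar_d (\<lambda>p. y1 (u @ p)) p"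
          using bar_d_append[of y1 u x t] len ne xt(1) by simp
        then show ?thesis by (simp add: bar_d_scale)
      qed
      then have "\<forall>b\<in>J. bar_d (c b) u = 0"
        using J(3)[unfolded cells_indep_def, rule_format, of "\<lambda>b. bar_d (c b) u"] by blast
      then show ?thesis using b by blast
    qed
    then show ?thesis by (auto simp: std_cocycle_def c_def)
  qed
  moreover have "y w = (\<Sum>b\<in>J. cup l (c b) (?B b) w) + bar_d H w"
    if w: "valid n w" "\<exists>m\<in>set (take (Suc l) w). msupp m \<notin> D" for w
  proof (cases "\<exists>m\<in>set (take l w). msupp m \<notin> D")
    case True
    then have "\<not> std_word n D (take l w)" by (auto simp: std_word_def)
    then have "(\<Sum>b\<in>J. cup l (c b) (?B b) w) = 0" by (simp add: cup_def c_def)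
    then show ?thesis using van[OF w(1) True] dHvan[OF True] by simp
  next
    case False
    then have l: "l < length w" using w(2) by (metis not_less take_all le_SucI)
    have "msupp (w ! l) \<notin> D" using w(2) False l by (auto simp: take_Suc_conv_app_nth)
    then have p: "nonface_word n D (drop l w)"
      using l w(1) by (auto simp: nonface_word_def hd_drop_conv_nth valid_def dest: in_set_dropD)
    have u: "valid n (take l w)" "length (take l w) = l"
      using l w(1) by (auto simp: valid_def dest: in_set_takeD)
    have "y1 w = (\<Sum>b\<in>J. c b (take l w) * ?B b (drop l w))"
      using y1[OF u p] by simp
    then show ?thesis by (simp add: y1_def cup_def algebra_simps)
  qed
  ultimately show ?thesis by blast
qed

text \<open>Iterates the step. The remainder stays a cocycle modulo \<open>C(R)\<close>, because the
  product of the closed cochain \<open>c l b\<close> with a cell is one.\<close>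

lemma nonface_cocycle_lift:
  fixes y :: "mono list \<Rightarrow> 'k::field"
  assumes down: "\<forall>F\<in>D. \<forall>G. G \<subseteq> F \<longrightarrow> G \<in> D" and vert: "\<forall>i\<in>{1..n}. {i} \<in> D"
    and J: "J \<subseteq> cells n D" "cells_span TYPE('k) n D J" "cells_indep TYPE('k) n D J"
    and coc: "\<And>w. valid n w \<Longrightarrow> \<exists>m\<in>set w. msupp m \<notin> D \<Longrightarrow> bar_d y w = 0"
  shows "\<exists>c H. (\<forall>l b. b \<in> J \<longrightarrow> std_cocycle n D l (c l b)) \<and>
    (\<forall>w. valid n w \<longrightarrow> (\<exists>m\<in>set (take L w). msupp m \<notin> D) \<longrightarrow>
       y w = (\<Sum>l<L. \<Sum>b\<in>J. cup l (c l b) (dual_word (cell_word b)) w) + bar_d H w)"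
proof (induction L)
  case 0
  show ?case by (intro exI[of _ "\<lambda>_ _ _. 0"]) (auto simp: std_cocycle_def intro: bar_d_eq_0)
next
  case (Suc L)
  let ?B = "\<lambda>b. dual_word (cell_word b) :: mono list \<Rightarrow> 'k"
  obtain c H where c: "\<And>l b. b \<in> J \<Longrightarrow> std_cocycle n D l (c l b)" and
    y: "\<And>w. valid n w \<Longrightarrow> \<exists>m\<in>set (take L w). msupp m \<notin> D \<Longrightarrow>
       y w = (\<Sum>l<L. \<Sum>b\<in>J. cup l (c l b) (?B b) w) + bar_d H w"
    using Suc by blast
  define y' where "y' w = y w - (\<Sum>l<L. \<Sum>b\<in>J. cup l (c l b) (?B b) w) - bar_d H w" for w
  have "\<exists>c' H'. (\<forall>b\<in>J. std_cocycle n D L (c' b)) \<and>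
    (\<forall>w. valid n w \<longrightarrow> (\<exists>m\<in>set (take (Suc L) w). msupp m \<notin> D) \<longrightarrow>
       y' w = (\<Sum>b\<in>J. cup L (c' b) (?B b) w) + bar_d H' w)"
  proof (rule nonface_cocycle_lift_step[OF down J])
    fix w assume w: "valid n w" "\<exists>m\<in>set w. msupp m \<notin> D"
    have "bar_d (cup l (c l b) (?B b)) w = 0" if b: "b \<in> J" for l b
    proof -
      have "cup l (c l b) (bar_d (?B b)) w = 0"
      proof (cases "std_word n D (take l w)")
        case True
        have "\<exists>m\<in>set (drop l w). msupp m \<notin> D"
          using w(2) True unfolding std_word_def by (metis Un_iff append_take_drop_id set_append)
        moreover have "valid n (drop l w)" using w(1) by (auto simp: valid_def dest: in_set_dropD)
        ultimately have "bar_d (?B b) (drop l w) = 0"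
          using b J(1) by (intro bar_d_dual_cell_nonface[OF down vert]) auto
        then show ?thesis by (simp add: cup_def)
      next
        case False
        then have "c l b (take l w) = 0" using c[OF b, of l] by (auto simp: std_cocycle_def)
        then show ?thesis by (simp add: cup_def)
      qed
      then show ?thesis using bar_d_cup_std_cocycle[OF down c[OF b] w(1)] by simp
    qed
    then show "bar_d y' w = 0"
      using coc[OF w] unfolding y'_def by (simp add: bar_d_diff bar_d_sum bar_d_bar_d)
  next
    fix w assume "valid n w" "\<exists>m\<in>set (take L w). msupp m \<notin> D"
    then show "y' w = 0" using y by (simp add: y'_def)
  qed
  then obtain c' H' where c': "\<And>b. b \<in> J \<Longrightarrow> std_cocycle n D L (c' b)" and
    y': "\<And>w. valid n w \<Longrightarrow> \<exists>m\<in>set (take (Suc L) w). msupp m \<notin> D \<Longrightarrow>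
       y' w = (\<Sum>b\<in>J. cup L (c' b) (?B b) w) + bar_d H' w" by blast
  have "(\<Sum>l<L. \<Sum>b\<in>J. cup l ((c(L := c')) l b) (?B b) w) = (\<Sum>l<L. \<Sum>b\<in>J. cup l (c l b) (?B b) w)" for w
    by (intro sum.cong) auto
  then have "y w = (\<Sum>l<Suc L. \<Sum>b\<in>J. cup l ((c(L := c')) l b) (?B b) w) + bar_d (\<lambda>w. H w + H' w) w"
    if "valid n w" "\<exists>m\<in>set (take (Suc L) w). msupp m \<notin> D" for w
    using y'[OF that] by (simp add: y'_def bar_d_add algebra_simps)
  moreover have "std_cocycle n D l ((c(L := c')) l b)" if "b \<in> J" for l b
    using c c' that by auto
  ultimately show ?case by blast
qed

section \<open>Decomposing cocycles\<close>

abbreviation wdeg :: "mono list \<Rightarrow> nat" where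
  "wdeg w \<equiv> sum_list (map mdeg w)"

lemma mdeg_eq_sum: "msupp m \<subseteq> {1..n} \<Longrightarrow> mdeg m = (\<Sum>i\<in>{1..n}. m i)"
  unfolding mdeg_def by (rule sum.mono_neutral_left) (auto simp: msupp_def)

lemma mdeg_madd:
  assumes "msupp a \<subseteq> {1..n}" "msupp b \<subseteq> {1..n}"
  shows "mdeg (madd a b) = mdeg a + mdeg b"
proof -
  have "mdeg (madd a b) = (\<Sum>i\<in>{1..n}. madd a b i)" by (rule mdeg_eq_sum) (use assms in simp)
  then show ?thesis using assms by (simp add: mdeg_eq_sum madd_def sum.distrib)
qed

lemma mdeg_chi: "mdeg (chi g) = card g"
  by (simp add: mdeg_def) (simp add: chi_def)

lemma wdeg_merges: "w' \<in> merges w \<Longrightarrow> valid n w \<Longrightarrow> wdeg w' = wdeg w"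
  by (induction w arbitrary: w' rule: merges.induct) (auto simp: mdeg_madd)

lemma std_word_append [simp]: "std_word n D (u @ w) \<longleftrightarrow> std_word n D u \<and> std_word n D w"
  by (auto simp: std_word_def)

lemma std_word_take_drop: "std_word n D (take l w) \<and> std_word n D (drop l w) \<longleftrightarrow> std_word n D w"
  by (metis append_take_drop_id std_word_append)

lemma std_word_iff:
  "simplicial_complex n D \<Longrightarrow> std_word n D w \<longleftrightarrow> (\<forall>m\<in>set w. std_pos D m)"
  by (auto simp: std_word_def valid_def std_pos_def simplicial_complex_def)

lemma admissible_iff:
  "simplicial_complex n D \<Longrightarrow>
    admissible D i d w \<longleftrightarrow> length w = i \<and> std_word n D w \<and> wdeg w = d"
  by (simp add: admissible_def std_word_iff)

text \<open>A merged letter that is not a face gives a word outside the support of \<open>g\<close>,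
  so the face test in \<open>cobd\<close> is automatic.\<close>

lemma cobd_eq_bar_d:
  fixes g :: "mono list \<Rightarrow> 'k::field"
  assumes sc: "simplicial_complex n D" and supp: "\<And>w. g w \<noteq> 0 \<Longrightarrow> std_word n D w"
  shows "cobd D g w = (if std_word n D w then bar_d g w else 0)"
proof -
  have "(if msupp (madd (w ! j) (w ! Suc j)) \<in> D then (-1) ^ j * g (merge_at j w) else 0) =
      (-1) ^ j * g (merge_at j w)" for j
  proof (cases "msupp (madd (w ! j) (w ! Suc j)) \<in> D")
    case False
    have "madd (w ! j) (w ! Suc j) \<in> set (merge_at j w)" by (simp add: merge_at_def)
    then have "g (merge_at j w) = 0" using False supp by (metis std_word_def)
    then show ?thesis by simp
  qed simp
  then show ?thesis by (simp add: cobd_def std_word_iff[OF sc] bar_d_eq_sum cong: if_cong)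
qed

lemma cobd_not_std: "simplicial_complex n D \<Longrightarrow> \<not> std_word n D w \<Longrightarrow> cobd D g w = 0"
  unfolding cobd_def std_word_iff by (rule if_not_P)

lemma cobd_zero: "cobd D (\<lambda>_. 0) w = 0"
  by (auto simp: cobd_def intro!: sum.neutral)

lemma cobd_linear:
  "cobd D (\<lambda>w. f w + g w) w = cobd D f w + cobd D g w"
  "cobd D (\<lambda>w. c * f w) w = c * cobd D f w"
  by (auto simp: cobd_def sum.distrib[symmetric] sum_distrib_left distrib_left mult.left_commute
      intro!: sum.cong)

lemma cocycle_iff:
  assumes sc: "simplicial_complex n D"
  shows "cocycle D i d f \<longleftrightarrow> std_cocycle n D i f \<and> (\<forall>w. f w \<noteq> 0 \<longrightarrow> wdeg w = d)"
proof
  assume f: "cocycle D i d f"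
  then have supp: "length w = i \<and> std_word n D w \<and> wdeg w = d" if "f w \<noteq> 0" for w
    using that by (simp add: cocycle_def cochain_def admissible_iff[OF sc])
  have "bar_d f w = 0" if "std_word n D w" for w
    using f cobd_eq_bar_d[OF sc, of f w] supp that by (simp add: cocycle_def)
  then show "std_cocycle n D i f \<and> (\<forall>w. f w \<noteq> 0 \<longrightarrow> wdeg w = d)"
    using supp by (simp add: std_cocycle_def)
next
  assume f: "std_cocycle n D i f \<and> (\<forall>w. f w \<noteq> 0 \<longrightarrow> wdeg w = d)"
  then have "cobd D f w = 0" for w
    by (subst cobd_eq_bar_d[OF sc]) (auto simp: std_cocycle_def)
  then show "cocycle D i d f"
    using f by (auto simp: cocycle_def cochain_def admissible_iff[OF sc] std_cocycle_def)
qed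

lemma cocycle_cup:
  fixes f g :: "mono list \<Rightarrow> 'k::field"
  assumes sc: "simplicial_complex n D" and f: "cocycle D i d f" and g: "cocycle D j e g"
  shows "cocycle D (i + j) (d + e) (cup i f g)"
proof -
  have down: "\<forall>F\<in>D. \<forall>G. G \<subseteq> F \<longrightarrow> G \<in> D" using sc by (simp add: simplicial_complex_def)
  note f' = f[unfolded cocycle_iff[OF sc]] and g' = g[unfolded cocycle_iff[OF sc]]
  have fs: "length w = i \<and> std_word n D w \<and> wdeg w = d" if "f w \<noteq> 0" for w
    using f' that by (simp add: std_cocycle_def)
  have gs: "length w = j \<and> std_word n D w \<and> wdeg w = e" if "g w \<noteq> 0" for w
    using g' that by (simp add: std_cocycle_def)
  have "length w = i + j \<and> std_word n D w \<and> wdeg w = d + e" if "cup i f g w \<noteq> 0" for w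
  proof -
    have nz: "f (take i w) \<noteq> 0" "g (drop i w) \<noteq> 0" using that by (auto simp: cup_def)
    have "length w = length (take i w) + length (drop i w)" by simp
    also have "\<dots> = i + j" using fs[OF nz(1)] gs[OF nz(2)] by linarith
    finally have "length w = i + j" .
    moreover have "wdeg w = wdeg (take i w) + wdeg (drop i w)"
      by (metis append_take_drop_id map_append sum_list_append)
    moreover have "std_word n D w" using fs[OF nz(1)] gs[OF nz(2)] std_word_take_drop by blast
    ultimately show ?thesis using fs[OF nz(1)] gs[OF nz(2)] by linarith
  qed
  moreover have "bar_d (cup i f g) w = 0" if w: "std_word n D w" for w
  proof -
    have "bar_d g (drop i w) = 0"
      using g' w std_word_take_drop[of n D i w] by (simp add: std_cocycle_def)
    then show ?thesis
      using bar_d_cup_std_cocycle[OF down conjunct1[OF f'], of w g] w by (simp add: std_word_def cup_def)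
  qed
  ultimately show ?thesis by (auto simp: cocycle_iff[OF sc] std_cocycle_def)
qed

lemma gen12_cocycle:
  assumes sc: "simplicial_complex n D" and "(i, d, f) \<in> gen12 D"
  shows "cocycle D i d f \<and> i \<ge> 1"
  using assms(2)
proof (induction i d f rule: gen12.induct)
  case (gmul i d f j e g)
  then show ?case using cocycle_cup[OF sc] by auto
qed auto

definition decomposable :: "nat set set \<Rightarrow> nat \<Rightarrow> nat \<Rightarrow> (mono list \<Rightarrow> 'k::field) \<Rightarrow> bool" where
  "decomposable D i d f \<longleftrightarrow> (\<exists>fs g. (\<forall>(c, f')\<in>set fs. (i, d, f') \<in> gen12 D) \<and> cochain D (i - 1) d g \<and>
     (\<forall>ms. f ms = (\<Sum>(c, f')\<leftarrow>fs. c * f' ms) + cobd D g ms))"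

lemma decomposable_gen: "(i, d, f) \<in> gen12 D \<Longrightarrow> decomposable D i d f"
  unfolding decomposable_def
  by (intro exI[of _ "[(1, f)]"] exI[of _ "\<lambda>_. 0"]) (auto simp: cochain_def cobd_zero)

lemma decomposable_cobd: "cochain D (i - 1) d g \<Longrightarrow> decomposable D i d (cobd D g)"
  unfolding decomposable_def by (intro exI[of _ "[]"] exI[of _ g]) auto

lemma decomposable_zero: "decomposable D i d (\<lambda>_. 0)"
  unfolding decomposable_def
  by (intro exI[of _ "[]"] exI[of _ "\<lambda>_. 0"]) (auto simp: cochain_def cobd_zero)

lemma decomposable_add:
  assumes "decomposable D i d f" "decomposable D i d f'"
  shows "decomposable D i d (\<lambda>w. f w + f' w)"
proof -
  obtain fs g fs' g' where
    "\<forall>(c, f')\<in>set fs. (i, d, f') \<in> gen12 D" "cochain D (i - 1) d g"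
    "\<forall>ms. f ms = (\<Sum>(c, f')\<leftarrow>fs. c * f' ms) + cobd D g ms"
    "\<forall>(c, f')\<in>set fs'. (i, d, f') \<in> gen12 D" "cochain D (i - 1) d g'"
    "\<forall>ms. f' ms = (\<Sum>(c, f')\<leftarrow>fs'. c * f' ms) + cobd D g' ms"
    using assms unfolding decomposable_def by blast
  moreover from this have "cochain D (i - 1) d (\<lambda>w. g w + g' w)"
    unfolding cochain_def by (metis add_0)
  ultimately show ?thesis
    unfolding decomposable_def
    by (intro exI[of _ "fs @ fs'"] exI[of _ "\<lambda>w. g w + g' w"]) (auto simp: cobd_linear)
qed

lemma decomposable_scale:
  assumes "decomposable D i d f"
  shows "decomposable D i d (\<lambda>w. a * f w)"
proof -
  obtain fs g where fs:
    "\<forall>(c, f')\<in>set fs. (i, d, f') \<in> gen12 D" "cochain D (i - 1) d g"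
    "\<forall>ms. f ms = (\<Sum>(c, f')\<leftarrow>fs. c * f' ms) + cobd D g ms"
    using assms unfolding decomposable_def by blast
  have "a * (\<Sum>(c, f')\<leftarrow>fs. c * f' ms) = (\<Sum>(c, f')\<leftarrow>map (\<lambda>(c, f'). (a * c, f')) fs. c * f' ms)" for ms
    by (induction fs) (auto simp: algebra_simps)
  then show ?thesis
    unfolding decomposable_def using fs
    by (intro exI[of _ "map (\<lambda>(c, f'). (a * c, f')) fs"] exI[of _ "\<lambda>w. a * g w"])
       (auto simp: cochain_def cobd_linear distrib_left)
qed

lemma decomposable_sum:
  "(\<And>x. x \<in> A \<Longrightarrow> decomposable D i d (f x)) \<Longrightarrow> decomposable D i d (\<lambda>w. \<Sum>x\<in>A. f x w)"
  by (induction A rule: infinite_finite_induct) (auto intro: decomposable_zero decomposable_add)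

text \<open>As \<open>h\<close> is closed, the product of \<open>cobd D g\<close> with
  \<open>h\<close> is the coboundary of the product of \<open>g\<close> with
  \<open>h\<close>.\<close>

lemma decomposable_cup:
  fixes f h :: "mono list \<Rightarrow> 'k::field"
  assumes sc: "simplicial_complex n D" and f: "decomposable D i d f" "i \<ge> 1"
    and h: "(j, e, h) \<in> gen12 D"
  shows "decomposable D (i + j) (d + e) (cup i f h)"
proof -
  obtain fs g where fs:
    "\<forall>(c, f')\<in>set fs. (i, d, f') \<in> gen12 D" "cochain D (i - 1) d g"
    "\<And>ms. f ms = (\<Sum>(c, f')\<leftarrow>fs. c * f' ms) + cobd D g ms"
    using f(1) unfolding decomposable_def by blast
  have hc: "std_cocycle n D j h" "\<And>w. h w \<noteq> 0 \<Longrightarrow> wdeg w = e" "j \<ge> 1"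
    using gen12_cocycle[OF sc h] by (auto simp: cocycle_iff[OF sc])
  have hs: "length w = j \<and> std_word n D w \<and> wdeg w = e" if "h w \<noteq> 0" for w
    using hc that by (simp add: std_cocycle_def)
  have gs: "length w = i - 1 \<and> std_word n D w \<and> wdeg w = d" if "g w \<noteq> 0" for w
    using fs(2) that by (simp add: cochain_def admissible_iff[OF sc])
  have "cup i (cobd D g) h w = cobd D (cup (i - 1) g h) w" for w
  proof (cases "std_word n D w")
    case False
    then have "\<not> std_word n D (take i w) \<or> \<not> std_word n D (drop i w)"
      using std_word_take_drop by blast
    moreover have "cobd D g u = 0" if "\<not> std_word n D u" for u
      using that by (rule cobd_not_std[OF sc])
    moreover have "h u = 0" if "\<not> std_word n D u" for u
      using that hc(1) by (auto simp: std_cocycle_def)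
    moreover have "cobd D (cup (i - 1) g h) w = 0" using False by (rule cobd_not_std[OF sc])
    ultimately show ?thesis by (auto simp: cup_def)
  next
    case True
    have supp: "std_word n D u" if "cup (i - 1) g h u \<noteq> 0" for u
    proof -
      have "g (take (i - 1) u) \<noteq> 0" "h (drop (i - 1) u) \<noteq> 0" using that by (auto simp: cup_def)
      then have "std_word n D (take (i - 1) u)" "std_word n D (drop (i - 1) u)"
        using gs hc(1) by (auto simp: std_cocycle_def)
      then show ?thesis using std_word_take_drop by blast
    qed
    have eq: "cobd D (cup (i - 1) g h) w = bar_d (cup (i - 1) g h) w"
      using cobd_eq_bar_d[OF sc, of "cup (i - 1) g h" w] supp True by simp
    show ?thesis
    proof (cases "i - 1 < length w")
      case len: True
      have tr: "std_word n D (take i w)" "std_word n D (drop (i - 1) w)"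
        using std_word_take_drop[of n D i w] std_word_take_drop[of n D "i - 1" w] True by auto
      have "bar_d h (drop (i - 1) w) = 0" using hc(1) tr by (simp add: std_cocycle_def)
      then have "bar_d (cup (i - 1) g h) w = bar_d g (take i w) * h (drop i w)"
        using bar_d_cup[OF len, of g h] f(2) by simp
      also have "bar_d g (take i w) = cobd D g (take i w)"
        using cobd_eq_bar_d[OF sc, of g "take i w"] gs tr by simp
      finally show ?thesis unfolding eq cup_def[of i "cobd D g"] by (rule sym)
    next
      case len: False
      have "bar_d (cup (i - 1) g h) w = 0"
      proof (rule bar_d_eq_0)
        fix w' assume "w' \<in> merges w"
        then have "length (take (i - 1) w') \<noteq> i - 1" using length_merges[of w' w] len by simp
        then have "g (take (i - 1) w') = 0" using gs by blast
        then show "cup (i - 1) g h w' = 0" by (simp add: cup_def)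
      qed
      moreover have "h (drop i w) = 0"
        using hc len by (auto simp: std_cocycle_def)
      ultimately show ?thesis using eq by (simp add: cup_def)
    qed
  qed
  moreover have "(\<Sum>(c, f')\<leftarrow>fs. c * f' u) * h v =
      (\<Sum>(c, f')\<leftarrow>map (\<lambda>(c, f'). (c, cup i f' h)) fs. c * f' w)" if "u = take i w" "v = drop i w" for u v w
    using that by (induction fs) (auto simp: cup_def algebra_simps)
  ultimately have "cup i f h w = (\<Sum>(c, f')\<leftarrow>map (\<lambda>(c, f'). (c, cup i f' h)) fs. c * f' w)
      + cobd D (cup (i - 1) g h) w" for w
    unfolding cup_def[of i f] fs(3) by (simp add: cup_def[of i "cobd D g"] distrib_right)
  moreover have "cochain D (i + j - 1) (d + e) (cup (i - 1) g h)"
    unfolding cochain_def admissible_iff[OF sc]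
  proof (intro allI impI)
    fix w assume "cup (i - 1) g h w \<noteq> 0"
    then have nz: "g (take (i - 1) w) \<noteq> 0" "h (drop (i - 1) w) \<noteq> 0" by (auto simp: cup_def)
    have "length w = length (take (i - 1) w) + length (drop (i - 1) w)" by simp
    also have "\<dots> = i - 1 + j" using gs[OF nz(1)] hs[OF nz(2)] by linarith
    finally have "length w = i + j - 1" using f(2) by simp
    moreover have "wdeg w = wdeg (take (i - 1) w) + wdeg (drop (i - 1) w)"
      by (metis append_take_drop_id map_append sum_list_append)
    moreover have "std_word n D w"
      using gs[OF nz(1)] hs[OF nz(2)] std_word_take_drop by blast
    ultimately show "length w = i + j - 1 \<and> std_word n D w \<and> wdeg w = d + e"
      using gs[OF nz(1)] hs[OF nz(2)] by linarith
  qed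
  moreover have "\<forall>(c, f')\<in>set (map (\<lambda>(c, f'). (c, cup i f' h)) fs). (i + j, d + e, f') \<in> gen12 D"
    using fs(1) h by (auto intro: gmul)
  ultimately show ?thesis unfolding decomposable_def by blast
qed

section \<open>Generators from variables and minimal nonfaces\<close>

lemma std_word_vars:
  assumes "\<forall>i\<in>{1..n}. {i} \<in> D" "set vs \<subseteq> {1..n}"
  shows "std_word n D (map var vs)"
  using assms by (auto simp: std_word_def valid_def)

lemma wdeg_vars: "wdeg (map var vs) = length vs"
  by (induction vs) (auto simp: mdeg_chi)

lemma bar_d_dual_vars: "valid n w \<Longrightarrow> bar_d (dual_word (map var vs)) w = (0::'k::field)"
  by (rule bar_d_eq_0) (use merges_neq_vars in \<open>auto simp: dual_word_def\<close>)

lemma dual_word_Cons: "dual_word (m # u) = (cup 1 (dual_word [m]) (dual_word u) :: mono list \<Rightarrow> 'k::field)"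
proof
  fix w :: "mono list"
  show "dual_word (m # u) w = (cup 1 (dual_word [m]) (dual_word u) w :: 'k)"
    by (cases w) (auto simp: dual_word_def cup_def)
qed

lemma gen12_vars:
  assumes sc: "simplicial_complex n D" and vert: "\<forall>i\<in>{1..n}. {i} \<in> D"
    and "vs \<noteq> []" "set vs \<subseteq> {1..n}"
  shows "(length vs, length vs, dual_word (map var vs) :: mono list \<Rightarrow> 'k::field) \<in> gen12 D"
  using assms(3,4)
proof (induction vs)
  case (Cons v vs)
  have "cocycle D 1 1 (dual_word (map var [v]) :: mono list \<Rightarrow> 'k)"
    unfolding cocycle_iff[OF sc] std_cocycle_def
    using Cons.prems std_word_vars[OF vert, of "[v]"] bar_d_dual_vars[of n _ "[v]"]
    by (auto simp: dual_word_def std_word_def mdeg_chi)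
  then have v: "(1, 1, dual_word [var v] :: mono list \<Rightarrow> 'k) \<in> gen12 D" using g1 by simp
  show ?case
  proof (cases "vs = []")
    case True
    then show ?thesis using v by simp
  next
    case False
    then have "(1 + length vs, 1 + length vs, cup 1 (dual_word [var v]) (dual_word (map var vs)) :: mono list \<Rightarrow> 'k) \<in> gen12 D"
      using Cons v by (intro gmul) auto
    then show ?thesis using dual_word_Cons[of "var v" "map var vs", where 'k = 'k] by simp
  qed
qed simp

text \<open>The connecting map applied to a cell: its coboundary in \<open>C(S)\<close>, which on
  valid words vanishes outside \<open>C(R)\<close>.\<close>

definition cell_class :: "nat \<Rightarrow> nat set set \<Rightarrow> nat set \<times> nat set \<Rightarrow> mono list \<Rightarrow> 'k::field" where
  "cell_class n D b w = (if std_word n D w then bar_d (dual_word (cell_word b)) w else 0)"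

text \<open>Words of variables are closed, so by the Leibniz rule the coboundary of a cell is the
  degree two class of \<open>g\<close> times classes of variables. A cell word has
  \<open>1 + card \<tau>\<close> letters, and the coboundary adds one.\<close>

lemma gen12_cell_class:
  assumes sc: "simplicial_complex n D" and vert: "\<forall>i\<in>{1..n}. {i} \<in> D" and b: "b \<in> cells n D"
  shows "(2 + card (snd b), card (fst b) + card (snd b), cell_class n D b :: mono list \<Rightarrow> 'k::field) \<in> gen12 D"
proof -
  have down: "\<forall>F\<in>D. \<forall>G. G \<subseteq> F \<longrightarrow> G \<in> D" using sc by (simp add: simplicial_complex_def)
  obtain g \<tau> where gt: "b = (g, \<tau>)" by (cases b)
  have g: "g \<subseteq> {1..n}" "min_nonface D g" "\<tau> \<subseteq> {1..n}" using b gt by (auto simp: cells_def)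
  have fin: "finite \<tau>" by (rule finite_subset[OF g(3)]) simp
  have g0: "(g, {}) \<in> cells n D" using g by (simp add: cells_def)
  let ?\<gamma> = "cell_class n D (g, {}) :: mono list \<Rightarrow> 'k"
  have w0: "cell_word (g, {}) = [chi g]" by (simp add: cell_word_def)
  have \<gamma>: "?\<gamma> w = bar_d (dual_word [chi g]) w" if "valid n w" for w
    using that bar_d_dual_cell_nonface[OF down vert g0, of w, where 'k = 'k]
    by (auto simp: cell_class_def w0 std_word_def)
  have "cocycle D 2 (card g) ?\<gamma>"
    unfolding cocycle_iff[OF sc] std_cocycle_def
  proof (intro conjI allI impI)
    fix w assume nz: "?\<gamma> w \<noteq> 0"
    then show s: "std_word n D w" by (auto simp: cell_class_def split: if_splits)
    have "\<exists>w'\<in>merges w. w' = [chi g]"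
    proof (rule ccontr)
      assume "\<not> ?thesis"
      then have "bar_d (dual_word [chi g]) w = (0::'k)" by (intro bar_d_eq_0) (auto simp: dual_word_def)
      then show False using nz by (simp add: cell_class_def w0 split: if_splits)
    qed
    then have m: "[chi g] \<in> merges w" by blast
    show "length w = 2" using length_merges[OF m] by simp
    show "wdeg w = card g" using wdeg_merges[OF m, of n] s by (simp add: std_word_def mdeg_chi)
  next
    fix w assume "std_word n D w"
    then have v: "valid n w" by (simp add: std_word_def)
    have "bar_d ?\<gamma> w = bar_d (bar_d (dual_word [chi g])) w"
      by (rule bar_d_cong) (use \<gamma> valid_merges v in blast)
    then show "bar_d ?\<gamma> w = 0" by (simp add: bar_d_bar_d)
  qed
  then have \<gamma>gen: "(2, card g, ?\<gamma>) \<in> gen12 D" by (rule g2)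
  show ?thesis
  proof (cases "\<tau> = {}")
    case True
    then show ?thesis using \<gamma>gen gt by simp
  next
    case False
    define vs where "vs = sorted_list_of_set \<tau>"
    have vs: "vs \<noteq> []" "set vs \<subseteq> {1..n}" "length vs = card \<tau>"
      using fin False g by (auto simp: vs_def)
    have cw: "cell_word b = chi g # map var vs" by (simp add: gt cell_word_def vs_def)
    have "cell_class n D b w = (cup 2 ?\<gamma> (dual_word (map var vs)) w :: 'k)" for w
    proof (cases "std_word n D w")
      case False
      then have "\<not> std_word n D (take 2 w) \<or> \<not> std_word n D (drop 2 w)"
        using std_word_take_drop by blast
      then show ?thesis
        using False std_word_vars[OF vert vs(2)] by (auto simp: cell_class_def cup_def dual_word_def)
    next
      case True
      have v: "valid n (take 2 w)" "valid n (drop 1 w)" "std_word n D (take 2 w)"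
        using True by (auto simp: std_word_def valid_def dest: in_set_takeD in_set_dropD)
      show ?thesis
      proof (cases "1 < length w")
        case len: True
        have "cell_class n D b w = bar_d (cup 1 (dual_word [chi g]) (dual_word (map var vs))) w"
          using True unfolding cell_class_def cw dual_word_Cons[of "chi g" "map var vs"] by simp
        also have "\<dots> = bar_d (dual_word [chi g]) (take (Suc 1) w) * dual_word (map var vs) (drop (Suc 1) w)
            + (-1) ^ 1 * (dual_word [chi g] (take 1 w) * bar_d (dual_word (map var vs)) (drop 1 w))"
          by (rule bar_d_cup[OF len])
        also have "bar_d (dual_word (map var vs)) (drop 1 w) = (0::'k)" by (rule bar_d_dual_vars[OF v(2)])
        also have "bar_d (dual_word [chi g]) (take (Suc 1) w) * dual_word (map var vs) (drop (Suc 1) w)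
            + (-1) ^ 1 * (dual_word [chi g] (take 1 w) * 0) =
            bar_d (dual_word [chi g]) (take 2 w) * (dual_word (map var vs) (drop 2 w) :: 'k)"
          by (simp only: Suc_1 mult_zero_right add_0_right)
        finally show ?thesis unfolding cup_def \<gamma>[OF v(1)] .
      next
        case False
        then consider "w = []" | a where "w = [a]" by (cases w) auto
        then show ?thesis
          by cases (auto simp: cell_class_def cup_def)
      qed
    qed
    then have "cell_class n D b = (cup 2 ?\<gamma> (dual_word (map var vs)) :: mono list \<Rightarrow> 'k)" by blast
    moreover have "(2 + length vs, card g + length vs, cup 2 ?\<gamma> (dual_word (map var vs))) \<in> gen12 D"
      by (rule gmul[OF \<gamma>gen gen12_vars[OF sc vert vs(1,2)]])
    ultimately show ?thesis using vs gt by simp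
  qed
qed

lemma cocycle_decomposable:
  fixes z :: "mono list \<Rightarrow> 'k::field"
  assumes sc: "simplicial_complex n D" and vert: "\<forall>i\<in>{1..n}. {i} \<in> D"
    and det: "detects TYPE('k) n D"
    and "i \<ge> 1" "cocycle D i d z"
  shows "decomposable D i d z"
  using assms(4,5)
proof (induction i arbitrary: d z rule: less_induct)
  case (less i)
  have down: "\<forall>F\<in>D. \<forall>G. G \<subseteq> F \<longrightarrow> G \<in> D" and emp: "{} \<in> D"
    using sc by (simp_all add: simplicial_complex_def)
  have z: "std_cocycle n D i z" "\<And>w. z w \<noteq> 0 \<Longrightarrow> wdeg w = d"
    using less.prems by (simp_all add: cocycle_iff[OF sc])
  \<comment> \<open>Over \<open>{{}}\<close> every nonempty valid word is a nonface word, so the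
    result on \<open>I\<close> decomposes cocycles of \<open>C(S)\<close>.\<close>
  let ?C = "cells n {{}}"
  let ?B = "\<lambda>b. dual_word (cell_word b) :: mono list \<Rightarrow> 'k"
  have "\<exists>\<chi> y. \<forall>w. nonface_word n {{}} w \<longrightarrow> z w = (\<Sum>b\<in>?C. \<chi> b * ?B b w) + bar_d y w"
  proof (rule nonface_cocycle_cells)
    fix w assume "nonface_word n {{}} w"
    then show "bar_d z w = 0" using bar_d_std_cocycle[OF down z(1)] by (simp add: nonface_word_def)
  qed (auto simp: detects_irrelevant)
  then obtain \<chi> y where "\<forall>w. nonface_word n {{}} w \<longrightarrow> z w = (\<Sum>b\<in>?C. \<chi> b * ?B b w) + bar_d y w"
    by blast
  then have zy: "z w = (\<Sum>b\<in>?C. \<chi> b * ?B b w) + bar_d y w" if "valid n w" "w \<noteq> []" for w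
    using that hd_in_set[of w] by (auto simp: nonface_word_def valid_def)
  have cellC: "\<exists>vs. cell_word b = map var vs \<and> vs \<noteq> [] \<and> set vs \<subseteq> {1..n}" if b: "b \<in> ?C" for b
  proof -
    obtain g \<tau> where gt: "b = (g, \<tau>)" "g \<subseteq> {1..n}" "min_nonface {{}} g" "\<tau> \<subseteq> {1..n}"
      using b by (cases b) (auto simp: cells_def)
    obtain v where v: "v \<in> g" using gt(3) by (auto simp: min_nonface_def)
    then have "g = {v}" using gt(3) by (auto simp: min_nonface_def)
    moreover have "finite \<tau>" by (rule finite_subset[OF gt(4)]) simp
    ultimately show ?thesis using gt
      by (intro exI[of _ "v # sorted_list_of_set \<tau>"]) (auto simp: cell_word_def)
  qed
  have "cells_span TYPE('k) n D (cells n D)"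
    unfolding cells_span_def using nonface_cocycle_cells[OF down emp det] by blast
  then obtain J where J: "J \<subseteq> cells n D" "cells_span TYPE('k) n D J" "cells_indep TYPE('k) n D J"
    using cell_basis by blast
  \<comment> \<open>On a word with a nonface letter both \<open>z\<close> and the cochains dual to
    words of variables vanish, so \<open>y\<close> is a cocycle modulo \<open>C(R)\<close>.\<close>
  have ycoc: "bar_d y w = 0" if w: "valid n w" "\<exists>m\<in>set w. msupp m \<notin> D" for w
  proof -
    have ns: "\<not> std_word n D w" using w by (auto simp: std_word_def)
    then have "z w = 0" using z by (auto simp: std_cocycle_def)
    moreover have "?B b w = 0" if "b \<in> ?C" for b
      using cellC[OF that] std_word_vars[OF vert] ns by (auto simp: dual_word_def)
    ultimately show ?thesis using zy[OF w(1)] w by (cases "w = []") auto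
  qed
  \<comment> \<open>At words of length \<open>i\<close>, \<open>bar_d y\<close> sees only words of
    length \<open>i - 1\<close>; this is the prefix length required.\<close>
  obtain c H where c: "\<And>l b. b \<in> J \<Longrightarrow> std_cocycle n D l (c l b)" and
    y: "\<And>w. valid n w \<Longrightarrow> \<exists>m\<in>set (take (i - 1) w). msupp m \<notin> D \<Longrightarrow>
       y w = (\<Sum>l<i - 1. \<Sum>b\<in>J. cup l (c l b) (?B b) w) + bar_d H w"
    using nonface_cocycle_lift[OF down vert J ycoc, of "i - 1"] by blast
  define r where "r w = (if admissible D (i - 1) d w
      then y w - (\<Sum>l<i - 1. \<Sum>b\<in>J. cup l (c l b) (?B b) w) - bar_d H w else 0)" for w
  have r: "cochain D (i - 1) d r" by (auto simp: cochain_def r_def)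
  have rs: "length w = i - 1 \<and> std_word n D w \<and> wdeg w = d" if "r w \<noteq> 0" for w
    using r that by (simp add: cochain_def admissible_iff[OF sc])
  \<comment> \<open>The coefficients \<open>\<chi>\<close> and \<open>c\<close> may mix degrees;
    \<open>T1\<close> and \<open>T2\<close> cut out the bidegree of \<open>z\<close>.\<close>
  define T1 where "T1 b w = (if admissible D i d w then \<chi> b * ?B b w else 0)" for b w
  define T2 where "T2 l b w = (if admissible D i d w
      then (-1) ^ l * cup l (c l b) (cell_class n D b) w else 0)" for l b w
  have zeq: "z w = (\<Sum>b\<in>?C. T1 b w) + (\<Sum>l<i - 1. \<Sum>b\<in>J. T2 l b w) + cobd D r w" for w
  proof (cases "admissible D i d w")
    case True
    then have w: "length w = i" "std_word n D w" "wdeg w = d" "valid n w" "w \<noteq> []"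
      using less.prems by (auto simp: admissible_iff[OF sc] std_word_def)
    have "bar_d y w = bar_d (\<lambda>w. (\<Sum>l<i - 1. \<Sum>b\<in>J. cup l (c l b) (?B b) w) + bar_d H w + r w) w"
    proof (rule bar_d_cong)
      fix w' assume w': "w' \<in> merges w"
      have v: "valid n w'" "length w' = i - 1" "wdeg w' = d"
        using valid_merges[OF w' w(4)] length_merges[OF w'] wdeg_merges[OF w' w(4)] w by auto
      show "y w' = (\<Sum>l<i - 1. \<Sum>b\<in>J. cup l (c l b) (?B b) w') + bar_d H w' + r w'"
      proof (cases "std_word n D w'")
        case True
        then show ?thesis using v by (simp add: r_def admissible_iff[OF sc])
      next
        case False
        then have "r w' = 0" using rs by blast
        moreover have "\<exists>m\<in>set (take (i - 1) w'). msupp m \<notin> D"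
          using False v by (auto simp: std_word_def)
        ultimately show ?thesis using y[OF v(1)] by simp
      qed
    qed
    also have "\<dots> = (\<Sum>l<i - 1. \<Sum>b\<in>J. bar_d (cup l (c l b) (?B b)) w) + bar_d r w"
      by (simp add: bar_d_add bar_d_sum bar_d_bar_d)
    also have "(\<Sum>l<i - 1. \<Sum>b\<in>J. bar_d (cup l (c l b) (?B b)) w) = (\<Sum>l<i - 1. \<Sum>b\<in>J. T2 l b w)"
    proof (intro sum.cong refl)
      fix l b assume b: "b \<in> J"
      have "std_word n D (drop l w)" using w std_word_take_drop by blast
      then show "bar_d (cup l (c l b) (?B b)) w = T2 l b w"
        using bar_d_cup_std_cocycle[OF down c[OF b] w(4)] True by (simp add: T2_def cup_def cell_class_def)
    qed
    also have "bar_d r w = cobd D r w"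
      using cobd_eq_bar_d[OF sc, of r w] rs w by simp
    finally show ?thesis using zy[OF w(4,5)] True by (simp add: T1_def)
  next
    case False
    have "z w = 0"
      using False z by (auto simp: admissible_iff[OF sc] std_cocycle_def)
    moreover have "cobd D r w = 0"
    proof (cases "std_word n D w")
      case std: True
      then have v: "valid n w" by (simp add: std_word_def)
      have "bar_d r w = 0"
      proof (rule bar_d_eq_0, rule ccontr)
        fix w' assume w': "w' \<in> merges w" "r w' \<noteq> 0"
        then have "length w = i \<and> wdeg w = d"
          using rs[OF w'(2)] length_merges[OF w'(1)] wdeg_merges[OF w'(1) v] less.prems by simp
        then show False using False std by (simp add: admissible_iff[OF sc])
      qed
      then show ?thesis using cobd_eq_bar_d[OF sc, of r w] rs by simp
    next
      case False
      then show ?thesis by (rule cobd_not_std[OF sc])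
    qed
    ultimately show ?thesis using False by (simp add: T1_def T2_def)
  qed
  have dT1: "decomposable D i d (T1 b)" if b: "b \<in> ?C" for b
  proof -
    obtain vs where vs: "cell_word b = map var vs" "vs \<noteq> []" "set vs \<subseteq> {1..n}"
      using cellC[OF b] by blast
    show ?thesis
    proof (cases "admissible D i d (cell_word b)")
      case True
      then have "i = length vs" "d = length vs"
        using vs wdeg_vars by (auto simp: admissible_iff[OF sc])
      then have "(i, d, ?B b) \<in> gen12 D" using gen12_vars[OF sc vert vs(2,3)] vs(1) by simp
      then have "decomposable D i d (\<lambda>w. \<chi> b * ?B b w)" by (intro decomposable_scale decomposable_gen)
      moreover have "T1 b = (\<lambda>w. \<chi> b * ?B b w)" using True by (auto simp: T1_def dual_word_def)
      ultimately show ?thesis by simp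
    next
      case False
      then have "T1 b = (\<lambda>_. 0)" by (auto simp: T1_def dual_word_def)
      then show ?thesis by (simp add: decomposable_zero)
    qed
  qed
  have dT2: "decomposable D i d (T2 l b)" if b: "b \<in> J" for l b
  proof -
    define j where "j = 2 + card (snd b)"
    define e where "e = card (fst b) + card (snd b)"
    let ?E = "cell_class n D b :: mono list \<Rightarrow> 'k"
    have E: "(j, e, ?E) \<in> gen12 D"
      unfolding j_def e_def by (rule gen12_cell_class[OF sc vert]) (use b J in auto)
    have Ec: "length w = j \<and> wdeg w = e" if "?E w \<noteq> 0" for w
      using gen12_cocycle[OF sc E] that by (auto simp: cocycle_iff[OF sc] std_cocycle_def)
    \<comment> \<open>The component of \<open>c l b\<close> whose internal degree complements
      \<open>e\<close>; merging preserves degrees, so it is again a cocycle.\<close>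
    define c' where "c' w = (if wdeg w = d - e then c l b w else 0)" for w
    have nz: "l + j = i \<and> e \<le> d \<and> wdeg (take l w) = d - e"
      if "admissible D i d w" "c l b (take l w) \<noteq> 0" "?E (drop l w) \<noteq> 0" for w
    proof -
      have "length (take l w) = l" using c[OF b, of l] that by (auto simp: std_cocycle_def)
      moreover have "length w = length (take l w) + length (drop l w)" by simp
      moreover have "wdeg w = wdeg (take l w) + wdeg (drop l w)"
        by (metis append_take_drop_id map_append sum_list_append)
      moreover have "length w = i" "wdeg w = d" using that(1) by (simp_all add: admissible_iff[OF sc])
      ultimately show ?thesis using Ec[OF that(3)] by linarith
    qed
    show ?thesis
    proof (cases "l + j = i \<and> e \<le> d")
      case False
      then have "T2 l b w = 0" for w using nz[of w] by (auto simp: T2_def cup_def)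
      then have "T2 l b = (\<lambda>_. 0)" by blast
      then show ?thesis by (simp add: decomposable_zero)
    next
      case True
      have c': "cocycle D l (d - e) c'"
        unfolding cocycle_iff[OF sc] std_cocycle_def
      proof (intro conjI allI impI)
        fix w assume w: "std_word n D w"
        have "bar_d c' w = bar_d (\<lambda>v. (if wdeg w = d - e then 1 else 0) * c l b v) w"
        proof (rule bar_d_cong)
          fix w' assume "w' \<in> merges w"
          then have "wdeg w' = wdeg w" using wdeg_merges w by (auto simp: std_word_def)
          then show "c' w' = (if wdeg w = d - e then 1 else 0) * c l b w'" by (simp add: c'_def)
        qed
        also have "\<dots> = 0" unfolding bar_d_scale using c[OF b, of l] w by (simp add: std_cocycle_def)
        finally show "bar_d c' w = 0" .
      qed (use c[OF b, of l] in \<open>auto simp: c'_def std_cocycle_def split: if_splits\<close>)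
      have cup: "cocycle D (l + j) (d - e + e) (cup l c' ?E)"
        by (rule cocycle_cup[OF sc c']) (use gen12_cocycle[OF sc E] in blast)
      have "T2 l b w = (-1) ^ l * cup l c' ?E w" for w
      proof (cases "admissible D i d w")
        case adm: True
        have "cup l (c l b) ?E w = cup l c' ?E w"
          using nz[OF adm] by (auto simp: cup_def c'_def)
        then show ?thesis using adm by (simp add: T2_def)
      next
        case False
        then have "cup l c' ?E w = 0"
          using cup True by (auto simp: cocycle_def cochain_def)
        then show ?thesis using False by (simp add: T2_def)
      qed
      then have T2: "T2 l b = (\<lambda>w. (-1) ^ l * cup l c' ?E w)" by blast
      have "decomposable D (l + j) (d - e + e) (cup l c' ?E)"
      \<comment> \<open>In degree zero \<open>c'\<close> is the scalar \<open>c' []\<close> and the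
        cell class is already a generator; the induction hypothesis starts at degree one.\<close>
      proof (cases "l = 0")
        case l0: True
        then have eq: "cup l c' ?E = (\<lambda>w. c' [] * ?E w)" by (auto simp: cup_def)
        show ?thesis
        proof (cases "c' [] = 0")
          case True
          then show ?thesis unfolding eq by (simp add: decomposable_zero)
        next
          case False
          then have "d - e = 0" by (auto simp: c'_def split: if_splits)
          moreover have "decomposable D j e (\<lambda>w. c' [] * ?E w)"
            by (rule decomposable_scale, rule decomposable_gen, rule E)
          ultimately show ?thesis unfolding eq using l0 by simp
        qed
      next
        case False
        \<comment> \<open>Cell classes have degree \<open>j \<ge> 2\<close>, so
          \<open>l < i\<close>.\<close>
        have dc': "decomposable D l (d - e) c'"
          by (rule less.IH[OF _ _ c']) (use True False in \<open>auto simp: j_def\<close>)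
        show ?thesis by (rule decomposable_cup[OF sc dc' _ E]) (use False in simp)
      qed
      then show ?thesis unfolding T2 using True by (simp add: decomposable_scale)
    qed
  qed
  have "decomposable D i d (\<lambda>w. \<Sum>b\<in>?C. T1 b w)"
    by (rule decomposable_sum) (rule dT1)
  moreover have "decomposable D i d (\<lambda>w. \<Sum>l<i - 1. \<Sum>b\<in>J. T2 l b w)"
    by (intro decomposable_sum dT2)
  ultimately have "decomposable D i d (\<lambda>w. (\<Sum>b\<in>?C. T1 b w) + (\<Sum>l<i - 1. \<Sum>b\<in>J. T2 l b w) + cobd D r w)"
    by (intro decomposable_add decomposable_cobd r)
  then show ?case unfolding zeq[symmetric] .
qed

theorem theorem1p3:
  fixes n :: nat and D :: "nat set set"
  assumes "simplicial_complex n D"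
    and "\<forall>i\<in>{1..n}. {i} \<in> D"
    and "seq_CM TYPE('k::field) (alexander_dual n D)"
  shows "K2_face_ring TYPE('k) D"
proof -
  have det: "detects TYPE('k) n D" by (rule seq_CM_dual_imp_detects[OF assms(1,3)])
  have "decomposable D i d z" if "1 \<le> i" "cocycle D i d z" for i d and z :: "mono list \<Rightarrow> 'k"
    by (rule cocycle_decomposable[OF assms(1,2) det that])
  then show ?thesis unfolding K2_face_ring_def decomposable_def by blast
qed

end
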